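(* For every even integer $n \ge 6$ there exists a planar $2$-connected $n$-vertex graph $G$ with exactly four perfect matchings, minimum degree $3$, and exactly $\frac{3n}{2}+1$ edges. Moreover, the constant $4$ is best possible, that is, for every even $n \ge 6$, every planar $2$-connected $n$-vertex graph with minimum degree $3$ that has at least one perfect matching has at least four perfect matchings.
   Context: All graphs are finite and simple. *)

theory Defs
  imports "HOL-Analysis.Analysis"
begin

text \<open>An undirected graph is given by a vertex set \<open>V\<close> and a set \<open>E\<close> of two-element subsets of \<open>V\<close>.\<close>

definition simple_graph :: "'a set \<Rightarrow> 'a set set \<Rightarrow> bool" where
  "simple_graph V E \<longleftrightarrow> finite V \<and> (\<forall>e\<in>E. e \<subseteq> V \<and> card e = 2)"

definition degree :: "'a set set \<Rightarrow> 'a \<Rightarrow> nat" where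
  "degree E v = card {e \<in> E. v \<in> e}"

definition min_degree :: "'a set \<Rightarrow> 'a set set \<Rightarrow> nat" where
  "min_degree V E = Min (degree E ` V)"

definition graph_connected :: "'a set \<Rightarrow> 'a set set \<Rightarrow> bool" where
  "graph_connected V E \<longleftrightarrow>
     V \<noteq> {} \<and> (\<forall>u\<in>V. \<forall>v\<in>V. (u, v) \<in> {(x, y). {x, y} \<in> E}\<^sup>*)"

definition k_connected :: "nat \<Rightarrow> 'a set \<Rightarrow> 'a set set \<Rightarrow> bool" where
  "k_connected k V E \<longleftrightarrow>
     k < card V \<and>
     (\<forall>S\<subseteq>V. card S < k \<longrightarrow> graph_connected (V - S) {e \<in> E. e \<inter> S = {}})"

definition matching :: "'a set set \<Rightarrow> 'a set set \<Rightarrow> bool" where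
  "matching E M \<longleftrightarrow> M \<subseteq> E \<and> pairwise disjnt M"

definition perfect_matching :: "'a set \<Rightarrow> 'a set set \<Rightarrow> 'a set set \<Rightarrow> bool" where
  "perfect_matching V E M \<longleftrightarrow> matching E M \<and> \<Union>M = V"

text \<open>
  A plane drawing sends vertices to distinct points \<open>p v\<close> of the plane (here the type
  \<open>complex\<close>) and each edge \<open>e\<close> to an arc \<open>\<gamma> e\<close> joining the images of its two ends. The last
  two conditions say that the interior of an arc contains no vertex, and that two arcs
  meet only at the images of common ends.
\<close>

definition plane_drawing ::
    "'a set \<Rightarrow> 'a set set \<Rightarrow> ('a \<Rightarrow> complex) \<Rightarrow> ('a set \<Rightarrow> real \<Rightarrow> complex) \<Rightarrow> bool" where
  "plane_drawing V E p \<gamma> \<longleftrightarrow>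
     inj_on p V \<and>
     (\<forall>e\<in>E. arc (\<gamma> e) \<and> {pathstart (\<gamma> e), pathfinish (\<gamma> e)} = p ` e) \<and>
     (\<forall>e\<in>E. path_image (\<gamma> e) \<inter> p ` V \<subseteq> p ` e) \<and>
     (\<forall>e\<in>E. \<forall>f\<in>E. e \<noteq> f \<longrightarrow> path_image (\<gamma> e) \<inter> path_image (\<gamma> f) \<subseteq> p ` (e \<inter> f))"

definition planar :: "'a set \<Rightarrow> 'a set set \<Rightarrow> bool" where
  "planar V E \<longleftrightarrow> (\<exists>p \<gamma>. plane_drawing V E p \<gamma>)"

end

theory Submission imports Defs begin

text \<open>
  Lower bound. For a vertex \<open>v\<close> of a graph with a perfect matching, the
  Gallai--Edmonds type decomposition of \<open>G - v\<close> gives a set \<open>X\<close> containing \<open>v\<close> such that \<open>G - X\<close> falls into exactly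
  \<open>card X\<close> factor-critical parts, and every perfect matching matches \<open>X\<close> with the parts. If \<open>card X \<ge> 2\<close>, then
  each part can be completed by an outside vertex in at least three ways, involving at least two different vertices: either
  three edges leave the part, or only two do and contracting the complement yields a smaller graph with at
  least three perfect matchings by induction. Counting systems of distinct representatives
  in the manner of M. Hall then gives four perfect matchings. If \<open>card X = 1\<close> for every \<open>v\<close>, every edge lies in
  a perfect matching, so that fewer than four perfect matchings would have to be three disjoint ones; two of
  them form a Hamiltonian cycle, and suitable chords from the third one produce a fourth.

  Extremal graphs: take a ladder with a triangle glued to each end. By parity a perfect matching uses exactly one
  edge between consecutive rungs, alternately on the two rails, so only the choices at the two triangles are free.
\<close>

section \<open>Systems of distinct representatives\<close>

text \<open>A part may be completed by the same outside vertex in several ways, and these must be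
  counted separately. Hence the systems of representatives carry labels: the chosen objects are
  completions, and only their labels, the outside vertices, have to differ. A part left by only two
  edges yields a contracted vertex of degree two. The induction therefore exempts one vertex
  \<open>z\<close> from the degree condition and promises only three perfect matchings, which is
  just what a row requires. The exempted vertex spoils at most one row, while a minimal tight
  subsystem has at least two. Contraction could also merge parallel edges and so lower degrees
  inside the part; for two cut edges this is excluded by 2-connectedness, which gives them distinct
  inner ends. \<open>K4\<close> has exactly three perfect matchings. It is kept out by the
  requirement of five vertices, which enters where the four ends of two crossing chords must not
  exhaust the graph. In the extremal graphs each apex has a third edge to the second rung from its
  end; the degrees then sum to \<open>3*n + 2\<close>.\<close>

lemma hall:
  assumes "finite I" "\<And>i. i \<in> I \<Longrightarrow> finite (N i)"
    and "\<And>T. T \<subseteq> I \<Longrightarrow> card T \<le> card (\<Union>i\<in>T. N i)"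
  shows "\<exists>g. inj_on g I \<and> (\<forall>i\<in>I. g i \<in> N i)"
  using assms
proof (induction "card I" arbitrary: I N rule: less_induct)
  case (less I N)
  note fin = less.prems(1) and finN = less.prems(2) and hall = less.prems(3)
  show ?case
  proof (cases "\<exists>T. T \<subset> I \<and> T \<noteq> {} \<and> card T = card (\<Union>i\<in>T. N i)")
    case True
    then obtain T where T: "T \<subset> I" "T \<noteq> {}" "card T = card (\<Union>i\<in>T. N i)" by blast
    define U where "U = (\<Union>i\<in>T. N i)"
    have finT: "finite T" using T fin by (auto intro: finite_subset)
    then have finU: "finite U" using T finN by (auto simp: U_def)
    have "\<exists>g. inj_on g T \<and> (\<forall>i\<in>T. g i \<in> N i)"
    proof (rule less.hyps)
      show "card T < card I" using T(1) by (rule psubset_card_mono[OF fin])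
    qed (use T finT finN hall in auto)
    then obtain g where g: "inj_on g T" "\<forall>i\<in>T. g i \<in> N i" by blast
    \<comment> \<open>Splitting off a tight \<open>T\<close>: Hall's condition for \<open>R\<close>
      with the values of \<open>T\<close> removed is the one for \<open>R \<union> T\<close>,
      reduced by \<open>card T = card U\<close>.\<close>
    have "\<exists>h. inj_on h (I - T) \<and> (\<forall>i\<in>I - T. h i \<in> N i - U)"
    proof (rule less.hyps)
      show "card (I - T) < card I" using T by (intro psubset_card_mono[OF fin]) auto
    next
      fix R assume R: "R \<subseteq> I - T"
      have "card (R \<union> T) \<le> card (\<Union>i\<in>R \<union> T. N i)" using R T by (intro hall) auto
      also have "(\<Union>i\<in>R \<union> T. N i) = (\<Union>i\<in>R. N i - U) \<union> U" by (auto simp: U_def)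
      also have "card \<dots> \<le> card (\<Union>i\<in>R. N i - U) + card U" by (rule card_Un_le)
      finally have "card R + card T \<le> card (\<Union>i\<in>R. N i - U) + card U"
        using R finT fin by (subst (asm) card_Un_disjoint) (auto intro: finite_subset)
      then show "card R \<le> card (\<Union>i\<in>R. N i - U)" using T(3) by (simp add: U_def)
    qed (use fin finN in auto)
    then obtain h where h: "inj_on h (I - T)" "\<forall>i\<in>I - T. h i \<in> N i - U" by blast
    define k where "k i = (if i \<in> T then g i else h i)" for i
    have "inj_on k I"
    proof (rule inj_onI)
      fix x y assume xy: "x \<in> I" "y \<in> I" "k x = k y"
      have gU: "g z \<in> U" if "z \<in> T" for z using that g by (auto simp: U_def)
      have hU: "h z \<notin> U" if "z \<in> I" "z \<notin> T" for z using that h by blast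
      show "x = y"
      proof (cases "x \<in> T"; cases "y \<in> T")
        assume "x \<in> T" "y \<in> T"
        then show ?thesis using xy g(1) by (simp add: k_def inj_on_eq_iff)
      next
        assume "x \<notin> T" "y \<notin> T"
        then show ?thesis using xy h(1) by (simp add: k_def inj_on_eq_iff)
      qed (use xy gU[of x] gU[of y] hU[of x] hU[of y] in \<open>simp_all add: k_def\<close>)
    qed
    moreover have "\<forall>i\<in>I. k i \<in> N i" using g h by (auto simp: k_def)
    ultimately show ?thesis by blast
  next
    case no_tight: False
    show ?thesis
    proof (cases "I = {}")
      case False
      then obtain i where i: "i \<in> I" by blast
      have "card {i} \<le> card (\<Union>j\<in>{i}. N j)" using i by (intro hall) auto
      then have "N i \<noteq> {}" by auto
      then obtain x where x: "x \<in> N i" by blast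
      \<comment> \<open>Every proper nonempty subset has a value to spare here, so \<open>x\<close>
        can be given to \<open>i\<close> without harm to the others.\<close>
      have "\<exists>g. inj_on g (I - {i}) \<and> (\<forall>j\<in>I - {i}. g j \<in> N j - {x})"
      proof (rule less.hyps)
        show "card (I - {i}) < card I" using i fin by (meson card_Diff1_less)
      next
        fix R assume R: "R \<subseteq> I - {i}"
        show "card R \<le> card (\<Union>j\<in>R. N j - {x})"
        proof (cases "R = {}")
          case False
          have "R \<subset> I" using R i by blast
          then have "card R < card (\<Union>j\<in>R. N j)"
            using no_tight False hall[of R] by (meson le_neq_implies_less psubset_imp_subset)
          moreover have "(\<Union>j\<in>R. N j - {x}) = (\<Union>j\<in>R. N j) - {x}" by blast
          ultimately show ?thesis by (metis Suc_leI card_Diff_singleton_if diff_Suc_1 diff_le_mono le_SucI nat_less_le not_less_eq_eq)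
        qed auto
      qed (use fin finN in auto)
      then obtain g where g: "inj_on g (I - {i})" "\<forall>j\<in>I - {i}. g j \<in> N j - {x}" by blast
      have "inj_on (g(i := x)) I" using g by (auto simp: inj_on_def)
      moreover have "\<forall>j\<in>I. (g(i := x)) j \<in> N j" using g x by auto
      ultimately show ?thesis by blast
    qed auto
  qed
qed

text \<open>Rows consist of objects, \<open>f\<close> gives their labels, and distinctness is asked
  of the labels only; two choices that differ in an object with the same label count twice.
  \<open>PiE\<close> fixes the values outside \<open>I\<close>, so that counting choices makes
  sense.\<close>

definition sdrs :: "'i set \<Rightarrow> ('i \<Rightarrow> 'b set) \<Rightarrow> ('b \<Rightarrow> 'x) \<Rightarrow> ('i \<Rightarrow> 'b) set" where
  "sdrs I A f = {\<phi> \<in> PiE I A. inj_on (f \<circ> \<phi>) I}"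

text \<open>Once a solution exists, this says that the bipartite graph of rows and labels is
  elementary: every row-label pair that occurs extends to a solution.\<close>

definition irreducible_tight :: "'i set \<Rightarrow> ('i \<Rightarrow> 'b set) \<Rightarrow> ('b \<Rightarrow> 'x) \<Rightarrow> bool" where
  "irreducible_tight I A f \<longleftrightarrow> I \<noteq> {} \<and> card (\<Union>i\<in>I. f ` A i) = card I \<and>
     (\<forall>T. T \<subset> I \<longrightarrow> T \<noteq> {} \<longrightarrow> card (\<Union>i\<in>T. f ` A i) \<noteq> card T)"

lemma finite_sdrs: "finite I \<Longrightarrow> (\<And>i. i \<in> I \<Longrightarrow> finite (A i)) \<Longrightarrow> finite (sdrs I A f)"
  unfolding sdrs_def by (rule finite_subset[of _ "PiE I A"]) (auto intro: finite_PiE)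

lemma sdrs_nonempty:
  assumes "finite I" "\<And>i. i \<in> I \<Longrightarrow> finite (A i)"
    and "\<And>T. T \<subseteq> I \<Longrightarrow> card T \<le> card (\<Union>i\<in>T. f ` A i)"
  shows "sdrs I A f \<noteq> {}"
proof -
  obtain g where g: "inj_on g I" "\<forall>i\<in>I. g i \<in> f ` A i"
    using hall[of I "\<lambda>i. f ` A i"] assms by auto
  then have "\<forall>i\<in>I. \<exists>a\<in>A i. f a = g i" by (metis imageE)
  then obtain \<phi> where \<phi>: "\<forall>i\<in>I. \<phi> i \<in> A i \<and> f (\<phi> i) = g i" by metis
  have "restrict \<phi> I \<in> sdrs I A f"
    using \<phi> g by (auto simp: sdrs_def inj_on_def)
  then show ?thesis by blast
qed

lemma sdrs_hall:
  assumes "\<phi> \<in> sdrs I A f" "T \<subseteq> I" "finite I" "\<And>i. i \<in> I \<Longrightarrow> finite (A i)"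
  shows "card T \<le> card (\<Union>i\<in>T. f ` A i)"
proof (rule card_inj_on_le[of "f \<circ> \<phi>"])
  show "inj_on (f \<circ> \<phi>) T" using assms by (auto simp: sdrs_def intro: inj_on_subset)
  show "(f \<circ> \<phi>) ` T \<subseteq> (\<Union>i\<in>T. f ` A i)" using assms by (fastforce simp: sdrs_def PiE_def Pi_def)
  show "finite (\<Union>i\<in>T. f ` A i)" using assms by (meson finite_UN_I finite_imageI finite_subset subsetD)
qed

text \<open>A tight set of minimal size is irreducible. On a tight \<open>S\<close> any solution
  uses up all labels available to \<open>S\<close>, so a solution on \<open>S\<close> can be
  combined with the values of \<open>\<phi>\<close> outside \<open>S\<close>; this embeds the
  solutions on \<open>S\<close> into those on \<open>I\<close>.\<close>

lemma irreducible_tight_subset: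
  assumes fin: "finite I" "\<And>i. i \<in> I \<Longrightarrow> finite (A i)" and ne: "I \<noteq> {}"
    and \<phi>: "\<phi> \<in> sdrs I A f" and tight: "card (\<Union>i\<in>I. f ` A i) = card I"
  obtains S where "S \<subseteq> I" "irreducible_tight S A f" "sdrs S A f \<noteq> {}"
    "card (sdrs S A f) \<le> card (sdrs I A f)"
proof -
  let ?P = "\<lambda>S. S \<subseteq> I \<and> S \<noteq> {} \<and> card (\<Union>i\<in>S. f ` A i) = card S"
  obtain S where S: "?P S" and min: "\<And>T. ?P T \<Longrightarrow> card S \<le> card T"
    using ex_has_least_nat[of ?P I card] ne tight by blast
  have finS: "finite S" using S fin by (auto intro: finite_subset)
  have "irreducible_tight S A f"
    unfolding irreducible_tight_def
  proof (intro conjI allI impI notI)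
    fix T assume T: "T \<subset> S" "T \<noteq> {}" "card (\<Union>i\<in>T. f ` A i) = card T"
    then have "card S \<le> card T" using S by (intro min) auto
    then show False using T finS by (meson not_le psubset_card_mono)
  qed (use S in auto)
  moreover have res: "restrict \<phi> S \<in> sdrs S A f"
    using \<phi> S by (auto simp: sdrs_def PiE_def Pi_def inj_on_def subset_iff)
  moreover have "card (sdrs S A f) \<le> card (sdrs I A f)"
  proof (rule card_inj_on_le)
    let ?h = "\<lambda>\<psi> i. if i \<in> S then \<psi> i else \<phi> i"
    show "inj_on ?h (sdrs S A f)"
    proof (rule inj_onI)
      fix x y assume xy: "x \<in> sdrs S A f" "y \<in> sdrs S A f" "?h x = ?h y"
      show "x = y"
      proof
        fix i show "x i = y i"
          using xy fun_cong[OF xy(3), of i] by (cases "i \<in> S") (auto simp: sdrs_def PiE_def extensional_def)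
      qed
    qed
    show "?h ` sdrs S A f \<subseteq> sdrs I A f"
    proof
      fix \<psi>' assume "\<psi>' \<in> ?h ` sdrs S A f"
      then obtain \<psi> where \<psi>: "\<psi> \<in> sdrs S A f" and \<psi>': "\<psi>' = ?h \<psi>" by blast
      let ?N = "\<Union>i\<in>S. f ` A i"
      have finN: "finite ?N" using finS S fin by auto
      have sub: "(f \<circ> \<phi>) ` S \<subseteq> ?N" using \<phi> S by (fastforce simp: sdrs_def PiE_def Pi_def)
      have "inj_on (f \<circ> \<phi>) S" using \<phi> S by (auto simp: sdrs_def intro: inj_on_subset)
      then have "card ((f \<circ> \<phi>) ` S) = card ?N" using S by (metis card_image)
      then have all: "(f \<circ> \<phi>) ` S = ?N" using sub finN by (simp add: card_subset_eq)
      have out: "f (\<phi> i) \<notin> ?N" if "i \<in> I - S" for i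
      proof
        assume "f (\<phi> i) \<in> ?N"
        then obtain j where "j \<in> S" "f (\<phi> j) = f (\<phi> i)" using all by (metis comp_apply image_iff)
        then show False using \<phi> that S by (auto simp: sdrs_def inj_on_def)
      qed
      have "f (\<psi> i) \<in> ?N" if "i \<in> S" for i using \<psi> that by (auto simp: sdrs_def)
      note in_N = this
      have "inj_on (f \<circ> \<psi>') I"
      proof (rule inj_onI)
        fix i j assume ij: "i \<in> I" "j \<in> I" "(f \<circ> \<psi>') i = (f \<circ> \<psi>') j"
        show "i = j"
        proof (cases "i \<in> S"; cases "j \<in> S")
          assume "i \<in> S" "j \<in> S"
          then show ?thesis using ij \<psi> by (auto simp: \<psi>' sdrs_def inj_on_def)
        next
          assume "i \<notin> S" "j \<notin> S"
          then show ?thesis using ij \<phi> by (auto simp: \<psi>' sdrs_def inj_on_def)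
        qed (use ij in_N[of i] in_N[of j] out[of i] out[of j] in \<open>simp_all add: \<psi>'\<close>)
      qed
      moreover have "\<psi>' \<in> PiE I A"
        using \<phi> \<psi> S by (auto simp: \<psi>' sdrs_def PiE_def Pi_def extensional_def)
      ultimately show "\<psi>' \<in> sdrs I A f" by (simp add: sdrs_def)
    qed
    show "finite (sdrs I A f)" using fin by (intro finite_sdrs) auto
  qed
  ultimately show ?thesis using that S by blast
qed

text \<open>Fixing the representative \<open>a\<close> of \<open>i\<close> leaves the system on \<open>S - {i}\<close> with the value \<open>f a\<close> removed;
  irreducibility is what makes Hall's condition survive.\<close>

lemma reduced_sdrs_nonempty:
  assumes irr: "irreducible_tight S A f" and fin: "finite S" "\<And>i. i \<in> S \<Longrightarrow> finite (A i)"
    and ne: "sdrs S A f \<noteq> {}" and i: "i \<in> S"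
  shows "sdrs (S - {i}) (\<lambda>j. {b \<in> A j. f b \<noteq> x}) f \<noteq> {}"
proof (rule sdrs_nonempty)
  obtain \<phi> where \<phi>: "\<phi> \<in> sdrs S A f" using ne by blast
  fix T assume T: "T \<subseteq> S - {i}"
  show "card T \<le> card (\<Union>j\<in>T. f ` {b \<in> A j. f b \<noteq> x})"
  proof (cases "T = {}")
    case False
    have "T \<subset> S" using T i by blast
    then have "card (\<Union>j\<in>T. f ` A j) \<noteq> card T" using irr False by (auto simp: irreducible_tight_def)
    moreover have "card T \<le> card (\<Union>j\<in>T. f ` A j)"
      using sdrs_hall[OF \<phi>] T fin by blast
    moreover have "(\<Union>j\<in>T. f ` {b \<in> A j. f b \<noteq> x}) = (\<Union>j\<in>T. f ` A j) - {x}" by blast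
    ultimately show ?thesis by (metis Suc_leI card_Diff_singleton_if diff_Suc_1 diff_le_mono le_neq_implies_less)
  qed auto
qed (use fin in auto)

lemma sum_reduced_sdrs_le:
  assumes fin: "finite S" "\<And>i. i \<in> S \<Longrightarrow> finite (A i)" and i: "i \<in> S"
  shows "(\<Sum>a\<in>A i. card (sdrs (S - {i}) (\<lambda>j. {b \<in> A j. f b \<noteq> f a}) f)) \<le> card (sdrs S A f)"
proof -
  let ?R = "\<lambda>a. sdrs (S - {i}) (\<lambda>j. {b \<in> A j. f b \<noteq> f a}) f"
  have "(\<Sum>a\<in>A i. card (?R a)) = card (Sigma (A i) ?R)"
    using fin i by (intro card_SigmaI[symmetric] ballI finite_sdrs) auto
  also have "\<dots> \<le> card (sdrs S A f)"
  proof (rule card_inj_on_le)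
    let ?h = "\<lambda>(a, \<psi>). \<psi>(i := a)"
    show "inj_on ?h (Sigma (A i) ?R)"
    proof (rule inj_onI, clarify)
      fix a \<psi> a' \<psi>' assume *: "\<psi> \<in> ?R a" "\<psi>' \<in> ?R a'" "\<psi>(i := a) = \<psi>'(i := a')"
      have "\<psi> j = \<psi>' j" for j
      proof (cases "j = i")
        case True
        \<comment> \<open>Reduced solutions are extensional on \<open>S - {i}\<close>, so the update
          at \<open>i\<close> overwrites only the default value and loses nothing.\<close>
        have "\<psi> i = undefined" "\<psi>' i = undefined"
          using *(1,2) by (auto simp: sdrs_def PiE_def extensional_def)
        then show ?thesis using True by simp
      qed (use fun_cong[OF *(3), of j] in simp)
      then show "a = a' \<and> \<psi> = \<psi>'" using *(3) by (metis ext fun_upd_same)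
    qed
    show "?h ` Sigma (A i) ?R \<subseteq> sdrs S A f"
    proof clarify
      fix a \<psi> assume a: "a \<in> A i" and \<psi>: "\<psi> \<in> ?R a"
      have vals: "\<psi> j \<in> A j \<and> f (\<psi> j) \<noteq> f a" if "j \<in> S" "j \<noteq> i" for j
        using \<psi> that by (auto simp: sdrs_def PiE_def Pi_def)
      have inj: "j = k" if "j \<in> S" "j \<noteq> i" "k \<in> S" "k \<noteq> i" "f (\<psi> j) = f (\<psi> k)" for j k
        using \<psi> that by (auto simp: sdrs_def inj_on_def)
      have "inj_on (f \<circ> \<psi>(i := a)) S"
      proof (rule inj_onI)
        fix j k assume "j \<in> S" "k \<in> S" "(f \<circ> \<psi>(i := a)) j = (f \<circ> \<psi>(i := a)) k"
        then show "j = k" using vals[of j] vals[of k] inj[of j k] by (cases "j = i"; cases "k = i") auto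
      qed
      moreover have "\<psi>(i := a) \<in> PiE S A"
        using \<psi> a i vals by (auto simp: sdrs_def PiE_def Pi_def extensional_def)
      ultimately show "\<psi>(i := a) \<in> sdrs S A f" by (simp add: sdrs_def)
    qed
    show "finite (sdrs S A f)" using fin by (intro finite_sdrs) auto
  qed
  finally show ?thesis .
qed

text \<open>Irreducibility lets every element of a row extend to a solution, and different elements
  of one row give different solutions.\<close>

lemma card_row_le_sdrs:
  assumes "irreducible_tight S A f" "finite S" "\<And>i. i \<in> S \<Longrightarrow> finite (A i)"
    and "sdrs S A f \<noteq> {}" "i \<in> S"
  shows "card (A i) \<le> card (sdrs S A f)"
proof -
  have "card (A i) = (\<Sum>a\<in>A i. 1)" by simp
  also have "\<dots> \<le> (\<Sum>a\<in>A i. card (sdrs (S - {i}) (\<lambda>j. {b \<in> A j. f b \<noteq> f a}) f))"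
  proof (rule sum_mono)
    fix a assume "a \<in> A i"
    have "finite (sdrs (S - {i}) (\<lambda>j. {b \<in> A j. f b \<noteq> f a}) f)"
      using assms by (intro finite_sdrs) auto
    then show "1 \<le> card (sdrs (S - {i}) (\<lambda>j. {b \<in> A j. f b \<noteq> f a}) f)"
      using reduced_sdrs_nonempty[OF assms, of "f a"] by (simp add: Suc_leI card_gt_0_iff)
  qed
  also have "\<dots> \<le> card (sdrs S A f)" using assms by (intro sum_reduced_sdrs_le) auto
  finally show ?thesis .
qed

lemma irreducible_card_ge_2:
  assumes irr: "irreducible_tight S A f" and fin: "finite S" "\<And>i. i \<in> S \<Longrightarrow> finite (A i)"
    and two: "\<And>i. i \<in> S \<Longrightarrow> 2 \<le> card (f ` A i)"
  shows "2 \<le> card S"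
proof -
  obtain i where i: "i \<in> S" using irr by (auto simp: irreducible_tight_def)
  have "2 \<le> card (f ` A i)" by (rule two[OF i])
  also have "\<dots> \<le> card (\<Union>i\<in>S. f ` A i)" using fin i by (intro card_mono) auto
  finally show ?thesis using irr by (simp add: irreducible_tight_def)
qed

text \<open>One row \<open>k\<close> may be short; it will belong to the part containing a vertex
  without degree condition. An irreducible subsystem has at least two rows, hence one that differs
  from \<open>k\<close>, and that row alone gives three solutions.\<close>

lemma three_sdrs:
  assumes fin: "finite I" "\<And>i. i \<in> I \<Longrightarrow> finite (A i)" and ne: "I \<noteq> {}"
    and \<phi>: "sdrs I A f \<noteq> {}" and tight: "card (\<Union>i\<in>I. f ` A i) = card I"
    and two: "\<And>i. i \<in> I \<Longrightarrow> 2 \<le> card (f ` A i)"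
    and three: "\<And>i. i \<in> I \<Longrightarrow> i \<noteq> k \<Longrightarrow> 3 \<le> card (A i)"
  shows "3 \<le> card (sdrs I A f)"
proof -
  obtain \<phi> where "\<phi> \<in> sdrs I A f" using \<phi> by blast
  then obtain S where S: "S \<subseteq> I" "irreducible_tight S A f" "sdrs S A f \<noteq> {}"
    "card (sdrs S A f) \<le> card (sdrs I A f)"
    using irreducible_tight_subset[of I A \<phi> f] fin ne tight by auto
  have finS: "finite S" "\<And>i. i \<in> S \<Longrightarrow> finite (A i)" using S fin by (auto intro: finite_subset)
  have "2 \<le> card S" using S finS two by (intro irreducible_card_ge_2[of S A f]) auto
  then have "\<not> S \<subseteq> {k}" using card_mono[of "{k}" S] by auto
  then obtain i where i: "i \<in> S" "i \<noteq> k" by blast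
  have "3 \<le> card (A i)" using three i S by auto
  also have "\<dots> \<le> card (sdrs S A f)" using card_row_le_sdrs[OF S(2) finS S(3) i(1)] .
  finally show ?thesis using S(4) by simp
qed

text \<open>Multigraph form of the fact that a bipartite graph with a unique perfect matching has a
  vertex of degree one: a row of an irreducible subsystem has no more elements than there are
  solutions.\<close>

lemma unique_sdr_singleton_row:
  assumes fin: "finite I" "\<And>i. i \<in> I \<Longrightarrow> finite (A i)" and ne: "I \<noteq> {}"
    and tight: "card (\<Union>i\<in>I. f ` A i) = card I" and uniq: "card (sdrs I A f) = 1"
  shows "\<exists>i\<in>I. card (A i) \<le> 1"
proof -
  obtain \<phi> where "\<phi> \<in> sdrs I A f" using uniq by (metis card_1_singletonE singletonI)
  then obtain S where S: "S \<subseteq> I" "irreducible_tight S A f" "sdrs S A f \<noteq> {}"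
    "card (sdrs S A f) \<le> card (sdrs I A f)"
    using irreducible_tight_subset[of I A \<phi> f] fin ne tight by auto
  have finS: "finite S" "\<And>i. i \<in> S \<Longrightarrow> finite (A i)" using S fin by (auto intro: finite_subset)
  obtain i where i: "i \<in> S" using S(2) by (auto simp: irreducible_tight_def)
  have "card (A i) \<le> 1" using card_row_le_sdrs[OF S(2) finS S(3) i] S(4) uniq by simp
  then show ?thesis using i S by blast
qed

text \<open>If an irreducible system had only three solutions, every reduced system would have a unique one.
  Then each value \<open>x\<close> has its own row with at least two elements of value \<open>x\<close>, and choosing freely
  among these already gives \<open>2 ^ card S\<close> solutions.\<close>

lemma four_sdrs_irreducible:
  assumes irr: "irreducible_tight S A f" and fin: "finite S" "\<And>i. i \<in> S \<Longrightarrow> finite (A i)"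
    and ne: "sdrs S A f \<noteq> {}" and S2: "2 \<le> card S"
    and three: "\<And>i. i \<in> S \<Longrightarrow> 3 \<le> card (A i)"
  shows "4 \<le> card (sdrs S A f)"
proof (rule ccontr)
  assume few: "\<not> 4 \<le> card (sdrs S A f)"
  let ?N = "\<Union>i\<in>S. f ` A i"
  let ?B = "\<lambda>x j. {b \<in> A j. f b \<noteq> x}"
  have cN: "card ?N = card S" using irr by (simp add: irreducible_tight_def)
  have finN: "finite ?N" using fin by auto
  have row: "\<exists>j\<in>S. card (?B x j) \<le> 1" if x: "x \<in> ?N" for x
  proof -
    obtain i a where i: "i \<in> S" and a: "a \<in> A i" and xa: "x = f a" using x by blast
    let ?R = "\<lambda>a. sdrs (S - {i}) (?B (f a)) f"
    have finR: "finite (?R a)" for a using fin by (intro finite_sdrs) auto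
    have neR: "?R a \<noteq> {}" for a using reduced_sdrs_nonempty[OF irr fin ne i] by blast
    have pos: "1 \<le> card (?R a)" for a using finR neR by (simp add: Suc_leI card_gt_0_iff)
    \<comment> \<open>The other elements of the row, at least two, contribute one solution each. A
      second solution through \<open>a\<close> would make four.\<close>
    have "card (?R a) = 1"
    proof (rule ccontr)
      assume "card (?R a) \<noteq> 1"
      then have "2 \<le> card (?R a)" using pos[of a] by simp
      moreover have "card (A i - {a}) \<le> (\<Sum>b\<in>A i - {a}. card (?R b))"
        using sum_mono[of "A i - {a}" "\<lambda>_. 1::nat" "\<lambda>b. card (?R b)"] pos by simp
      moreover have "(\<Sum>b\<in>A i. card (?R b)) = card (?R a) + (\<Sum>b\<in>A i - {a}. card (?R b))"
        using a fin(2)[OF i] by (simp add: sum.remove)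
      moreover have "(\<Sum>b\<in>A i. card (?R b)) \<le> card (sdrs S A f)"
        using fin i by (intro sum_reduced_sdrs_le) auto
      moreover have "2 \<le> card (A i - {a})" using three[OF i] a by simp
      ultimately show False using few by linarith
    qed
    moreover have "card (\<Union>j\<in>S - {i}. f ` ?B (f a) j) = card (S - {i})"
    proof (rule antisym)
      have "card (\<Union>j\<in>S - {i}. f ` ?B (f a) j) \<le> card (?N - {x})"
        using finN xa by (intro card_mono) auto
      also have "\<dots> = card (S - {i})" using x cN i by simp
      finally show "card (\<Union>j\<in>S - {i}. f ` ?B (f a) j) \<le> card (S - {i})" .
      obtain \<phi> where "\<phi> \<in> ?R a" using neR by blast
      then show "card (S - {i}) \<le> card (\<Union>j\<in>S - {i}. f ` ?B (f a) j)"
        by (rule sdrs_hall) (use fin in auto)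
    qed
    moreover have "S - {i} \<noteq> {}"
    proof
      assume "S - {i} = {}"
      then have "card S \<le> card {i}" by (intro card_mono) auto
      then show False using S2 by simp
    qed
    ultimately have "\<exists>j\<in>S - {i}. card (?B (f a) j) \<le> 1"
      by (intro unique_sdr_singleton_row[of "S - {i}" "?B (f a)" f]) (use fin in auto)
    then show ?thesis using xa by blast
  qed
  then obtain j where j: "\<And>x. x \<in> ?N \<Longrightarrow> j x \<in> S \<and> card (?B x (j x)) \<le> 1" by metis
  let ?C = "\<lambda>x. {b \<in> A (j x). f b = x}"
  have C2: "2 \<le> card (?C x)" if "x \<in> ?N" for x
  proof -
    have "A (j x) = ?C x \<union> ?B x (j x)" by blast
    then have "card (A (j x)) \<le> card (?C x) + card (?B x (j x))" by (metis (lifting) card_Un_le)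
    then show ?thesis using three[of "j x"] j[OF that] by linarith
  qed
  \<comment> \<open>If \<open>x\<close> and \<open>y\<close> shared a row, the two or more elements
    labelled \<open>x\<close> would be among its at most one element not labelled
    \<open>y\<close>.\<close>
  have injj: "inj_on j ?N"
  proof (rule inj_onI, rule ccontr)
    fix x y assume xy: "x \<in> ?N" "y \<in> ?N" "j x = j y" "x \<noteq> y"
    have "card (?C x) \<le> card (?B y (j y))"
      using xy fin j[OF xy(2)] by (intro card_mono) auto
    then show False using C2[OF xy(1)] j[OF xy(2)] by linarith
  qed
  have jS: "j ` ?N = S"
  proof (rule card_subset_eq[OF fin(1)])
    show "j ` ?N \<subseteq> S" using j by blast
    show "card (j ` ?N) = card S" using injj cN by (simp add: card_image)
  qed
  define k where "k = the_inv_into ?N j"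
  have k: "k i \<in> ?N \<and> j (k i) = i" if "i \<in> S" for i
    using that jS injj by (metis f_the_inv_into_f k_def the_inv_into_into order_refl)
  let ?D = "\<lambda>i. {b \<in> A i. f b = k i}"
  have D2: "2 \<le> card (?D i)" if "i \<in> S" for i using C2[of "k i"] k[OF that] by simp
  have "PiE S ?D \<subseteq> sdrs S A f"
  proof
    fix \<phi> assume \<phi>: "\<phi> \<in> PiE S ?D"
    have "f (\<phi> i) = k i" if "i \<in> S" for i using \<phi> that by (auto simp: PiE_def Pi_def)
    moreover have "inj_on k S" using k by (metis inj_onI)
    ultimately have "inj_on (f \<circ> \<phi>) S" by (auto simp: inj_on_def)
    then show "\<phi> \<in> sdrs S A f" using \<phi> by (auto simp: sdrs_def PiE_def Pi_def)
  qed
  then have "card (PiE S ?D) \<le> card (sdrs S A f)"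
    using fin by (intro card_mono finite_sdrs) auto
  moreover have "card (PiE S ?D) = (\<Prod>i\<in>S. card (?D i))" using fin by (intro card_PiE)
  moreover have "(\<Prod>i\<in>S. 2::nat) \<le> (\<Prod>i\<in>S. card (?D i))" using D2 by (intro prod_mono) auto
  moreover have "(2::nat) ^ 2 \<le> 2 ^ card S" using S2 by (intro power_increasing) auto
  ultimately show False using few by simp
qed

lemma four_sdrs:
  assumes fin: "finite I" "\<And>i. i \<in> I \<Longrightarrow> finite (A i)" and ne: "I \<noteq> {}"
    and \<phi>: "sdrs I A f \<noteq> {}" and tight: "card (\<Union>i\<in>I. f ` A i) = card I"
    and two: "\<And>i. i \<in> I \<Longrightarrow> 2 \<le> card (f ` A i)"
    and three: "\<And>i. i \<in> I \<Longrightarrow> 3 \<le> card (A i)"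
  shows "4 \<le> card (sdrs I A f)"
proof -
  obtain \<phi> where "\<phi> \<in> sdrs I A f" using \<phi> by blast
  then obtain S where S: "S \<subseteq> I" "irreducible_tight S A f" "sdrs S A f \<noteq> {}"
    "card (sdrs S A f) \<le> card (sdrs I A f)"
    using irreducible_tight_subset[of I A \<phi> f] fin ne tight by auto
  have finS: "finite S" "\<And>i. i \<in> S \<Longrightarrow> finite (A i)" using S fin by (auto intro: finite_subset)
  have "2 \<le> card S" using S finS two by (intro irreducible_card_ge_2[of S A f]) auto
  then have "4 \<le> card (sdrs S A f)"
    using S finS three by (intro four_sdrs_irreducible) auto
  then show ?thesis using S(4) by simp
qed

section \<open>Perfect matchings\<close>

lemma perfect_matching_even:
  assumes M: "perfect_matching W E M" and fin: "finite W" and E: "\<forall>e\<in>E. card e = 2"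
  shows "even (card W)"
proof -
  have "card (\<Union>M) = (\<Sum>e\<in>M. card e)"
    using M fin by (intro card_Union_disjoint) (auto simp: perfect_matching_def matching_def intro: finite_subset)
  also have "\<dots> = (\<Sum>e\<in>M. 2)"
    using M E by (intro sum.cong) (auto simp: perfect_matching_def matching_def)
  finally show ?thesis using M by (simp add: perfect_matching_def)
qed

lemma perfect_matching_UN:
  assumes "\<And>i. i \<in> I \<Longrightarrow> perfect_matching (W i) E (P i)" "disjoint_family_on W I"
  shows "perfect_matching (\<Union>i\<in>I. W i) E (\<Union>i\<in>I. P i)"
proof -
  have "disjnt e d" if "e \<in> P i" "d \<in> P j" "i \<in> I" "j \<in> I" "e \<noteq> d" for e d i j
  proof (cases "i = j")
    case True
    then show ?thesis
      using that assms(1)[of i] by (auto simp: perfect_matching_def matching_def pairwise_def)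
  next
    case False
    then have "W i \<inter> W j = {}" using assms(2) that by (auto simp: disjoint_family_on_def)
    moreover have "e \<subseteq> W i" "d \<subseteq> W j"
      using that assms(1)[of i] assms(1)[of j] by (auto simp: perfect_matching_def)
    ultimately show ?thesis by (auto simp: disjnt_def)
  qed
  moreover have "\<Union>(P i) = W i" "P i \<subseteq> E" if "i \<in> I" for i
    using assms(1)[OF that] by (auto simp: perfect_matching_def matching_def)
  ultimately show ?thesis
    unfolding perfect_matching_def matching_def pairwise_def by fastforce
qed

lemma perfect_matching_edge: "e \<in> E \<Longrightarrow> perfect_matching e E {e}"
  by (simp add: perfect_matching_def matching_def)

lemma perfect_matching_Un:
  assumes "perfect_matching A E M" "perfect_matching B E N" "A \<inter> B = {}"
  shows "perfect_matching (A \<union> B) E (M \<union> N)"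
proof -
  have "perfect_matching (\<Union>b\<in>UNIV. if b then A else B) E (\<Union>b\<in>UNIV. if b then M else N)"
    by (rule perfect_matching_UN) (use assms in \<open>auto simp: disjoint_family_on_def\<close>)
  then show ?thesis by (simp add: UNIV_bool Un_commute)
qed

lemma perfect_matching_insert:
  assumes "perfect_matching W E M" "e \<in> E" "e \<inter> W = {}"
  shows "perfect_matching (e \<union> W) E (insert e M)"
  using perfect_matching_Un[OF perfect_matching_edge[OF assms(2)] assms(1,3)] by simp

lemma perfect_matching_restrict:
  assumes M: "perfect_matching W E M" and U: "U \<subseteq> W" "\<And>e. e \<in> M \<Longrightarrow> e \<inter> U \<noteq> {} \<Longrightarrow> e \<subseteq> U"
  shows "perfect_matching U E {e \<in> M. e \<subseteq> U}"
proof -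
  have "\<Union>{e \<in> M. e \<subseteq> U} = U"
    using M U unfolding perfect_matching_def by blast
  then show ?thesis
    using M by (auto simp: perfect_matching_def matching_def pairwise_def)
qed

lemma perfect_matching_remove:
  assumes M: "perfect_matching W E M" and e: "e \<in> M" "e \<noteq> {}"
  shows "perfect_matching (W - e) E (M - {e})"
proof -
  have "disjnt d e" if "d \<in> M - {e}" for d
    using M e that by (auto simp: perfect_matching_def matching_def pairwise_def)
  then have "\<Union>(M - {e}) = W - e"
    using M e unfolding perfect_matching_def disjnt_def by blast
  then show ?thesis
    using M by (auto simp: perfect_matching_def matching_def pairwise_def)
qed

lemma perfect_matching_mono: "perfect_matching W E M \<Longrightarrow> M \<subseteq> F \<Longrightarrow> perfect_matching W F M"
  by (auto simp: perfect_matching_def matching_def)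

lemma perfect_matching_edge_unique:
  assumes "perfect_matching W E M" "d \<in> M" "e \<in> M" "v \<in> d" "v \<in> e"
  shows "d = e"
proof (rule ccontr)
  assume "d \<noteq> e"
  then have "disjnt d e" using assms by (auto simp: perfect_matching_def matching_def pairwise_def)
  then show False using assms by (auto simp: disjnt_def)
qed

lemma perfect_matching_subset: "perfect_matching W E M \<Longrightarrow> e \<in> M \<Longrightarrow> e \<subseteq> W \<and> e \<in> E"
  by (auto simp: perfect_matching_def matching_def)

lemma finite_perfect_matchings:
  assumes "finite W" shows "finite {M. perfect_matching W E M}"
  by (rule finite_subset[of _ "Pow (Pow W)"]) (use assms in \<open>auto simp: perfect_matching_def\<close>)

lemma card_2_other:
  assumes "card e = 2" "v \<in> e" obtains u where "u \<noteq> v" "e = {v, u}"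
  using assms by (metis card_2_iff doubleton_eq_iff insert_iff singletonD)

section \<open>Factor-critical sets and the decomposition theorem\<close>

text \<open>The full edge set \<open>E\<close> can be kept, because a perfect matching of
  \<open>C - {c}\<close> has this set as its union and so uses only edges inside it. Single vertices
  qualify by the empty matching.\<close>

definition factor_critical :: "'a set set \<Rightarrow> 'a set \<Rightarrow> bool" where
  "factor_critical E C \<longleftrightarrow> C \<noteq> {} \<and> (\<forall>c\<in>C. \<exists>M. perfect_matching (C - {c}) E M)"

lemma factor_critical_odd:
  assumes "factor_critical E C" "finite C" "\<forall>e\<in>E. card e = 2"
  shows "odd (card C)"
proof -
  obtain c M where c: "c \<in> C" "perfect_matching (C - {c}) E M"
    using assms(1) unfolding factor_critical_def by blast
  then have "even (card (C - {c}))" using assms by (intro perfect_matching_even) auto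
  moreover have "card C = Suc (card (C - {c}))" using c assms by (metis card_Suc_Diff1)
  ultimately show ?thesis by simp
qed

text \<open>Without an edge between \<open>A\<close> and \<open>B\<close>, deleting a vertex of
  \<open>A\<close> leaves \<open>B\<close> perfectly matched in itself, so \<open>card B\<close> is
  even, and likewise \<open>card A\<close>. But a factor-critical set has odd size.\<close>

lemma factor_critical_connected:
  assumes C: "factor_critical E C" and fin: "finite C" and E: "\<forall>e\<in>E. card e = 2"
    and AB: "A \<noteq> {}" "B \<noteq> {}" "A \<inter> B = {}" "A \<union> B = C"
  shows "\<exists>a\<in>A. \<exists>b\<in>B. {a, b} \<in> E"
proof (rule ccontr)
  assume no: "\<not> ?thesis"
  have even_side: "even (card B')"
    if sides: "A' \<noteq> {}" "A' \<inter> B' = {}" "A' \<union> B' = C" "\<not> (\<exists>a\<in>A'. \<exists>b\<in>B'. {a, b} \<in> E)" for A' B'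
  proof -
    obtain a where a: "a \<in> A'" using sides by blast
    then have "a \<in> C" using sides by blast
    then obtain M where M: "perfect_matching (C - {a}) E M" using C unfolding factor_critical_def by blast
    have "perfect_matching B' E {e \<in> M. e \<subseteq> B'}"
    proof (rule perfect_matching_restrict[OF M])
      fix e assume e: "e \<in> M" "e \<inter> B' \<noteq> {}"
      then have "e \<in> E" "e \<subseteq> C" using perfect_matching_subset[OF M] by auto
      moreover obtain v where v: "v \<in> e" "v \<in> B'" using e by blast
      moreover obtain u where "e = {v, u}" using card_2_other[of e v] E \<open>e \<in> E\<close> v by metis
      ultimately show "e \<subseteq> B'" using sides by (auto simp: insert_commute)
    qed (use sides a in blast)
    then show ?thesis using sides fin E by (auto intro: perfect_matching_even)
  qed
  have "even (card B)" using AB no by (intro even_side[of A B]) auto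
  moreover have "\<not> (\<exists>a\<in>B. \<exists>b\<in>A. {a, b} \<in> E)" using no by (metis insert_commute)
  then have "even (card A)" using AB by (intro even_side[of B A]) auto
  moreover have "card C = card A + card B" using AB fin by (metis card_Un_disjoint finite_Un)
  ultimately show False using factor_critical_odd[OF C fin E] by simp
qed

section \<open>Decomposition into factor-critical parts\<close>

definition neighbour_parts :: "'a set set \<Rightarrow> 'a set set \<Rightarrow> 'a set \<Rightarrow> 'a set set" where
  "neighbour_parts E \<C> T = {C \<in> \<C>. \<exists>t\<in>T. \<exists>c\<in>C. {t, c} \<in> E}"

text \<open>The strong form of Tutte's theorem: \<open>S\<close> is matchable into the components of
  \<open>W - S\<close>, all of which are factor-critical. Matchability is expressed by Hall's
  condition on the side of \<open>S\<close>.\<close>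

definition factor_decomposition :: "'a set set \<Rightarrow> 'a set \<Rightarrow> 'a set \<Rightarrow> 'a set set \<Rightarrow> bool" where
  "factor_decomposition E W S \<C> \<longleftrightarrow> S \<subseteq> W \<and> disjoint \<C> \<and> \<Union>\<C> = W - S \<and>
     (\<forall>C\<in>\<C>. factor_critical E C) \<and>
     (\<forall>C\<in>\<C>. \<forall>c\<in>C. \<forall>d\<in>W - S - C. {c, d} \<notin> E) \<and>
     (\<forall>T\<subseteq>S. card T \<le> card (neighbour_parts E \<C> T))"

text \<open>The competitors of the extremal argument satisfy only these weak conditions; covering
  \<open>W - S\<close>, factor-criticality and Hall's condition are drawn from maximality.\<close>

definition odd_family :: "'a set set \<Rightarrow> 'a set \<Rightarrow> 'a set \<Rightarrow> 'a set set \<Rightarrow> bool" where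
  "odd_family E W S \<C> \<longleftrightarrow> S \<subseteq> W \<and> disjoint \<C> \<and> \<Union>\<C> \<subseteq> W - S \<and> (\<forall>C\<in>\<C>. odd (card C)) \<and>
     (\<forall>C\<in>\<C>. \<forall>c\<in>C. \<forall>d\<in>W - S - C. {c, d} \<notin> E)"

lemma sum_card_odd_parity:
  assumes "finite \<C>" "\<And>C. C \<in> \<C> \<Longrightarrow> finite C \<and> odd (card C)" "disjoint \<C>"
  shows "even (card (\<Union>\<C>)) \<longleftrightarrow> even (card \<C>)"
proof -
  have "card (\<Union>\<C>) = (\<Sum>C\<in>\<C>. card C)"
    using assms by (intro card_Union_disjoint) (auto simp: disjoint_def pairwise_def disjnt_def)
  moreover have "even (\<Sum>C\<in>\<C>. card C) \<longleftrightarrow> even (card \<C>)"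
    using assms(1,2) by (induction \<C>) auto
  ultimately show ?thesis by simp
qed

text \<open>Each \<open>s\<close> is joined to some vertex \<open>c\<close> of its part, and the
  rest of the part is matched by factor-criticality.\<close>

lemma matched_parts_perfect_matching:
  assumes parts: "\<And>C. C \<in> \<C> \<Longrightarrow> factor_critical E C" and disj: "disjoint \<C>"
    and S: "S \<inter> \<Union>\<C> = {}" and g: "bij_betw g S \<C>"
    and edge: "\<And>s. s \<in> S \<Longrightarrow> \<exists>c\<in>g s. {s, c} \<in> E"
  shows "\<exists>M. perfect_matching (S \<union> \<Union>\<C>) E M"
proof -
  have gC: "g s \<in> \<C>" if "s \<in> S" for s using g that by (auto simp: bij_betw_def)
  have "\<exists>P. perfect_matching (insert s (g s)) E P" if s: "s \<in> S" for s
  proof -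
    obtain c where c: "c \<in> g s" "{s, c} \<in> E" using edge s by blast
    obtain M where "perfect_matching (g s - {c}) E M"
      using parts[OF gC[OF s]] c by (auto simp: factor_critical_def)
    then have "perfect_matching ({s, c} \<union> (g s - {c})) E (insert {s, c} M)"
      using c S gC[OF s] s by (intro perfect_matching_insert) auto
    moreover have "{s, c} \<union> (g s - {c}) = insert s (g s)" using c by blast
    ultimately show ?thesis by metis
  qed
  then obtain P where P: "\<And>s. s \<in> S \<Longrightarrow> perfect_matching (insert s (g s)) E (P s)" by metis
  have "perfect_matching (\<Union>s\<in>S. insert s (g s)) E (\<Union>s\<in>S. P s)"
  proof (rule perfect_matching_UN[OF P])
    show "disjoint_family_on (\<lambda>s. insert s (g s)) S"
      unfolding disjoint_family_on_def
    proof (intro ballI impI)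
      fix s t assume st: "s \<in> S" "t \<in> S" "s \<noteq> t"
      then have "g s \<noteq> g t" using g by (auto simp: bij_betw_def inj_on_def)
      then have "g s \<inter> g t = {}" using disj gC st by (auto simp: disjoint_def)
      moreover have "s \<notin> g t" "t \<notin> g s" using S gC st by auto
      ultimately show "insert s (g s) \<inter> insert t (g t) = {}" using st by auto
    qed
  qed
  moreover have "(\<Union>s\<in>S. insert s (g s)) = S \<union> \<Union>\<C>" using g by (auto simp: bij_betw_def)
  ultimately show ?thesis by metis
qed

text \<open>Hall's theorem matches \<open>S\<close> injectively into the parts; equal numbers make
  this a bijection, so no part is left over.\<close>

lemma factor_decomposition_perfect_matching:
  assumes dec: "factor_decomposition E W S \<C>" and fin: "finite W" and card: "card \<C> = card S"
  shows "\<exists>M. perfect_matching W E M"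
proof -
  have finS: "finite S" using dec fin by (auto simp: factor_decomposition_def intro: finite_subset)
  have "\<Union>\<C> \<subseteq> W" using dec by (auto simp: factor_decomposition_def)
  then have "finite (\<Union>\<C>)" using fin by (rule finite_subset)
  then have finC: "finite \<C>" by (rule finite_UnionD)
  let ?N = "\<lambda>s. neighbour_parts E \<C> {s}"
  have "\<exists>g. inj_on g S \<and> (\<forall>s\<in>S. g s \<in> ?N s)"
  proof (rule hall[OF finS])
    show "finite (?N s)" for s using finC by (auto simp: neighbour_parts_def)
    fix T assume "T \<subseteq> S"
    moreover have "(\<Union>s\<in>T. ?N s) = neighbour_parts E \<C> T" by (auto simp: neighbour_parts_def)
    ultimately show "card T \<le> card (\<Union>s\<in>T. ?N s)" using dec by (simp add: factor_decomposition_def)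
  qed
  then obtain g where g: "inj_on g S" "\<And>s. s \<in> S \<Longrightarrow> g s \<in> ?N s" by blast
  have "g ` S = \<C>"
  proof (rule card_subset_eq[OF finC])
    show "g ` S \<subseteq> \<C>" using g by (auto simp: neighbour_parts_def)
    show "card (g ` S) = card \<C>" using g card by (simp add: card_image)
  qed
  then have "bij_betw g S \<C>" using g by (simp add: bij_betw_def)
  then have "\<exists>M. perfect_matching (S \<union> \<Union>\<C>) E M"
    by (rule matched_parts_perfect_matching[rotated 3])
       (use dec g in \<open>auto simp: factor_decomposition_def neighbour_parts_def\<close>)
  moreover have "S \<union> \<Union>\<C> = W" using dec by (auto simp: factor_decomposition_def)
  ultimately show ?thesis by simp
qed

text \<open>Among the families of odd sets that are unions of components of \<open>W - S\<close>, one maximising first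
  \<open>card \<C> - card S\<close> and then \<open>card S\<close> is a decomposition into factor-critical parts.\<close>

theorem factor_decomposition_exists:
  assumes "finite W" "\<forall>e\<in>E. card e = 2"
  shows "\<exists>S \<C>. factor_decomposition E W S \<C>"
  using assms
proof (induction "card W" arbitrary: W rule: less_induct)
  case (less W)
  note fin = less.prems(1) and E = less.prems(2)
  have bound: "card \<C> \<le> card W" "card S \<le> card W" "finite \<C>" "finite S" if "odd_family E W S \<C>" for S \<C>
  proof -
    have "\<Union>\<C> \<subseteq> W" using that by (auto simp: odd_family_def)
    then have fU: "finite (\<Union>\<C>)" using fin by (rule finite_subset)
    then show fC: "finite \<C>" by (rule finite_UnionD)
    show "card S \<le> card W" using that fin by (auto simp: odd_family_def intro: card_mono)
    show "finite S" using that fin by (auto simp: odd_family_def intro: finite_subset)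
    have "card \<C> = (\<Sum>C\<in>\<C>. 1)" by simp
    also have "\<dots> \<le> (\<Sum>C\<in>\<C>. card C)"
      using that by (intro sum_mono) (auto simp: odd_family_def Suc_leI odd_pos)
    also have "\<dots> = card (\<Union>\<C>)"
      using that fU by (intro card_Union_disjoint[symmetric])
        (auto simp: odd_family_def disjoint_def pairwise_def disjnt_def intro: finite_subset)
    also have "\<dots> \<le> card W" using \<open>\<Union>\<C> \<subseteq> W\<close> fin by (rule card_mono[rotated])
    finally show "card \<C> \<le> card W" .
  qed
  \<comment> \<open>The base \<open>?w\<close> exceeds every possible \<open>card S\<close>, so
    \<open>?f\<close> encodes the lexicographic order; the summand \<open>?w\<close> keeps the
    subtraction of naturals exact.\<close>
  let ?w = "Suc (card W)"
  let ?f = "\<lambda>(S, \<C>). (card \<C> + ?w - card S) * ?w + card S"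
  let ?P = "\<lambda>(S, \<C>). odd_family E W S \<C>"
  have "?P ({}, {})" by (simp add: odd_family_def)
  moreover have "\<forall>y. ?P y \<longrightarrow> ?f y < (2 * ?w) * ?w + ?w"
  proof (clarify)
    fix S \<C> assume "odd_family E W S \<C>"
    note b = bound[OF this]
    have "(card \<C> + ?w - card S) * ?w \<le> (2 * ?w) * ?w" using b by (intro mult_le_mono1) simp
    then show "(card \<C> + ?w - card S) * ?w + card S < (2 * ?w) * ?w + ?w" using b by simp
  qed
  ultimately obtain x where x: "?P x" "\<And>y. ?P y \<Longrightarrow> ?f y \<le> ?f x"
    using ex_has_greatest_nat[of ?P "({}, {})" ?f] by blast
  obtain S \<C> where SC: "x = (S, \<C>)" by (cases x)
  have odd: "odd_family E W S \<C>" using x SC by simp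
  note fC = bound(3)[OF odd] and fS = bound(4)[OF odd]
  have max: "card \<D> + card S \<le> card \<C> + card R"
    and max_eq: "card \<D> + card S = card \<C> + card R \<Longrightarrow> card R \<le> card S"
    if R: "odd_family E W R \<D>" for R \<D>
  proof -
    have le: "(card \<D> + ?w - card R) * ?w + card R \<le> (card \<C> + ?w - card S) * ?w + card S"
      using x(2)[of "(R, \<D>)"] R SC by simp
    note b = bound[OF odd] bound[OF R]
    show "card \<D> + card S \<le> card \<C> + card R"
    proof (rule ccontr)
      assume "\<not> ?thesis"
      then have "Suc (card \<C> + ?w - card S) \<le> card \<D> + ?w - card R" using b by simp
      then have "Suc (card \<C> + ?w - card S) * ?w \<le> (card \<D> + ?w - card R) * ?w" by (rule mult_le_mono1)
      then show False using le b by simp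
    qed
    show "card R \<le> card S" if "card \<D> + card S = card \<C> + card R"
    proof -
      have "card \<D> + ?w - card R = card \<C> + ?w - card S" using that b by simp
      then show ?thesis using le by simp
    qed
  qed
  have S: "S \<subseteq> W" and disj: "disjoint \<C>" and UC: "\<Union>\<C> \<subseteq> W - S"
    and oddC: "\<And>C. C \<in> \<C> \<Longrightarrow> odd (card C)"
    and iso: "\<And>C c d. C \<in> \<C> \<Longrightarrow> c \<in> C \<Longrightarrow> d \<in> W - S - C \<Longrightarrow> {c, d} \<notin> E"
    using odd by (auto simp: odd_family_def)
  have crit: "factor_critical E C" if C: "C \<in> \<C>" for C
    unfolding factor_critical_def
  proof (intro conjI ballI, use oddC[OF C] in force, rule ccontr)
    fix c assume c: "c \<in> C" and no: "\<nexists>M. perfect_matching (C - {c}) E M"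
    have CW: "C \<subseteq> W - S" using C UC by blast
    then have finC: "finite C" using fin by (auto intro: finite_subset)
    have "card (C - {c}) < card C" using c finC by (metis card_Diff1_less)
    also have "card C \<le> card W" using CW fin by (intro card_mono) auto
    finally have "\<exists>R \<D>. factor_decomposition E (C - {c}) R \<D>"
      using finC E by (intro less.hyps) auto
    then obtain R \<D> where dec: "factor_decomposition E (C - {c}) R \<D>" by blast
    then have R: "R \<subseteq> C - {c}" and dD: "disjoint \<D>" and UD: "\<Union>\<D> = C - {c} - R"
      and cD: "\<And>D. D \<in> \<D> \<Longrightarrow> factor_critical E D"
      and isoD: "\<And>D d v. D \<in> \<D> \<Longrightarrow> d \<in> D \<Longrightarrow> v \<in> C - {c} - R - D \<Longrightarrow> {d, v} \<notin> E"
      by (auto simp: factor_decomposition_def)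
    have finR: "finite R" using R finC by (auto intro: finite_subset)
    have finUD: "finite (\<Union>\<D>)" using UD finC by simp
    then have finD: "finite \<D>" by (rule finite_UnionD)
    have fD: "finite D \<and> odd (card D)" if "D \<in> \<D>" for D
    proof -
      have "finite D" using that finUD by (meson Union_upper finite_subset)
      then show ?thesis using factor_critical_odd[OF cD[OF that] _ E] by simp
    qed
    have "card R \<le> card (neighbour_parts E \<D> R)" using dec by (simp add: factor_decomposition_def)
    also have "\<dots> \<le> card \<D>" using finD by (intro card_mono) (auto simp: neighbour_parts_def)
    finally have "card R \<le> card \<D>" .
    moreover have "card R \<noteq> card \<D>"
      using factor_decomposition_perfect_matching[OF dec] finC no by auto
    moreover have "even (card R) \<longleftrightarrow> even (card \<D>)"
    proof -
      have "even (card (\<Union>\<D>)) \<longleftrightarrow> even (card \<D>)" using finD fD dD by (intro sum_card_odd_parity) auto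
      moreover have "card C = Suc (card (\<Union>\<D>) + card R)"
        using UD R c finC by (metis Diff_subset card_Diff_subset card_Suc_Diff1 card_mono finR finite_Diff
            le_add_diff_inverse2)
      ultimately show ?thesis using oddC[OF C] by simp
    qed
    ultimately have big: "card \<D> \<ge> card R + 2" by presburger
    \<comment> \<open>Parity raises a strict inequality to the gap of two in \<open>big\<close>.
      Replacing \<open>C\<close> by \<open>\<D>\<close> loses one part and gains at least
      \<open>card R + 2\<close>, while \<open>S\<close> gains the \<open>card R + 1\<close> vertices
      of \<open>R\<close> and \<open>c\<close>. The difference does not drop although
      \<open>S\<close> grows, against the choice of the maximum.\<close>
    define S' where "S' = insert c (S \<union> R)"
    define \<C>' where "\<C>' = (\<C> - {C}) \<union> \<D>"
    have sep: "A \<inter> C = {}" if "A \<in> \<C> - {C}" for A using that C disj by (auto simp: disjoint_def)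
    have DC: "D \<subseteq> C - {c} - R" if "D \<in> \<D>" for D using that UD by blast
    have "odd_family E W S' \<C>'"
      unfolding odd_family_def
    proof (intro conjI ballI)
      show "S' \<subseteq> W" using S c CW R by (auto simp: S'_def)
      show "disjoint \<C>'"
        unfolding disjoint_def
      proof (intro ballI impI)
        fix A B assume AB: "A \<in> \<C>'" "B \<in> \<C>'" "A \<noteq> B"
        then consider "A \<in> \<C>" "B \<in> \<C>" | "A \<in> \<D>" "B \<in> \<D>" | "A \<in> \<C> - {C}" "B \<in> \<D>" | "A \<in> \<D>" "B \<in> \<C> - {C}"
          by (auto simp: \<C>'_def)
        then show "A \<inter> B = {}"
        proof cases
          case 1 then show ?thesis using AB disj by (auto simp: disjoint_def)
        next
          case 2 then show ?thesis using AB dD by (auto simp: disjoint_def)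
        next
          case 3 then show ?thesis using sep[of A] DC[of B] by blast
        next
          case 4 then show ?thesis using sep[of B] DC[of A] by blast
        qed
      qed
      show "\<Union>\<C>' \<subseteq> W - S'"
      proof
        fix v assume "v \<in> \<Union>\<C>'"
        then obtain A where A: "v \<in> A" "A \<in> \<C> - {C} \<or> A \<in> \<D>" by (auto simp: \<C>'_def)
        then show "v \<in> W - S'"
        proof (elim disjE)
          assume "A \<in> \<C> - {C}"
          then show ?thesis using A(1) UC sep[of A] c R by (auto simp: S'_def)
        next
          assume "A \<in> \<D>"
          then show ?thesis using A(1) DC[of A] CW by (auto simp: S'_def)
        qed
      qed
    next
      fix A assume "A \<in> \<C>'"
      then show "odd (card A)" using oddC fD by (auto simp: \<C>'_def)
    next
      fix A a d assume A: "A \<in> \<C>'" "a \<in> A" "d \<in> W - S' - A"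
      then have "A \<in> \<C> - {C} \<or> A \<in> \<D>" by (auto simp: \<C>'_def)
      then show "{a, d} \<notin> E"
      proof
        assume "A \<in> \<C> - {C}"
        then show ?thesis using iso[of A a d] A by (auto simp: S'_def)
      next
        assume AD: "A \<in> \<D>"
        then have aC: "a \<in> C" using DC A by blast
        show ?thesis
        proof (cases "d \<in> C")
          case True
          then show ?thesis using isoD[OF AD A(2), of d] A by (auto simp: S'_def)
        next
          case False
          then show ?thesis using iso[OF C aC, of d] A by (auto simp: S'_def)
        qed
      qed
    qed
    moreover have cC: "card \<C>' = card \<C> - 1 + card \<D>"
    proof -
      have "(\<C> - {C}) \<inter> \<D> = {}"
      proof (rule ccontr)
        assume "\<not> ?thesis"
        then obtain A where A: "A \<in> \<C> - {C}" "A \<in> \<D>" by blast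
        then have "A = {}" using sep[of A] DC[of A] by blast
        then show False using fD A by fastforce
      qed
      then show ?thesis using fC finD C by (simp add: \<C>'_def card_Un_disjoint)
    qed
    moreover have cS: "card S' = Suc (card S + card R)"
    proof -
      have "c \<notin> S \<union> R" "S \<inter> R = {}" using CW c R by auto
      then show ?thesis using fS finR by (simp add: S'_def card_Un_disjoint)
    qed
    moreover have "card \<C> \<ge> 1" using C fC by (metis Suc_leI card_gt_0_iff empty_iff One_nat_def)
    ultimately show False using max[of S' \<C>'] max_eq[of S' \<C>'] big by linarith
  qed
  have cover: "\<Union>\<C> = W - S"
  proof (rule ccontr)
    assume "\<Union>\<C> \<noteq> W - S"
    \<comment> \<open>If the uncovered remainder is odd, it is a further part. If it is even, one
      vertex moves to \<open>S\<close> and the others form an odd part, which keeps the difference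
      and enlarges \<open>S\<close>.\<close>
    define R where "R = W - S - \<Union>\<C>"
    have finR: "finite R" using fin by (simp add: R_def)
    have neR: "R \<noteq> {}" using UC \<open>\<Union>\<C> \<noteq> W - S\<close> by (auto simp: R_def)
    have ext: "odd_family E W T (insert Q \<C>) \<and> Q \<notin> \<C>"
      if T: "S \<subseteq> T" "T \<subseteq> W - \<Union>\<C>" and Q: "Q = W - T - \<Union>\<C>" "odd (card Q)" for T Q
    proof
      show "odd_family E W T (insert Q \<C>)"
        unfolding odd_family_def
      proof (intro conjI ballI)
        show "disjoint (insert Q \<C>)" using disj Q by (auto simp: disjoint_def)
      next
        fix C c d assume C: "C \<in> insert Q \<C>" "c \<in> C" "d \<in> W - T - C"
        show "{c, d} \<notin> E"
        proof (cases "C \<in> \<C>")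
          case True
          then show ?thesis using C iso[of C c d] T by auto
        next
          case False
          then obtain D where "D \<in> \<C>" "d \<in> D" using C Q by auto
          then show ?thesis using iso[of D d c] C Q False T by (auto simp: insert_commute)
        qed
      qed (use T Q oddC UC in auto)
      show "Q \<notin> \<C>"
      proof
        assume "Q \<in> \<C>"
        then have "Q = {}" using Q by blast
        then show False using Q(2) by simp
      qed
    qed
    show False
    proof (cases "odd (card R)")
      case True
      moreover have "S \<subseteq> W - \<Union>\<C>" using S UC by auto
      ultimately have "odd_family E W S (insert R \<C>) \<and> R \<notin> \<C>" using ext[of S R] by (simp add: R_def)
      then show False using max[of S "insert R \<C>"] fC by simp
    next
      case False
      obtain r where r: "r \<in> R" using neR by blast
      have "odd (card (R - {r}))" using False r finR neR by (simp add: card_gt_0_iff)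
      moreover have "r \<notin> S" "insert r S \<subseteq> W - \<Union>\<C>" "R - {r} = W - insert r S - \<Union>\<C>"
        using r S UC by (auto simp: R_def)
      ultimately have "odd_family E W (insert r S) (insert (R - {r}) \<C>) \<and> R - {r} \<notin> \<C>"
        by (intro ext) auto
      then have "card (insert r S) \<le> card S"
        using max_eq[of "insert r S" "insert (R - {r}) \<C>"] fC fS \<open>r \<notin> S\<close> by simp
      then show False using fS \<open>r \<notin> S\<close> by simp
    qed
  qed
  have hall: "card T \<le> card (neighbour_parts E \<C> T)" if T: "T \<subseteq> S" for T
  proof -
    let ?N = "neighbour_parts E \<C> T"
    \<comment> \<open>The parts without a neighbour in \<open>T\<close> stay separated when
      \<open>T\<close> is dropped from \<open>S\<close>. A violation of Hall's condition at
      \<open>T\<close> would thus save more vertices than it costs parts.\<close>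
    have "odd_family E W (S - T) (\<C> - ?N)"
      unfolding odd_family_def
    proof (intro conjI ballI)
      fix C c d assume C: "C \<in> \<C> - ?N" "c \<in> C" "d \<in> W - (S - T) - C"
      show "{c, d} \<notin> E"
      proof (cases "d \<in> T")
        case True
        then show ?thesis using C by (auto simp: neighbour_parts_def insert_commute)
      next
        case False
        then show ?thesis using C iso[of C c d] by auto
      qed
    qed (use S UC oddC disj in \<open>auto simp: disjoint_def\<close>)
    then have "card (\<C> - ?N) + card S \<le> card \<C> + card (S - T)" by (rule max)
    moreover have "card (\<C> - ?N) = card \<C> - card ?N" "card ?N \<le> card \<C>"
      using fC by (auto simp: neighbour_parts_def intro: card_mono intro!: card_Diff_subset)
    moreover have "card (S - T) = card S - card T" "card T \<le> card S"
      using fS T by (auto intro: card_mono finite_subset intro!: card_Diff_subset)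
    ultimately show ?thesis by linarith
  qed
  have "factor_decomposition E W S \<C>"
    using S disj cover crit iso hall by (simp add: factor_decomposition_def)
  then show ?case by blast
qed

section \<open>Three disjoint perfect matchings\<close>

text \<open>A perfect matching seen as the map to the partner; nothing is asked outside
  \<open>V\<close>.\<close>

definition involution_on :: "'a set \<Rightarrow> ('a \<Rightarrow> 'a) \<Rightarrow> bool" where
  "involution_on V f \<longleftrightarrow> (\<forall>x\<in>V. f x \<in> V \<and> f x \<noteq> x \<and> f (f x) = x)"

text \<open>The pieces of three matchings on \<open>A\<close>, \<open>B\<close> and \<open>C\<close>
  glue to one matching. That no piece is all of \<open>V\<close> will make it differ from three
  pairwise disjoint ones.\<close>

definition mixed_partition :: "'a set \<Rightarrow> ('a \<Rightarrow> 'a) \<Rightarrow> ('a \<Rightarrow> 'a) \<Rightarrow> ('a \<Rightarrow> 'a) \<Rightarrow> bool" where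
  "mixed_partition V f g h \<longleftrightarrow> (\<exists>A B C. A \<union> B \<union> C = V \<and> A \<inter> B = {} \<and> A \<inter> C = {} \<and> B \<inter> C = {} \<and>
     f ` A \<subseteq> A \<and> g ` B \<subseteq> B \<and> h ` C \<subseteq> C \<and> A \<noteq> V \<and> B \<noteq> V \<and> C \<noteq> V)"

lemma mixed_partition_commute: "mixed_partition V f g h \<Longrightarrow> mixed_partition V g f h"
  unfolding mixed_partition_def by (metis Int_commute sup_commute)

text \<open>Only \<open>B\<close> and \<open>C\<close> have to be given: the complement of
  \<open>B \<union> C\<close> serves as \<open>A\<close>, since an involution that preserves a set
  preserves its complement.\<close>

lemma mixed_partitionI:
  assumes f: "involution_on V f" and B: "B \<subseteq> V" "g ` B \<subseteq> B" and C: "C \<subseteq> V" "h ` C \<subseteq> C"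
    and BC: "B \<inter> C = {}" "f ` (B \<union> C) \<subseteq> B \<union> C" and ne: "C \<noteq> {}" "C \<noteq> V"
  shows "mixed_partition V f g h"
proof -
  have "f x \<in> V - (B \<union> C)" if x: "x \<in> V - (B \<union> C)" for x
  proof -
    have "f x \<in> V" "f (f x) = x" using f x by (auto simp: involution_on_def)
    moreover have "f x \<notin> B \<union> C"
    proof
      assume "f x \<in> B \<union> C"
      then have "f (f x) \<in> B \<union> C" using BC(2) by blast
      then show False using x \<open>f (f x) = x\<close> by simp
    qed
    ultimately show ?thesis by blast
  qed
  then have "f ` (V - (B \<union> C)) \<subseteq> V - (B \<union> C)" by (rule image_subsetI)
  moreover have "V - (B \<union> C) \<union> B \<union> C = V" "(V - (B \<union> C)) \<inter> B = {}" "(V - (B \<union> C)) \<inter> C = {}"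
    using B(1) C(1) by auto
  moreover have "V - (B \<union> C) \<noteq> V" "B \<noteq> V" using ne C(1) BC(1) by auto
  ultimately show ?thesis
    unfolding mixed_partition_def using B(2) C(2) BC(1) ne(2) by (intro exI conjI)
qed

section \<open>Alternating walks of two involutions\<close>

primrec walk :: "('a \<Rightarrow> 'a) \<Rightarrow> ('a \<Rightarrow> 'a) \<Rightarrow> 'a \<Rightarrow> nat \<Rightarrow> 'a" where
  "walk f g x 0 = x"
| "walk f g x (Suc t) = (if even t then f else g) (walk f g x t)"

lemma walk_shift: "walk f g x (Suc t) = walk g f (f x) t"
  by (induction t) auto

context
  fixes V :: "'a set" and f g :: "'a \<Rightarrow> 'a"
  assumes f: "involution_on V f" and g: "involution_on V g"
begin

lemma walk_in: "x \<in> V \<Longrightarrow> walk f g x t \<in> V"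
  by (induction t) (use f g in \<open>auto simp: involution_on_def\<close>)

lemma walk_steps:
  assumes "x \<in> V"
  shows "even t \<Longrightarrow> f (walk f g x t) = walk f g x (Suc t)"
    and "odd t \<Longrightarrow> g (walk f g x t) = walk f g x (Suc t)"
    and "even t \<Longrightarrow> f (walk f g x (Suc t)) = walk f g x t"
    and "odd t \<Longrightarrow> g (walk f g x (Suc t)) = walk f g x t"
  using walk_in[OF assms, of t] f g by (auto simp: involution_on_def)

text \<open>For odd \<open>k\<close> the step out of position \<open>s\<close> and the step into
  position \<open>s + k\<close> use the same involution. Applied to both ends it moves them towards
  each other by two steps in all, until they are adjacent, where equality would be a fixed
  point.\<close>

lemma walk_odd_distance:
  assumes x: "x \<in> V" shows "odd k \<Longrightarrow> walk f g x s \<noteq> walk f g x (s + k)"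
proof (induction k arbitrary: s rule: less_induct)
  case (less k)
  show ?case
  proof
    assume eq: "walk f g x s = walk f g x (s + k)"
    let ?p = "if even s then f else g"
    have p: "?p (walk f g x s) = walk f g x (Suc s)" using walk_steps[OF x, of s] by simp
    obtain j where j: "k = Suc j" using less.prems by (cases k) auto
    have "?p (walk f g x (Suc (s + j))) = walk f g x (s + j)"
      using walk_steps[OF x, of "s + j"] less.prems j by auto
    then have *: "walk f g x (Suc s) = walk f g x (s + j)" using p eq j by simp
    show False
    proof (cases j)
      case 0
      have "?p (walk f g x s) \<noteq> walk f g x s"
        using walk_in[OF x, of s] f g by (simp add: involution_on_def)
      then show False using * p 0 by (simp del: walk.simps)
    next
      case (Suc i)
      then have "walk f g x (Suc s) \<noteq> walk f g x (Suc s + i)"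
        using less.IH[of i "Suc s"] less.prems j by (simp del: walk.simps)
      then show False using * Suc by simp
    qed
  qed
qed

text \<open>The first repetition on the walk is a return to \<open>x\<close> after an even number of steps.\<close>

lemma walk_cycle:
  assumes x: "x \<in> V" and fin: "finite V"
  obtains L where "inj_on (walk f g x) {..<L}" "L > 0"
    "f ` walk f g x ` {..<L} \<subseteq> walk f g x ` {..<L}" "g ` walk f g x ` {..<L} \<subseteq> walk f g x ` {..<L}"
proof -
  let ?h = "walk f g x"
  have "\<not> inj ?h"
  proof
    assume "inj ?h"
    moreover have "finite (range ?h)" using fin walk_in[OF x] by (auto intro: finite_subset)
    ultimately show False using finite_imageD by blast
  qed
  then obtain a b where "?h a = ?h b" "a < b" unfolding inj_on_def by (metis linorder_neqE_nat)
  then have ex: "\<exists>b. \<exists>a<b. ?h a = ?h b" by blast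
  define L where "L = (LEAST b. \<exists>a<b. ?h a = ?h b)"
  obtain s where s: "s < L" "?h s = ?h L" using LeastI_ex[OF ex] by (auto simp: L_def)
  have min: "?h a \<noteq> ?h b" if "a < b" "b < L" for a b
    using not_less_Least[of b "\<lambda>b. \<exists>a<b. ?h a = ?h b"] that by (auto simp: L_def)
  have inj: "inj_on ?h {..<L}"
    by (rule inj_onI) (metis lessThan_iff linorder_neqE_nat min)
  have par: "even s \<longleftrightarrow> even L"
  proof (rule ccontr)
    assume "\<not> ?thesis"
    then have "odd (L - s)" using s by auto
    then show False using walk_odd_distance[OF x, of "L - s" s] s by simp
  qed
  \<comment> \<open>For \<open>s > 0\<close> the steps into \<open>s\<close> and into
    \<open>L\<close> use the same involution by parity; undoing it would give an earlier
    repetition.\<close>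
  have s0: "s = 0"
  proof (rule ccontr)
    assume "s \<noteq> 0"
    then obtain a b where ab: "s = Suc a" "L = Suc b" using s by (metis Suc_pred neq0_conv not_less_zero)
    have "?h a = ?h b" using walk_steps(3,4)[OF x, of a] walk_steps(3,4)[OF x, of b] s par ab by (metis even_Suc)
    then show False using min[of a b] ab s by simp
  qed
  then have evenL: "even L" and L0: "?h L = x" and Lpos: "L > 0" using par s by auto
  have "f (?h t) \<in> ?h ` {..<L}" if "t < L" for t
  proof (cases "even t")
    case True
    then have "Suc t < L" using that evenL by (metis Suc_lessI even_Suc)
    then show ?thesis using walk_steps(1)[OF x True] by (metis imageI lessThan_iff)
  next
    case False
    then obtain k where k: "t = Suc k" by (cases t) auto
    then have "f (?h t) = ?h k" using walk_steps(3)[OF x, of k] False by simp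
    moreover have "k < L" using k that by simp
    ultimately show ?thesis by blast
  qed
  moreover have "g (?h t) \<in> ?h ` {..<L}" if "t < L" for t
  proof (cases "odd t")
    case True
    show ?thesis
    proof (cases "Suc t = L")
      case True
      then show ?thesis using walk_steps(2)[OF x \<open>odd t\<close>] L0 Lpos by (metis imageI lessThan_iff walk.simps(1))
    next
      case False
      then have "Suc t < L" using that by simp
      then show ?thesis using walk_steps(2)[OF x True] by (metis imageI lessThan_iff)
    qed
  next
    case False
    show ?thesis
    proof (cases t)
      case 0
      obtain b where b: "L = Suc b" using Lpos by (cases L) auto
      then have "g (?h L) = ?h b" using walk_steps(4)[OF x, of b] evenL by simp
      then have "g (?h t) = ?h b" using 0 L0 by simp
      then show ?thesis using b by blast
    next
      case (Suc k)
      then have "g (?h t) = ?h k" using walk_steps(4)[OF x, of k] False by simp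
      moreover have "k < L" using Suc that by simp
      ultimately show ?thesis by blast
    qed
  qed
  ultimately show ?thesis using that[OF inj Lpos] by blast
qed

text \<open>On an arc of odd length \<open>h\<close> takes the two ends and \<open>g\<close> pairs
  up the interior. The whole arc is closed under \<open>f\<close>, so \<open>f\<close> takes
  everything outside it.\<close>

lemma mixed_partition_odd_chord:
  assumes h: "involution_on V h" and x: "x \<in> V" and V: "finite V" "5 \<le> card V"
    and chord: "h x = walk f g x d" "odd d" and inj: "inj_on (walk f g x) {..d}"
  shows "mixed_partition V f g h"
proof (rule mixed_partitionI[OF f, of "walk f g x ` {0<..<d}" g "{x, h x}" h])
  let ?h = "walk f g x"
  show "?h ` {0<..<d} \<subseteq> V" using walk_in[OF x] by blast
  show "{x, h x} \<subseteq> V" "h ` {x, h x} \<subseteq> {x, h x}" using h x by (auto simp: involution_on_def)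
  show "g ` ?h ` {0<..<d} \<subseteq> ?h ` {0<..<d}"
  proof clarify
    fix t assume t: "t \<in> {0<..<d}"
    show "g (?h t) \<in> ?h ` {0<..<d}"
    proof (cases "odd t")
      case True
      then have "Suc t < d" using t chord by (metis Suc_lessI even_Suc greaterThanLessThan_iff)
      then show ?thesis using walk_steps(2)[OF x True] by (metis greaterThanLessThan_iff imageI zero_less_Suc)
    next
      case False
      then obtain k where k: "t = Suc k" "odd k" using t by (cases t) auto
      then have "g (?h t) = ?h k" using walk_steps(4)[OF x, of k] by simp
      moreover have "k \<in> {0<..<d}" using k t by (auto intro: odd_pos)
      ultimately show ?thesis by blast
    qed
  qed
  show "?h ` {0<..<d} \<inter> {x, h x} = {}"
  proof -
    have "?h t \<noteq> ?h 0" "?h t \<noteq> ?h d" if "t \<in> {0<..<d}" for t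
      using that inj_on_eq_iff[OF inj, of t 0] inj_on_eq_iff[OF inj, of t d] by auto
    then have "?h t \<notin> {x, h x}" if "t \<in> {0<..<d}" for t using that chord by fastforce
    then show ?thesis by blast
  qed
  have d0: "?h ` {..d} = ?h ` {0<..<d} \<union> {x, h x}"
  proof -
    have "{..d} = {0<..<d} \<union> {0, d}" using odd_pos[OF chord(2)] by auto
    then show ?thesis using chord by auto
  qed
  have "f (?h t) \<in> ?h ` {..d}" if t: "t \<le> d" for t
  proof (cases "even t")
    case True
    then have "Suc t \<le> d" using t chord by (metis Suc_leI le_neq_implies_less)
    then show ?thesis using walk_steps(1)[OF x True] by (metis atMost_iff imageI)
  next
    case False
    then obtain k where k: "t = Suc k" by (cases t) auto
    then have "f (?h t) = ?h k" using walk_steps(3)[OF x, of k] False by simp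
    then show ?thesis using k t by auto
  qed
  then show "f ` (?h ` {0<..<d} \<union> {x, h x}) \<subseteq> ?h ` {0<..<d} \<union> {x, h x}"
    unfolding d0[symmetric] by blast
  have "card {x, h x} \<le> 2" by (simp add: card_insert_if)
  then show "{x, h x} \<noteq> V" using V by auto
qed auto

end

text \<open>Take a shortest arc of an alternating \<open>f\<close>-\<open>g\<close> walk whose ends are matched by \<open>h\<close>. If its length is even,
  the \<open>h\<close>-chord at its second vertex has to cross it.\<close>

lemma mixed_partition_exists:
  assumes f: "involution_on V f" and g: "involution_on V g" and h: "involution_on V h"
    and V: "finite V" "5 \<le> card V"
  shows "mixed_partition V f g h"
proof (rule ccontr)
  assume no: "\<not> ?thesis"
  then have no': "\<not> mixed_partition V g f h" using mixed_partition_commute by blast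
  \<comment> \<open>If the cycle through \<open>x\<close> missed a vertex, \<open>q\<close> on the
    cycle and \<open>p\<close> off it would form a mixed partition with an empty third piece. So the
    two involutions trace a Hamiltonian cycle.\<close>
  have ham: "\<exists>L. inj_on (walk p q x) {..<L} \<and> walk p q x ` {..<L} = V"
    if pq: "involution_on V p" "involution_on V q" "\<not> mixed_partition V p q h" and x: "x \<in> V" for p q x
  proof -
    obtain L where L: "inj_on (walk p q x) {..<L}" "L > 0" "p ` walk p q x ` {..<L} \<subseteq> walk p q x ` {..<L}"
      "q ` walk p q x ` {..<L} \<subseteq> walk p q x ` {..<L}"
      using walk_cycle[OF pq(1,2) x V(1)] by blast
    define U where "U = walk p q x ` {..<L}"
    have clU: "p ` U \<subseteq> U" "q ` U \<subseteq> U" using L(3,4) by (simp_all add: U_def)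
    have U: "U \<subseteq> V" "U \<noteq> {}" using walk_in[OF pq(1,2) x] L(2) by (auto simp: U_def)
    have "U = V"
    proof (rule ccontr)
      assume ne: "U \<noteq> V"
      have "p y \<in> V - U" if y: "y \<in> V - U" for y
      proof -
        have "p y \<in> V" "p (p y) = y" using pq(1) y by (auto simp: involution_on_def)
        moreover have "p y \<notin> U"
        proof
          assume "p y \<in> U"
          then have "p (p y) \<in> U" using clU(1) by blast
          then show False using y \<open>p (p y) = y\<close> by simp
        qed
        ultimately show ?thesis by blast
      qed
      then have "p ` (V - U) \<subseteq> V - U" by blast
      then have "mixed_partition V p q h"
        unfolding mixed_partition_def
        by (intro exI[of _ "V - U"] exI[of _ U] exI[of _ "{}"]) (use U ne clU(2) in auto)
      then show False using pq(3) by blast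
    qed
    then show ?thesis using L(1) U_def by blast
  qed
  let ?chord = "\<lambda>d. \<exists>x p q. x \<in> V \<and> ((p = f \<and> q = g) \<or> (p = g \<and> q = f)) \<and> h x = walk p q x d"
  have "V \<noteq> {}" using V by auto
  then obtain x0 where x0: "x0 \<in> V" by blast
  have "h x0 \<in> V" using h x0 by (auto simp: involution_on_def)
  then have "\<exists>d. ?chord d" using ham[OF f g no x0] x0 by (metis imageE)
  then have "?chord (LEAST d. ?chord d)" by (rule LeastI_ex)
  then obtain d x p q where d: "d = (LEAST d. ?chord d)" and x: "x \<in> V"
    and pq_cases: "(p = f \<and> q = g) \<or> (p = g \<and> q = f)" and hx: "h x = walk p q x d" by blast
  have p: "involution_on V p" and q: "involution_on V q" and nopq: "\<not> mixed_partition V p q h"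
    "\<not> mixed_partition V q p h"
    using pq_cases f g no no' by auto
  have min: "h y \<noteq> walk p q y k" "h y \<noteq> walk q p y k" if "y \<in> V" "k < d" for y k
    using not_less_Least[of k ?chord] that pq_cases unfolding d by blast+
  let ?w = "walk p q x"
  obtain L where L: "inj_on ?w {..<L}" "?w ` {..<L} = V" using ham[OF p q nopq(1) x] by blast
  have "h x \<in> V" using h x by (auto simp: involution_on_def)
  then obtain t where t: "t < L" "h x = ?w t" using L by (metis imageE lessThan_iff)
  have dL: "d < L"
  proof (rule ccontr)
    assume "\<not> d < L"
    then have "t < d" using t(1) by simp
    then have "h x \<noteq> ?w t" by (rule min(1)[OF x])
    then show False using t(2) by (rule notE)
  qed
  have inj: "inj_on ?w {..k}" if "k < L" for k using L(1) that by (auto intro: inj_on_subset)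
  have weq: "?w i = ?w j \<longleftrightarrow> i = j" if "i < L" "j < L" for i j
    using L(1) that by (auto simp: inj_on_eq_iff)
  have evend: "even d"
    using mixed_partition_odd_chord[OF p q h x V hx _ inj[OF dL]] nopq(1) by blast
  have "h x \<noteq> x" using h x by (simp add: involution_on_def)
  then have "d \<noteq> 0" using hx by (metis walk.simps(1))
  moreover have "d \<noteq> 1" using evend by auto
  ultimately have d2: "2 \<le> d" by linarith
  let ?y = "p x"
  have y: "?y \<in> V" "?w 1 = ?y" using p x by (auto simp: involution_on_def)
  have hy: "h ?y \<in> V" "h (h ?y) = ?y" "h (h x) = x" "h ?y \<noteq> ?y"
    using h x y by (auto simp: involution_on_def)
  then obtain m where m: "m < L" "h ?y = ?w m" using L by (metis imageE lessThan_iff)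
  have m0: "m \<noteq> 0"
  proof
    assume "m = 0"
    then have "h x = ?y" using m hy by simp
    then have "?w d = ?w 1" using hx y by simp
    then show False using weq[of d 1] dL d2 by simp
  qed
  have m1: "m \<noteq> 1" using m y hy by auto
  have md: "m \<noteq> d"
  proof
    assume "m = d"
    then have "?y = x" using m hx hy by metis
    then show False using p x by (auto simp: involution_on_def)
  qed
  obtain k where k: "m = Suc k" using m0 by (cases m) auto
  have hyk: "h ?y = walk q p ?y k" using m k by (metis walk_shift)
  \<comment> \<open>From \<open>?y\<close> the swapped walk reaches \<open>h ?y\<close> after
    \<open>k = m - 1\<close> steps, so the minimality of \<open>d\<close> places \<open>m\<close>
    beyond \<open>d\<close>: the two chords cross.\<close>
  have dm: "d < m"
  proof (rule ccontr)
    assume "\<not> d < m"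
    then have "k < d" using k md by simp
    then have "h ?y \<noteq> walk q p ?y k" by (rule min(2)[OF y(1)])
    then show False using hyk by (rule notE)
  qed
  have inj_k: "inj_on (walk q p ?y) {..k}"
  proof (rule inj_onI)
    fix i j assume "i \<in> {..k}" "j \<in> {..k}" "walk q p ?y i = walk q p ?y j"
    then show "i = j" using weq[of "Suc i" "Suc j"] m k by (simp add: walk_shift del: walk.simps)
  qed
  have evenk: "even k"
    using mixed_partition_odd_chord[OF q p h y(1) V hyk _ inj_k] nopq(2) by blast
  \<comment> \<open>The crossing chords join positions \<open>0\<close>, \<open>d\<close> and
    \<open>1\<close>, \<open>m\<close>, with \<open>d\<close> even and \<open>m\<close> odd. Here
    \<open>h\<close> takes the four ends and \<open>q\<close> pairs up the stretch strictly between
    \<open>d\<close> and \<open>m\<close>. Both pieces together are closed under \<open>p\<close>,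
    which takes the rest. Five vertices ensure that the four ends are not all of
    \<open>V\<close>.\<close>
  let ?B = "?w ` {d<..<m}" and ?C = "{?w 0, ?w 1, ?w d, ?w m}"
  have "mixed_partition V p q h"
  proof (rule mixed_partitionI[OF p, of ?B q ?C h])
    show "?B \<subseteq> V" "?C \<subseteq> V" using walk_in[OF p q x] by blast+
    show "h ` ?C \<subseteq> ?C" using hx m hy y by auto
    show "?B \<inter> ?C = {}"
    proof (intro equals0I, elim IntE imageE)
      have not_in: "?w i \<notin> ?C" if i: "i \<in> {d<..<m}" for i
      proof -
        have "d < i" "i < m" using i by auto
        then have "?w i \<noteq> ?w 0" "?w i \<noteq> ?w 1" "?w i \<noteq> ?w d" "?w i \<noteq> ?w m"
          using weq[of i 0] weq[of i 1] weq[of i d] weq[of i m] m dL d2 by (simp_all del: walk.simps)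
        then show "?w i \<notin> ?C" by blast
      qed
      fix z i assume "z \<in> ?C" "z = ?w i" "i \<in> {d<..<m}"
      then show False using not_in[of i] by (simp only:)
    qed
    show "q ` ?B \<subseteq> ?B"
    proof clarify
      fix t assume t: "t \<in> {d<..<m}"
      show "q (?w t) \<in> ?B"
      proof (cases "odd t")
        case True
        then have "Suc t \<noteq> m" using k evenk by auto
        then have "Suc t \<in> {d<..<m}" using t by auto
        then show ?thesis using walk_steps(2)[OF p q x True] by (metis imageI)
      next
        case False
        then obtain i where i: "t = Suc i" "odd i" using t by (cases t) auto
        then have "i \<noteq> d" using evend by auto
        then have "i \<in> {d<..<m}" using i t by auto
        moreover have "q (?w t) = ?w i" using walk_steps(4)[OF p q x, of i] i by simp
        ultimately show ?thesis by blast
      qed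
    qed
    have BC: "?B \<union> ?C = ?w ` ({0, 1} \<union> {d..m})"
    proof -
      have "{d..m} = {d<..<m} \<union> {d, m}" using dm by auto
      then show ?thesis by (auto simp del: walk.simps)
    qed
    have "p (?w t) \<in> ?w ` ({0, 1} \<union> {d..m})" if t: "t \<in> {0, 1} \<union> {d..m}" for t
    proof (cases "even t")
      case True
      then have "t \<noteq> m" "t \<noteq> 1" using k evenk by auto
      then have "Suc t \<in> {0, 1} \<union> {d..m}" using t dm by auto
      then show ?thesis using walk_steps(1)[OF p q x True] by (metis imageI)
    next
      case False
      then obtain i where i: "t = Suc i" "even i" using t by (cases t) auto
      then have "t \<noteq> d" using evend by auto
      then have "i \<in> {0, 1} \<union> {d..m}" using i t by auto
      moreover have "p (?w t) = ?w i" using walk_steps(3)[OF p q x, of i] i by simp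
      ultimately show ?thesis by blast
    qed
    then show "p ` (?B \<union> ?C) \<subseteq> ?B \<union> ?C" unfolding BC by blast
    have "card ?C \<le> 4" by (simp add: card_insert_if)
    then show "?C \<noteq> V" using V by auto
  qed auto
  then show False using nopq by blast
qed

section \<open>From involutions back to perfect matchings\<close>

definition mate :: "'a set set \<Rightarrow> 'a \<Rightarrow> 'a" where
  "mate M v = (SOME u. u \<noteq> v \<and> {v, u} \<in> M)"

lemma mate:
  assumes M: "perfect_matching V E M" and E: "\<forall>e\<in>E. card e = 2" and v: "v \<in> V"
  shows "mate M v \<noteq> v" "{v, mate M v} \<in> M"
proof -
  obtain e where e: "e \<in> M" "v \<in> e" using M v by (auto simp: perfect_matching_def)
  moreover have "e \<in> E" using M e perfect_matching_subset by blast
  then obtain u where "u \<noteq> v" "e = {v, u}" using card_2_other[of e v] E e by metis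
  ultimately have "\<exists>u. u \<noteq> v \<and> {v, u} \<in> M" by blast
  then have "mate M v \<noteq> v \<and> {v, mate M v} \<in> M" unfolding mate_def by (rule someI_ex)
  then show "mate M v \<noteq> v" "{v, mate M v} \<in> M" by auto
qed

lemma mate_edge:
  assumes M: "perfect_matching V E M" and E: "\<forall>e\<in>E. card e = 2" and e: "e \<in> M" "v \<in> e"
  shows "e = {v, mate M v}"
proof -
  have "v \<in> V" using M e by (auto simp: perfect_matching_def)
  then show ?thesis using perfect_matching_edge_unique[OF M e(1) mate(2)[OF M E]] e by blast
qed

lemma involution_mate:
  assumes M: "perfect_matching V E M" and E: "\<forall>e\<in>E. card e = 2"
  shows "involution_on V (mate M)"
  unfolding involution_on_def
proof (intro ballI)
  fix v assume v: "v \<in> V"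
  have e: "{v, mate M v} \<in> M" and ne: "mate M v \<noteq> v" using mate[OF M E v] by auto
  have "mate M v \<in> V" using e M by (auto simp: perfect_matching_def)
  moreover have "{v, mate M v} = {mate M v, mate M (mate M v)}" using mate_edge[OF M E e] by blast
  ultimately show "mate M v \<in> V \<and> mate M v \<noteq> v \<and> mate M (mate M v) = v"
    using ne by (metis doubleton_eq_iff)
qed

lemma perfect_matching_restrict_mate:
  assumes M: "perfect_matching V E M" and E: "\<forall>e\<in>E. card e = 2" and A: "A \<subseteq> V" "mate M ` A \<subseteq> A"
  shows "perfect_matching A E {e \<in> M. e \<subseteq> A}"
proof (rule perfect_matching_restrict[OF M A(1)])
  fix e assume e: "e \<in> M" "e \<inter> A \<noteq> {}"
  then obtain v where "v \<in> e" "v \<in> A" by blast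
  then show "e \<subseteq> A" using mate_edge[OF M E e(1)] A(2) by blast
qed

text \<open>If the glued matching were \<open>M1\<close>, its pieces from \<open>M2\<close> and
  \<open>M3\<close> would lie in the empty intersections with \<open>M1\<close>, and the piece from
  \<open>M1\<close> would live on all of \<open>V\<close>. The other two cases are alike.\<close>

lemma fourth_perfect_matching:
  assumes E: "\<forall>e\<in>E. card e = 2" and V: "finite V" "5 \<le> card V"
    and pm: "perfect_matching V E M1" "perfect_matching V E M2" "perfect_matching V E M3"
    and disj: "M1 \<inter> M2 = {}" "M1 \<inter> M3 = {}" "M2 \<inter> M3 = {}"
  shows "\<exists>M. perfect_matching V E M \<and> M \<notin> {M1, M2, M3}"
proof -
  have "mixed_partition V (mate M1) (mate M2) (mate M3)"
    by (intro mixed_partition_exists involution_mate[OF pm(1) E] involution_mate[OF pm(2) E]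
        involution_mate[OF pm(3) E] V)
  then obtain A B C where ABC: "A \<union> B \<union> C = V" "A \<inter> B = {}" "A \<inter> C = {}" "B \<inter> C = {}"
    and cl: "mate M1 ` A \<subseteq> A" "mate M2 ` B \<subseteq> B" "mate M3 ` C \<subseteq> C" and ne: "A \<noteq> V" "B \<noteq> V" "C \<noteq> V"
    unfolding mixed_partition_def by (elim exE conjE)
  let ?A = "{e \<in> M1. e \<subseteq> A}" and ?B = "{e \<in> M2. e \<subseteq> B}" and ?C = "{e \<in> M3. e \<subseteq> C}"
  have sub: "A \<subseteq> V" "B \<subseteq> V" "C \<subseteq> V" using ABC(1) by auto
  note A = perfect_matching_restrict_mate[OF pm(1) E sub(1) cl(1)]
    and B = perfect_matching_restrict_mate[OF pm(2) E sub(2) cl(2)]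
    and C = perfect_matching_restrict_mate[OF pm(3) E sub(3) cl(3)]
  let ?M = "?A \<union> ?B \<union> ?C"
  have pmM: "perfect_matching (A \<union> B \<union> C) E ?M"
    by (rule perfect_matching_Un[OF perfect_matching_Un[OF A B ABC(2)] C]) (simp add: Int_Un_distrib2 ABC)
  have empty: "U = {}" if "perfect_matching U E N" "N \<subseteq> P \<inter> Q" "P \<inter> Q = {}" for U N P Q
  proof -
    have "N = {}" using that by (simp only: subset_empty)
    then show ?thesis using that by (simp add: perfect_matching_def)
  qed
  have "?M \<noteq> M1"
  proof
    assume eq: "?M = M1"
    have "?B \<subseteq> ?M" "?C \<subseteq> ?M" by (rule subsetI, simp)+
    then have "?B \<subseteq> M1" "?C \<subseteq> M1" unfolding eq .
    then have "?B \<subseteq> M1 \<inter> M2" "?C \<subseteq> M1 \<inter> M3" by auto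
    then have "B = {}" "C = {}" using empty[OF B] empty[OF C] disj by simp_all
    then show False using ABC(1) ne(1) by simp
  qed
  moreover have "?M \<noteq> M2"
  proof
    assume eq: "?M = M2"
    have "?A \<subseteq> ?M" "?C \<subseteq> ?M" by (rule subsetI, simp)+
    then have "?A \<subseteq> M2" "?C \<subseteq> M2" unfolding eq .
    then have "?A \<subseteq> M1 \<inter> M2" "?C \<subseteq> M2 \<inter> M3" by auto
    then have "A = {}" "C = {}" using empty[OF A] empty[OF C] disj by simp_all
    then show False using ABC(1) ne(2) by simp
  qed
  moreover have "?M \<noteq> M3"
  proof
    assume eq: "?M = M3"
    have "?A \<subseteq> ?M" "?B \<subseteq> ?M" by (rule subsetI, simp)+
    then have "?A \<subseteq> M3" "?B \<subseteq> M3" unfolding eq .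
    then have "?A \<subseteq> M1 \<inter> M3" "?B \<subseteq> M2 \<inter> M3" by auto
    then have "A = {}" "B = {}" using empty[OF A] empty[OF B] disj by simp_all
    then show False using ABC(1) ne(3) by simp
  qed
  ultimately have "?M \<notin> {M1, M2, M3}" by simp
  then show ?thesis using pmM unfolding ABC(1) by (intro exI conjI)
qed

section \<open>Barriers in 2-connected graphs\<close>

text \<open>2-connectedness stated for bipartitions instead of paths: a partition of all vertices,
  or of all but one, is crossed by an edge. Since \<open>s\<close> may lie in
  \<open>A \<union> B\<close>, the case of no deleted vertex is included. This form carries over to
  contractions by enlarging one side.\<close>

definition biconnected :: "'a set \<Rightarrow> 'a set set \<Rightarrow> bool" where
  "biconnected W E \<longleftrightarrow> (\<forall>A B s. A \<noteq> {} \<longrightarrow> B \<noteq> {} \<longrightarrow> A \<inter> B = {} \<longrightarrow> A \<union> B \<subseteq> W \<longrightarrow> W - {s} \<subseteq> A \<union> B \<longrightarrow>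
     (\<exists>a\<in>A. \<exists>b\<in>B. {a, b} \<in> E))"

lemma biconnectedD:
  assumes "biconnected W E" "A \<noteq> {}" "B \<noteq> {}" "A \<inter> B = {}" "A \<union> B \<subseteq> W" "W - {s} \<subseteq> A \<union> B"
  obtains a b where "a \<in> A" "b \<in> B" "{a, b} \<in> E"
proof -
  have "\<exists>a\<in>A. \<exists>b\<in>B. {a, b} \<in> E"
    using assms(1)[unfolded biconnected_def, rule_format, OF assms(2-6)] .
  then show ?thesis using that by blast
qed

lemma k_connected_2_biconnected:
  assumes G: "simple_graph V E" and conn: "k_connected 2 V E"
  shows "biconnected V E"
  unfolding biconnected_def
proof (intro allI impI, rule ccontr)
  fix A B s
  assume AB: "A \<noteq> {}" "B \<noteq> {}" "A \<inter> B = {}" "A \<union> B \<subseteq> V" "V - {s} \<subseteq> A \<union> B"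
    and no: "\<not> (\<exists>a\<in>A. \<exists>b\<in>B. {a, b} \<in> E)"
  let ?S = "V - (A \<union> B)"
  have "?S \<subseteq> {s}" using AB(5) by blast
  then have "card ?S \<le> card {s}" by (intro card_mono) simp_all
  then have "graph_connected (V - ?S) {e \<in> E. e \<inter> ?S = {}}"
    using conn unfolding k_connected_def by simp
  moreover have VS: "V - ?S = A \<union> B" using AB(4) by blast
  moreover obtain a b where ab: "a \<in> A" "b \<in> B" using AB by blast
  ultimately have "(a, b) \<in> {(x, y). {x, y} \<in> {e \<in> E. e \<inter> ?S = {}}}\<^sup>*"
    unfolding graph_connected_def by simp
  then have "b \<in> A"
  proof (induction rule: rtrancl_induct)
    case (step y z)
    have "{y, z} \<in> E" "{y, z} \<inter> ?S = {}" using step.hyps(2) by auto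
    moreover have "{y, z} \<subseteq> V" using \<open>{y, z} \<in> E\<close> G unfolding simple_graph_def by blast
    ultimately have "z \<in> A \<union> B" by blast
    then show ?case using no step.IH \<open>{y, z} \<in> E\<close> by blast
  qed (rule ab(1))
  then show False using ab AB(3) by blast
qed

lemma subset_singleton_if_card_le:
  assumes "finite A" "card A \<le> Suc 0" shows "\<exists>s. A \<subseteq> {s}"
proof (cases "A = {}")
  case False
  then obtain s where "s \<in> A" by blast
  then have "A \<subseteq> {s}" using assms card_le_Suc0_iff_eq by blast
  then show ?thesis by blast
qed simp

text \<open>If there were at most one outer neighbour \<open>s\<close>, deleting it would separate
  \<open>C\<close> from the remaining outside vertices, of which there is at least one.\<close>

lemma two_outer_neighbours:
  assumes G: "simple_graph W E" and bi: "biconnected W E" and C: "C \<subseteq> W" "C \<noteq> {}" "2 \<le> card (W - C)"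
  shows "2 \<le> card {x \<in> W - C. \<exists>c\<in>C. {x, c} \<in> E}"
proof (rule ccontr)
  let ?N = "{x \<in> W - C. \<exists>c\<in>C. {x, c} \<in> E}"
  have finW: "finite W" using G by (simp add: simple_graph_def)
  assume "\<not> 2 \<le> card ?N"
  then have "card ?N \<le> Suc 0" by simp
  moreover have "finite ?N" using finW by simp
  ultimately obtain s where s: "?N \<subseteq> {s}" using subset_singleton_if_card_le by blast
  have "\<not> W - C \<subseteq> {s}"
  proof
    assume "W - C \<subseteq> {s}"
    then have "card (W - C) \<le> card {s}" by (intro card_mono) simp_all
    then show False using C(3) by simp
  qed
  then have ne: "W - C - {s} \<noteq> {}" by blast
  obtain a b where "a \<in> C" "b \<in> W - C - {s}" "{a, b} \<in> E"
    by (rule biconnectedD[OF bi C(2) ne, of s]) (use C(1) in auto)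
  then have "b \<in> ?N" "b \<noteq> s" by (auto simp: insert_commute)
  then show False using s by blast
qed

text \<open>The completions of a part, each with its outside vertex in front. They are the rows of
  the systems of representatives, with \<open>fst\<close> as label.\<close>

definition exit_matchings :: "'a set set \<Rightarrow> 'a set \<Rightarrow> ('a \<times> 'a set set) set" where
  "exit_matchings E C = {(x, P). x \<notin> C \<and> perfect_matching (insert x C) E P}"

lemma exit_matchingsI:
  assumes C: "factor_critical E C" and e: "{x, c} \<in> E" "c \<in> C" "x \<notin> C"
  obtains P where "perfect_matching (C - {c}) E P" "(x, insert {x, c} P) \<in> exit_matchings E C"
proof -
  obtain P where P: "perfect_matching (C - {c}) E P" using C e unfolding factor_critical_def by blast
  then have "perfect_matching ({x, c} \<union> (C - {c})) E (insert {x, c} P)"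
    using e by (intro perfect_matching_insert) auto
  moreover have "{x, c} \<union> (C - {c}) = insert x C" using e by blast
  ultimately have "(x, insert {x, c} P) \<in> exit_matchings E C" using e by (simp add: exit_matchings_def)
  then show ?thesis using that P by blast
qed

lemma exit_matchings_edge:
  assumes p: "(x, P) \<in> exit_matchings E C" and E: "\<forall>e\<in>E. card e = 2"
  obtains c where "c \<in> C" "{x, c} \<in> P" "{x, c} \<in> E"
proof -
  have P: "perfect_matching (insert x C) E P" using p by (simp add: exit_matchings_def)
  then obtain e where e: "e \<in> P" "x \<in> e" unfolding perfect_matching_def by blast
  have sub: "e \<subseteq> insert x C" "e \<in> E" using perfect_matching_subset[OF P e(1)] by auto
  then obtain c where c: "c \<noteq> x" "e = {x, c}" using card_2_other[of e x] E e(2) by blast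
  then have "c \<in> C" using sub by auto
  then show ?thesis using that[of c] c e sub by blast
qed

lemma exit_vertices:
  assumes C: "factor_critical E C" and E: "\<forall>e\<in>E. card e = 2"
  shows "fst ` exit_matchings E C = {x. x \<notin> C \<and> (\<exists>c\<in>C. {x, c} \<in> E)}"
proof (intro equalityI subsetI)
  fix x assume "x \<in> fst ` exit_matchings E C"
  then obtain P where p: "(x, P) \<in> exit_matchings E C" by auto
  then show "x \<in> {x. x \<notin> C \<and> (\<exists>c\<in>C. {x, c} \<in> E)}"
    using exit_matchings_edge[OF p E] by (auto simp: exit_matchings_def)
next
  fix x assume "x \<in> {x. x \<notin> C \<and> (\<exists>c\<in>C. {x, c} \<in> E)}"
  then obtain c where c: "x \<notin> C" "c \<in> C" "{x, c} \<in> E" by blast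
  obtain P where "(x, insert {x, c} P) \<in> exit_matchings E C" using exit_matchingsI[OF C c(3,2,1)] by blast
  then show "x \<in> fst ` exit_matchings E C" by force
qed

lemma finite_exit_matchings:
  assumes G: "simple_graph W E" shows "finite (exit_matchings E C)"
proof (rule finite_subset[of _ "W \<times> Pow E"])
  have E: "\<forall>e\<in>E. card e = 2 \<and> e \<subseteq> W" using G by (simp add: simple_graph_def)
  show "exit_matchings E C \<subseteq> W \<times> Pow E"
  proof clarify
    fix x P assume p: "(x, P) \<in> exit_matchings E C"
    then obtain c where "{x, c} \<in> E" using exit_matchings_edge[OF p] E by blast
    then have "x \<in> W" using E by blast
    moreover have "P \<subseteq> E" using p by (simp add: exit_matchings_def perfect_matching_def matching_def)
    ultimately show "x \<in> W \<and> P \<in> Pow E" by simp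
  qed
  have "E \<subseteq> Pow W" using E by blast
  then show "finite (W \<times> Pow E)" using G by (auto simp: simple_graph_def intro: finite_subset)
qed

text \<open>What turns systems of representatives into perfect matchings of \<open>W\<close>: as
  many parts as vertices in \<open>X\<close>, and no edges between different parts. The last clause
  assigns to each part an adjacent vertex of \<open>X\<close> of its own, which provides an initial
  solution.\<close>

definition barrier :: "'a set set \<Rightarrow> 'a set \<Rightarrow> 'a set \<Rightarrow> 'a set set \<Rightarrow> bool" where
  "barrier E W X \<C> \<longleftrightarrow> X \<subseteq> W \<and> disjoint \<C> \<and> \<Union>\<C> = W - X \<and> card \<C> = card X \<and>
     (\<forall>C\<in>\<C>. factor_critical E C) \<and> (\<forall>C\<in>\<C>. \<forall>c\<in>C. \<forall>d\<in>W - X - C. {c, d} \<notin> E) \<and>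
     (\<exists>g. inj_on g \<C> \<and> (\<forall>C\<in>\<C>. g C \<in> X \<and> (\<exists>c\<in>C. {g C, c} \<in> E)))"

text \<open>\<open>X\<close> is the set \<open>S\<close> of a decomposition of
  \<open>W - {v}\<close> with \<open>v\<close> added. An odd part cannot be matched in itself, so a
  perfect matching sends it to its own vertex of \<open>X\<close>. Thus \<open>card \<C>\<close>
  lies between \<open>card S\<close> and \<open>card S + 1\<close>, and the even size of
  \<open>W\<close> excludes the smaller value.\<close>

lemma barrier_exists:
  assumes G: "simple_graph W E" and M: "perfect_matching W E M" and v: "v \<in> W"
  obtains X \<C> where "barrier E W X \<C>" "v \<in> X"
proof -
  have finW: "finite W" and E: "\<forall>e\<in>E. card e = 2" and EW: "\<forall>e\<in>E. e \<subseteq> W"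
    using G by (auto simp: simple_graph_def)
  obtain S \<C> where dec: "factor_decomposition E (W - {v}) S \<C>"
    using factor_decomposition_exists[of "W - {v}" E] finW E by auto
  have S: "S \<subseteq> W - {v}" and disj: "disjoint \<C>" and UC: "\<Union>\<C> = W - {v} - S"
    and crit: "\<And>C. C \<in> \<C> \<Longrightarrow> factor_critical E C"
    and iso: "\<And>C c d. C \<in> \<C> \<Longrightarrow> c \<in> C \<Longrightarrow> d \<in> W - {v} - S - C \<Longrightarrow> {c, d} \<notin> E"
    and hall: "card S \<le> card (neighbour_parts E \<C> S)"
    using dec by (auto simp: factor_decomposition_def)
  define X where "X = insert v S"
  have X: "X \<subseteq> W" "v \<in> X" "\<Union>\<C> = W - X" using S v UC by (auto simp: X_def)
  have finS: "finite S" "finite X" using S finW by (auto simp: X_def intro: finite_subset)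
  have cX: "card X = Suc (card S)" using S finS by (auto simp: X_def card_insert_if)
  have finUC: "finite (\<Union>\<C>)" using X finW by simp
  then have finC: "finite \<C>" by (rule finite_UnionD)
  have finP: "finite C \<and> odd (card C)" if "C \<in> \<C>" for C
  proof -
    have "finite C" using that finUC by (meson Union_upper finite_subset)
    then show ?thesis using factor_critical_odd[OF crit[OF that] _ E] by simp
  qed
  have "\<exists>x\<in>X. \<exists>c\<in>C. {x, c} \<in> M" if C: "C \<in> \<C>" for C
  proof (rule ccontr)
    assume no: "\<not> ?thesis"
    have CW: "C \<subseteq> W - X" using C X by blast
    have "perfect_matching C E {e \<in> M. e \<subseteq> C}"
    proof (rule perfect_matching_restrict[OF M])
      fix e assume e: "e \<in> M" "e \<inter> C \<noteq> {}"
      then obtain c where c: "c \<in> e" "c \<in> C" by blast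
      have eE: "e \<in> E" "e \<subseteq> W" using perfect_matching_subset[OF M e(1)] by auto
      obtain d where d: "e = {c, d}" using card_2_other[of e c] E eE(1) c(1) by blast
      have "d \<notin> X" using no e(1) d c(2) by (auto simp: insert_commute)
      then have "d \<in> C" using iso[OF C c(2), of d] d eE by (auto simp: X_def)
      then show "e \<subseteq> C" using d c by simp
    qed (use CW in blast)
    then have "even (card C)" using finP[OF C] E by (intro perfect_matching_even) auto
    then show False using finP[OF C] by simp
  qed
  then obtain g where g: "\<And>C. C \<in> \<C> \<Longrightarrow> g C \<in> X \<and> (\<exists>c\<in>C. {g C, c} \<in> M)" by metis
  have inj: "inj_on g \<C>"
  proof (rule inj_onI)
    fix C D assume CD: "C \<in> \<C>" "D \<in> \<C>" "g C = g D"
    obtain c d where cd: "c \<in> C" "{g C, c} \<in> M" "d \<in> D" "{g C, d} \<in> M" using g CD by metis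
    have "{g C, c} = {g C, d}" using perfect_matching_edge_unique[OF M cd(2,4)] by blast
    then have "c = d" by (auto simp: doubleton_eq_iff)
    then show "C = D" using cd CD disj unfolding disjoint_def by blast
  qed
  have "card \<C> \<le> card X" using card_inj_on_le[OF inj _ finS(2)] g by blast
  moreover have "card S \<le> card \<C>"
    using hall card_mono[OF finC, of "neighbour_parts E \<C> S"] by (auto simp: neighbour_parts_def)
  moreover have "card \<C> \<noteq> card S"
  proof
    assume eq: "card \<C> = card S"
    have "even (card (\<Union>\<C>)) \<longleftrightarrow> even (card \<C>)" using finC finP disj by (intro sum_card_odd_parity) auto
    moreover have "card (\<Union>\<C>) = card W - card X" using X finS by (simp add: card_Diff_subset)
    moreover have "card X \<le> card W" using X finW by (intro card_mono) auto
    moreover have "even (card W)" by (rule perfect_matching_even[OF M finW E])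
    ultimately show False using eq cX by auto
  qed
  ultimately have cc: "card \<C> = card X" using cX by linarith
  have gE: "\<forall>C\<in>\<C>. g C \<in> X \<and> (\<exists>c\<in>C. {g C, c} \<in> E)"
    using g perfect_matching_subset[OF M] by blast
  have WX: "W - {v} - S = W - X" by (auto simp: X_def)
  have "barrier E W X \<C>"
    unfolding barrier_def
  proof (intro conjI ballI)
    show "\<exists>g. inj_on g \<C> \<and> (\<forall>C\<in>\<C>. g C \<in> X \<and> (\<exists>c\<in>C. {g C, c} \<in> E))" using inj gE by blast
    show "{c, d} \<notin> E" if "C \<in> \<C>" "c \<in> C" "d \<in> W - X - C" for C c d
      using iso[OF that(1,2), of d] that(3) unfolding WX .
  qed (use X disj cc crit in auto)
  then show ?thesis using that X(2) by blast
qed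

context
  fixes W :: "'a set" and E X \<C>
  assumes G: "simple_graph W E" and bar: "barrier E W X \<C>"
begin

lemma finW: "finite W" and edge_card: "\<forall>e\<in>E. card e = 2" and edge_subset: "\<And>e. e \<in> E \<Longrightarrow> e \<subseteq> W"
  using G by (auto simp: simple_graph_def)

lemma barrier_facts:
  shows "X \<subseteq> W" "disjoint \<C>" "\<Union>\<C> = W - X" "card \<C> = card X" "finite \<C>" "finite X"
    and "\<And>C. C \<in> \<C> \<Longrightarrow> factor_critical E C"
    and "\<And>C. C \<in> \<C> \<Longrightarrow> C \<subseteq> W - X \<and> C \<noteq> {}"
    and "\<And>C c d. C \<in> \<C> \<Longrightarrow> c \<in> C \<Longrightarrow> d \<in> W - X - C \<Longrightarrow> {c, d} \<notin> E"
proof -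
  show X: "X \<subseteq> W" and "disjoint \<C>" and UC: "\<Union>\<C> = W - X" and "card \<C> = card X"
    and crit: "\<And>C. C \<in> \<C> \<Longrightarrow> factor_critical E C"
    and "\<And>C c d. C \<in> \<C> \<Longrightarrow> c \<in> C \<Longrightarrow> d \<in> W - X - C \<Longrightarrow> {c, d} \<notin> E"
    using bar by (simp_all add: barrier_def)
  show "finite X" using X finW by (rule finite_subset)
  have "finite (\<Union>\<C>)" using UC finW by simp
  then show "finite \<C>" by (rule finite_UnionD)
  show "C \<subseteq> W - X \<and> C \<noteq> {}" if "C \<in> \<C>" for C
    using that UC crit[OF that] by (auto simp: factor_critical_def)
qed

lemma exit_vertices_subset: "C \<in> \<C> \<Longrightarrow> fst ` exit_matchings E C \<subseteq> X"
proof
  fix x assume C: "C \<in> \<C>" and "x \<in> fst ` exit_matchings E C"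
  then obtain c where c: "x \<notin> C" "c \<in> C" "{x, c} \<in> E"
    using exit_vertices[OF barrier_facts(7)[OF C] edge_card] by blast
  then have "x \<in> W" using edge_subset by blast
  moreover have "{c, x} \<in> E" using c by (simp add: insert_commute)
  ultimately show "x \<in> X" using barrier_facts(9)[OF C c(2), of x] c(1) by auto
qed

lemma barrier_sdr: "sdrs \<C> (exit_matchings E) fst \<noteq> {}"
proof -
  obtain g where g: "inj_on g \<C>" "\<And>C. C \<in> \<C> \<Longrightarrow> g C \<in> X \<and> (\<exists>c\<in>C. {g C, c} \<in> E)"
    using bar unfolding barrier_def by (elim conjE exE) simp
  have "\<exists>p\<in>exit_matchings E C. fst p = g C" if C: "C \<in> \<C>" for C
  proof -
    have "g C \<notin> C" using g(2)[OF C] barrier_facts(8)[OF C] by blast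
    then have "g C \<in> fst ` exit_matchings E C"
      using g(2)[OF C] exit_vertices[OF barrier_facts(7)[OF C] edge_card] by simp
    then show ?thesis by force
  qed
  then obtain \<phi> where \<phi>: "\<And>C. C \<in> \<C> \<Longrightarrow> \<phi> C \<in> exit_matchings E C \<and> fst (\<phi> C) = g C" by metis
  have "restrict \<phi> \<C> \<in> sdrs \<C> (exit_matchings E) fst"
    using \<phi> g(1) by (auto simp: sdrs_def inj_on_def)
  then show ?thesis by blast
qed

lemma barrier_tight: "card (\<Union>C\<in>\<C>. fst ` exit_matchings E C) = card \<C>"
proof (rule antisym)
  have "card (\<Union>C\<in>\<C>. fst ` exit_matchings E C) \<le> card X"
    using exit_vertices_subset barrier_facts(6) by (intro card_mono) auto
  then show "card (\<Union>C\<in>\<C>. fst ` exit_matchings E C) \<le> card \<C>" using barrier_facts(4) by simp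
  obtain \<phi> where "\<phi> \<in> sdrs \<C> (exit_matchings E) fst" using barrier_sdr by blast
  then show "card \<C> \<le> card (\<Union>C\<in>\<C>. fst ` exit_matchings E C)"
    by (rule sdrs_hall) (use barrier_facts(5) finite_exit_matchings[OF G] in auto)
qed

text \<open>Completions with distinct outside vertices glue to a perfect matching, as the parts are
  as many as the vertices of \<open>X\<close>. Every edge of it meets exactly one part, so the
  pieces, and from their unions the outside vertices, can be read off again.\<close>

lemma sdrs_le_perfect_matchings:
  "card (sdrs \<C> (exit_matchings E) fst) \<le> card {M. perfect_matching W E M}"
proof (rule card_inj_on_le)
  let ?h = "\<lambda>\<phi>. \<Union>C\<in>\<C>. snd (\<phi> C)"
  have row: "fst (\<phi> C) \<in> X \<and> perfect_matching (insert (fst (\<phi> C)) C) E (snd (\<phi> C))"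
    if "\<phi> \<in> sdrs \<C> (exit_matchings E) fst" "C \<in> \<C>" for \<phi> C
  proof -
    have "\<phi> C \<in> exit_matchings E C" using that by (auto simp: sdrs_def)
    moreover from this have "fst (\<phi> C) \<in> X" using exit_vertices_subset[OF that(2)] by blast
    ultimately show ?thesis by (auto simp: exit_matchings_def split_beta)
  qed
  have meets: "d \<inter> C \<noteq> {}" if \<phi>: "\<phi> \<in> sdrs \<C> (exit_matchings E) fst" and C: "C \<in> \<C>" and d: "d \<in> snd (\<phi> C)" for \<phi> C d
  proof
    assume "d \<inter> C = {}"
    moreover have "d \<subseteq> insert (fst (\<phi> C)) C" "d \<in> E"
      using perfect_matching_subset[OF conjunct2[OF row[OF \<phi> C]] d] by auto
    ultimately have "d \<subseteq> {fst (\<phi> C)}" "card d = 2" using edge_card by auto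
    then show False using card_mono[of "{fst (\<phi> C)}" d] by simp
  qed
  have recover: "snd (\<phi> C) = {d \<in> ?h \<phi>. d \<inter> C \<noteq> {}}"
    if \<phi>: "\<phi> \<in> sdrs \<C> (exit_matchings E) fst" and C: "C \<in> \<C>" for \<phi> C
  proof (intro equalityI subsetI)
    fix d assume "d \<in> snd (\<phi> C)"
    then show "d \<in> {d \<in> ?h \<phi>. d \<inter> C \<noteq> {}}" using meets[OF \<phi> C] C by blast
  next
    fix d assume "d \<in> {d \<in> ?h \<phi>. d \<inter> C \<noteq> {}}"
    then obtain D where D: "D \<in> \<C>" "d \<in> snd (\<phi> D)" and dC: "d \<inter> C \<noteq> {}" by blast
    have "d \<subseteq> insert (fst (\<phi> D)) D" using perfect_matching_subset[OF conjunct2[OF row[OF \<phi> D(1)]] D(2)] by blast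
    then have "D \<inter> C \<noteq> {}" using dC row[OF \<phi> D(1)] barrier_facts(8)[OF C] by blast
    then have "D = C" using barrier_facts(2) D(1) C unfolding disjoint_def by blast
    then show "d \<in> snd (\<phi> C)" using D(2) by simp
  qed
  show "inj_on ?h (sdrs \<C> (exit_matchings E) fst)"
  proof (rule inj_onI)
    fix \<phi> \<psi> assume \<phi>: "\<phi> \<in> sdrs \<C> (exit_matchings E) fst" and \<psi>: "\<psi> \<in> sdrs \<C> (exit_matchings E) fst" and eq: "?h \<phi> = ?h \<psi>"
    have "\<phi> C = \<psi> C" if C: "C \<in> \<C>" for C
    proof -
      have s: "snd (\<phi> C) = snd (\<psi> C)" unfolding recover[OF \<phi> C] recover[OF \<psi> C] eq ..
      have "insert (fst (\<phi> C)) C = \<Union>(snd (\<phi> C))" "insert (fst (\<psi> C)) C = \<Union>(snd (\<psi> C))"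
        using row[OF \<phi> C] row[OF \<psi> C] by (simp_all add: perfect_matching_def)
      then have "insert (fst (\<phi> C)) C = insert (fst (\<psi> C)) C" using s by simp
      moreover have "fst (\<phi> C) \<notin> C" using row[OF \<phi> C] barrier_facts(8)[OF C] by blast
      ultimately have "fst (\<phi> C) = fst (\<psi> C)" by blast
      then show ?thesis using s by (simp add: prod_eq_iff)
    qed
    then show "\<phi> = \<psi>" using \<phi> \<psi> by (intro PiE_ext[of \<phi> \<C> "exit_matchings E" \<psi>]) (auto simp: sdrs_def)
  qed
  show "?h ` sdrs \<C> (exit_matchings E) fst \<subseteq> {M. perfect_matching W E M}"
  proof (intro image_subsetI CollectI)
    fix \<phi> assume \<phi>: "\<phi> \<in> sdrs \<C> (exit_matchings E) fst"
    have inj: "inj_on (fst \<circ> \<phi>) \<C>" using \<phi> by (simp add: sdrs_def)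
    have "perfect_matching (\<Union>C\<in>\<C>. insert (fst (\<phi> C)) C) E (?h \<phi>)"
    proof (rule perfect_matching_UN)
      show "disjoint_family_on (\<lambda>C. insert (fst (\<phi> C)) C) \<C>"
        unfolding disjoint_family_on_def
      proof (intro ballI impI)
        fix C D assume CD: "C \<in> \<C>" "D \<in> \<C>" "C \<noteq> D"
        have "C \<inter> D = {}" using barrier_facts(2) CD unfolding disjoint_def by blast
        moreover have "fst (\<phi> C) \<noteq> fst (\<phi> D)" using inj_onD[OF inj] CD by fastforce
        moreover have "fst (\<phi> C) \<notin> D" "fst (\<phi> D) \<notin> C"
          using row[OF \<phi>] CD barrier_facts(8) by blast+
        ultimately show "insert (fst (\<phi> C)) C \<inter> insert (fst (\<phi> D)) D = {}" by blast
      qed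
    qed (use row[OF \<phi>] in blast)
    moreover have img: "(\<lambda>C. fst (\<phi> C)) ` \<C> = X"
    proof (rule card_subset_eq[OF barrier_facts(6)])
      show "(\<lambda>C. fst (\<phi> C)) ` \<C> \<subseteq> X" using row[OF \<phi>] by blast
      show "card ((\<lambda>C. fst (\<phi> C)) ` \<C>) = card X"
        using card_image[OF inj] barrier_facts(4) by (simp add: comp_def)
    qed
    have "(\<Union>C\<in>\<C>. insert (fst (\<phi> C)) C) = (\<lambda>C. fst (\<phi> C)) ` \<C> \<union> \<Union>\<C>" by auto
    then have "(\<Union>C\<in>\<C>. insert (fst (\<phi> C)) C) = W"
      unfolding img barrier_facts(3) using barrier_facts(1) by auto
    ultimately show "perfect_matching W E (?h \<phi>)" by simp
  qed
  show "finite {M. perfect_matching W E M}" by (rule finite_perfect_matchings[OF finW])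
qed

lemma barrier_two_neighbours:
  assumes bi: "biconnected W E" and X: "2 \<le> card X" and C: "C \<in> \<C>"
  shows "2 \<le> card (fst ` exit_matchings E C)"
proof -
  have CW: "C \<subseteq> W" "C \<noteq> {}" using barrier_facts(8)[OF C] by auto
  have "X \<subseteq> W - C" using barrier_facts(1,8) C by blast
  then have "card X \<le> card (W - C)" using finW by (intro card_mono) auto
  then have "2 \<le> card {x \<in> W - C. \<exists>c\<in>C. {x, c} \<in> E}"
    using X by (intro two_outer_neighbours[OF G bi CW]) simp
  also have "{x \<in> W - C. \<exists>c\<in>C. {x, c} \<in> E} = fst ` exit_matchings E C"
    unfolding exit_vertices[OF barrier_facts(7)[OF C] edge_card] using edge_subset by blast
  finally show ?thesis .
qed

end

lemma degree_le_perfect_matchings: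
  assumes fin: "finite W" and ext: "\<And>e. e \<in> E \<Longrightarrow> v \<in> e \<Longrightarrow> \<exists>M. perfect_matching W E M \<and> e \<in> M"
  shows "degree E v \<le> card {M. perfect_matching W E M}"
proof -
  let ?S = "{e \<in> E. v \<in> e}"
  obtain r where r: "\<And>e. e \<in> ?S \<Longrightarrow> perfect_matching W E (r e) \<and> e \<in> r e" using ext by (metis (mono_tags, lifting) mem_Collect_eq)
  have "inj_on r ?S"
  proof (rule inj_onI)
    fix d e assume de: "d \<in> ?S" "e \<in> ?S" "r d = r e"
    then show "d = e" using r[OF de(1)] r[OF de(2)] perfect_matching_edge_unique[of W E "r d" d e v] by simp
  qed
  then have "card ?S \<le> card {M. perfect_matching W E M}"
    by (rule card_inj_on_le) (use r finite_perfect_matchings[OF fin] in auto)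
  then show ?thesis by (simp add: degree_def)
qed

lemma edge_in_perfect_matching:
  assumes crit: "factor_critical E (W - {v})" and v: "v \<in> W" and e: "e \<in> E" "v \<in> e" "e \<subseteq> W" "card e = 2"
  shows "\<exists>M. perfect_matching W E M \<and> e \<in> M"
proof -
  obtain u where u: "u \<noteq> v" "e = {v, u}" using card_2_other[OF e(4,2)] by blast
  have uW: "u \<in> W - {v}" using u e by auto
  obtain P where "perfect_matching (W - {v} - {u}) E P" using crit uW unfolding factor_critical_def by blast
  then have "perfect_matching (e \<union> (W - {v} - {u})) E (insert e P)"
    using u by (intro perfect_matching_insert[OF _ e(1)]) auto
  moreover have "e \<union> (W - {v} - {u}) = W" using u uW v by auto
  ultimately show ?thesis by auto
qed

text \<open>A single part must be all of \<open>W - {v}\<close>; its factor-criticality is what lets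
  every edge at \<open>v\<close> be extended to a perfect matching.\<close>

lemma singleton_barrier_critical:
  assumes G: "simple_graph W E" and bar: "barrier E W X \<C>" "v \<in> X" "\<not> 2 \<le> card X"
  shows "factor_critical E (W - {v})"
proof -
  note facts = barrier_facts[OF G bar(1)]
  have "card X \<noteq> 0" using bar(2) facts(6) by auto
  then have c1: "card X = 1" using bar(3) by linarith
  then have "X = {v}" using bar(2) by (metis card_1_singletonE singletonD)
  moreover obtain C where "\<C> = {C}" using c1 facts(4) by (metis card_1_singletonE)
  ultimately have "C = W - {v}" "C \<in> \<C>" using facts(3) by auto
  then show ?thesis using facts(7) by blast
qed

section \<open>Counting perfect matchings by contraction\<close>

definition edge_cut :: "'a set set \<Rightarrow> 'a set \<Rightarrow> 'a set set" where
  "edge_cut E C = {e \<in> E. e \<inter> C \<noteq> {} \<and> \<not> e \<subseteq> C}"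

lemma edge_cutE:
  assumes "e \<in> edge_cut E C" "\<forall>e\<in>E. card e = 2"
  obtains c x where "c \<in> C" "x \<notin> C" "e = {x, c}" "e \<in> E"
proof -
  have e: "e \<in> E" "\<not> e \<subseteq> C" and "e \<inter> C \<noteq> {}" using assms(1) by (auto simp: edge_cut_def)
  then obtain c where c: "c \<in> e" "c \<in> C" by blast
  obtain x where x: "e = {c, x}" using card_2_other[of e c] assms(2) e(1) c(1) by blast
  then have "x \<notin> C" using e(2) c by auto
  then show ?thesis using that[of c x] c x e by (simp add: insert_commute)
qed

text \<open>A cut edge \<open>{x, c}\<close> is completed by a perfect matching of
  \<open>C - {c}\<close>. It is the only edge of this completion that is not inside
  \<open>C\<close>, so different cut edges give different completions.\<close>

lemma card_edge_cut_le_exit_matchings: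
  assumes G: "simple_graph W E" and C: "factor_critical E C"
  shows "card (edge_cut E C) \<le> card (exit_matchings E C)"
proof -
  have E: "\<forall>e\<in>E. card e = 2" using G by (simp add: simple_graph_def)
  have "\<exists>p\<in>exit_matchings E C. {d \<in> snd p. \<not> d \<subseteq> C} = {e}" if e: "e \<in> edge_cut E C" for e
  proof -
    obtain c x where c: "c \<in> C" "x \<notin> C" "e = {x, c}" "e \<in> E" using edge_cutE[OF e E] by blast
    obtain P where P: "perfect_matching (C - {c}) E P" "(x, insert {x, c} P) \<in> exit_matchings E C"
      using exit_matchingsI[OF C, of x c] c by blast
    have "d \<subseteq> C" if "d \<in> P" for d using perfect_matching_subset[OF P(1) that] by blast
    then have "{d \<in> snd (x, insert {x, c} P). \<not> d \<subseteq> C} = {e}" using c by auto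
    then show ?thesis using P(2) by blast
  qed
  then obtain r where r: "\<And>e. e \<in> edge_cut E C \<Longrightarrow> r e \<in> exit_matchings E C \<and> {d \<in> snd (r e). \<not> d \<subseteq> C} = {e}"
    by metis
  have "inj_on r (edge_cut E C)"
  proof (rule inj_onI)
    fix d e assume "d \<in> edge_cut E C" "e \<in> edge_cut E C" "r d = r e"
    then have "{d} = {e}" using r by metis
    then show "d = e" by simp
  qed
  then show ?thesis by (rule card_inj_on_le) (use r finite_exit_matchings[OF G] in auto)
qed

text \<open>The complement of \<open>C\<close> shrinks to \<open>z\<close>, later one of its own
  vertices, so that the smaller graph stays in the same type. Cut edges with a common end in
  \<open>C\<close> become a single edge.\<close>

definition contract :: "'a set set \<Rightarrow> 'a set \<Rightarrow> 'a \<Rightarrow> 'a set set" where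
  "contract E C z = {e \<in> E. e \<subseteq> C} \<union> (\<lambda>e. insert z (e \<inter> C)) ` edge_cut E C"

context
  fixes W :: "'a set" and E C z
  assumes G: "simple_graph W E" and bi: "biconnected W E" and CW: "C \<subseteq> W" and C: "factor_critical E C"
    and z: "z \<in> W - C"
begin

lemma graph_edges: "finite W" "\<forall>e\<in>E. card e = 2" "\<And>e. e \<in> E \<Longrightarrow> e \<subseteq> W"
  using G by (auto simp: simple_graph_def)

lemma contract_graph: "simple_graph (insert z C) (contract E C z)"
  unfolding simple_graph_def
proof (intro conjI ballI)
  show "finite (insert z C)" using graph_edges(1) CW by (auto intro: finite_subset)
  fix e assume "e \<in> contract E C z"
  then consider "e \<in> E" "e \<subseteq> C" | d where "d \<in> edge_cut E C" "e = insert z (d \<inter> C)"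
    by (auto simp: contract_def)
  then have "e \<subseteq> insert z C \<and> card e = 2"
  proof cases
    case 1
    then show ?thesis using graph_edges(2) by auto
  next
    case 2
    obtain c x where "c \<in> C" "x \<notin> C" "d = {x, c}" using edge_cutE[OF 2(1) graph_edges(2)] by blast
    then have "d \<inter> C = {c}" "z \<noteq> c" "c \<in> C" using z by auto
    then show ?thesis using 2(2) by simp
  qed
  then show "e \<subseteq> insert z C" "card e = 2" by auto
qed

lemma contract_cut_edge:
  assumes "{x, c} \<in> E" "x \<notin> C" "c \<in> C" shows "{z, c} \<in> contract E C z"
proof -
  have "{x, c} \<in> edge_cut E C" "insert z ({x, c} \<inter> C) = {z, c}" using assms by (auto simp: edge_cut_def)
  then show ?thesis unfolding contract_def by blast
qed

text \<open>If \<open>z\<close> lies in \<open>A\<close>, adding the whole complement of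
  \<open>C\<close> to \<open>A\<close> gives a bipartition of the original graph. If
  \<open>z\<close> lies on neither side, it is the deleted vertex, and the claim is that
  \<open>C\<close> is connected, which factor-criticality provides.\<close>

lemma contract_separation:
  assumes "A \<noteq> {}" "B \<noteq> {}" "A \<inter> B = {}" "A \<union> B \<subseteq> insert z C" "insert z C - {s} \<subseteq> A \<union> B" "z \<notin> B"
  shows "\<exists>a\<in>A. \<exists>b\<in>B. {a, b} \<in> contract E C z"
proof (cases "z \<in> A")
  case True
  have BC: "B \<subseteq> C" using assms(4,6) by blast
  obtain a b where ab: "a \<in> A \<union> (W - C)" "b \<in> B" "{a, b} \<in> E"
  proof (rule biconnectedD[OF bi, of "A \<union> (W - C)" B s])
    show "A \<union> (W - C) \<noteq> {}" "B \<noteq> {}" using assms(1,2) by auto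
    show "(A \<union> (W - C)) \<inter> B = {}" using assms(3) BC by blast
    show "A \<union> (W - C) \<union> B \<subseteq> W" using assms(4) CW z by auto
    show "W - {s} \<subseteq> A \<union> (W - C) \<union> B" using assms(5) by blast
  qed
  show ?thesis
  proof (cases "a \<in> C")
    case True
    then have "{a, b} \<in> contract E C z" using ab(2,3) BC by (auto simp: contract_def)
    moreover have "a \<in> A" using ab(1) True by blast
    ultimately show ?thesis using ab(2) by blast
  next
    case False
    have "{z, b} \<in> contract E C z" using contract_cut_edge[OF ab(3) False] ab(2) BC by blast
    then show ?thesis using \<open>z \<in> A\<close> ab(2) by blast
  qed
next
  case False
  have "finite C" using graph_edges(1) CW by (rule finite_subset[rotated])
  have zs: "z = s" using assms(5,6) False by blast
  have "A \<union> B = C" using assms(4,5,6) False z unfolding zs by blast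
  then obtain a b where ab: "a \<in> A" "b \<in> B" "{a, b} \<in> E"
    using factor_critical_connected[OF C \<open>finite C\<close> graph_edges(2) assms(1,2,3)] by blast
  moreover have "{a, b} \<subseteq> C" using ab \<open>A \<union> B = C\<close> by blast
  ultimately have "{a, b} \<in> contract E C z" by (simp add: contract_def)
  then show ?thesis using ab by blast
qed

lemma contract_biconnected: "biconnected (insert z C) (contract E C z)"
  unfolding biconnected_def
proof (intro allI impI)
  fix A B s
  assume AB: "A \<noteq> {}" "B \<noteq> {}" "A \<inter> B = {}" "A \<union> B \<subseteq> insert z C" "insert z C - {s} \<subseteq> A \<union> B"
  show "\<exists>a\<in>A. \<exists>b\<in>B. {a, b} \<in> contract E C z"
  proof (cases "z \<in> B")
    case False
    then show ?thesis using contract_separation[OF AB] by blast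
  next
    case True
    then have "z \<notin> A" using AB(3) by blast
    then have "\<exists>b\<in>B. \<exists>a\<in>A. {b, a} \<in> contract E C z"
      using AB by (intro contract_separation[of B A s]) (auto simp: Un_commute Int_commute)
    then show ?thesis by (metis insert_commute)
  qed
qed

lemma contract_perfect_matching: "\<exists>M. perfect_matching (insert z C) (contract E C z) M"
proof -
  have "C \<noteq> {}" "W - C \<noteq> {}" using C z by (auto simp: factor_critical_def)
  then obtain c x where cx: "c \<in> C" "x \<in> W - C" "{c, x} \<in> E"
    using biconnectedD[OF bi, of C "W - C"] CW by blast
  then have e: "{z, c} \<in> contract E C z" by (intro contract_cut_edge[of x]) (auto simp: insert_commute)
  obtain P where P: "perfect_matching (C - {c}) E P" using C cx(1) unfolding factor_critical_def by blast
  have "P \<subseteq> contract E C z" using perfect_matching_subset[OF P] unfolding contract_def by blast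
  then have "perfect_matching (C - {c}) (contract E C z) P" by (rule perfect_matching_mono[OF P])
  then have "perfect_matching ({z, c} \<union> (C - {c})) (contract E C z) (insert {z, c} P)"
    using z by (intro perfect_matching_insert[OF _ e]) auto
  moreover have "{z, c} \<union> (C - {c}) = insert z C" using cx by blast
  ultimately show ?thesis by auto
qed

text \<open>Injectivity says that no two edges of the cut become parallel under contraction.\<close>

lemma contract_degree:
  assumes inj: "inj_on (\<lambda>e. e \<inter> C) (edge_cut E C)" and c: "c \<in> C"
  shows "degree E c \<le> degree (contract E C z) c"
proof -
  define h where "h e = (if e \<subseteq> C then e else insert z (e \<inter> C))" for e
  have cut: "e \<in> edge_cut E C" if "e \<in> E" "c \<in> e" "\<not> e \<subseteq> C" for e
    using that c by (auto simp: edge_cut_def)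
  have strip: "h e \<inter> C = e \<inter> C" for e using z by (auto simp: h_def)
  have inner: "e \<subseteq> C \<longleftrightarrow> z \<notin> h e" for e using z by (auto simp: h_def)
  have "inj_on h {e \<in> E. c \<in> e}"
  proof (rule inj_onI)
    fix d e assume de: "d \<in> {e \<in> E. c \<in> e}" "e \<in> {e \<in> E. c \<in> e}" "h d = h e"
    have same: "d \<subseteq> C \<longleftrightarrow> e \<subseteq> C" "d \<inter> C = e \<inter> C"
      using inner[of d] inner[of e] strip[of d] strip[of e] unfolding de(3) by simp_all
    show "d = e"
    proof (cases "e \<subseteq> C")
      case True
      then show ?thesis using same de(3) by (simp add: h_def)
    next
      case False
      then have "d \<in> edge_cut E C" "e \<in> edge_cut E C" using same(1) cut de(1,2) by simp_all
      then show ?thesis by (rule inj_onD[OF inj same(2)])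
    qed
  qed
  moreover have "h ` {e \<in> E. c \<in> e} \<subseteq> {e \<in> contract E C z. c \<in> e}"
    using cut c by (auto simp: contract_def h_def)
  moreover have "finite {e \<in> contract E C z. c \<in> e}"
  proof (rule finite_subset[of _ "Pow (insert z C)"])
    show "{e \<in> contract E C z. c \<in> e} \<subseteq> Pow (insert z C)"
      using contract_graph by (auto simp: simple_graph_def)
    show "finite (Pow (insert z C))" using contract_graph by (simp add: simple_graph_def)
  qed
  ultimately show ?thesis unfolding degree_def by (rule card_inj_on_le)
qed

text \<open>Replacing the edge at \<open>z\<close> by a cut edge with the same end in
  \<open>C\<close> turns a matching of the contraction into a completion. The edges inside
  \<open>C\<close> are kept and determine the edge at \<open>z\<close> as the pair they leave
  uncovered, hence injectivity.\<close>

lemma contract_matchings_le_exit_matchings: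
  "card {M. perfect_matching (insert z C) (contract E C z) M} \<le> card (exit_matchings E C)"
proof -
  let ?M = "{M. perfect_matching (insert z C) (contract E C z) M}"
  have E': "\<forall>e\<in>contract E C z. card e = 2" using contract_graph by (simp add: simple_graph_def)
  define Q where "Q M p \<longleftrightarrow> p \<in> exit_matchings E C \<and> {d \<in> snd p. d \<subseteq> C} = {d \<in> M. d \<subseteq> C}
      \<and> M = insert (insert z C - \<Union>{d \<in> M. d \<subseteq> C}) {d \<in> M. d \<subseteq> C}" for M p
  have "\<exists>p. Q M p" if "M \<in> ?M" for M
  proof -
    have M: "perfect_matching (insert z C) (contract E C z) M" using that by simp
    then obtain e where e: "e \<in> M" "z \<in> e" unfolding perfect_matching_def by blast
    have "e \<in> contract E C z" using perfect_matching_subset[OF M e(1)] by blast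
    moreover have "\<not> e \<subseteq> C" using e(2) z by blast
    ultimately obtain d where d: "d \<in> edge_cut E C" "e = insert z (d \<inter> C)" by (auto simp: contract_def)
    obtain c x where cx: "c \<in> C" "x \<notin> C" "d = {x, c}" "d \<in> E"
      using edge_cutE[OF d(1) graph_edges(2)] by blast
    have ezc: "e = {z, c}" using d(2) cx by auto
    define P where "P = M - {e}"
    have W': "insert z C - e = C - {c}" using ezc z by auto
    have "perfect_matching (insert z C - e) (contract E C z) P"
      unfolding P_def using M e(1) by (rule perfect_matching_remove) (use e(2) in auto)
    then have P0: "perfect_matching (C - {c}) (contract E C z) P" unfolding W' .
    have PC: "d \<subseteq> C - {c} \<and> d \<in> E" if "d \<in> P" for d
    proof -
      have "d \<subseteq> C - {c}" "d \<in> contract E C z" using perfect_matching_subset[OF P0 that] by auto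
      moreover have "z \<notin> d" using calculation(1) z by blast
      ultimately show ?thesis by (auto simp: contract_def)
    qed
    have P: "perfect_matching (C - {c}) E P" using PC by (intro perfect_matching_mono[OF P0]) blast
    have inner: "{d \<in> M. d \<subseteq> C} = P" using PC \<open>\<not> e \<subseteq> C\<close> unfolding P_def by blast
    have UP: "\<Union>P = C - {c}" using P by (simp add: perfect_matching_def)
    have "perfect_matching ({x, c} \<union> (C - {c})) E (insert {x, c} P)"
      using cx by (intro perfect_matching_insert[OF P]) auto
    moreover have "{x, c} \<union> (C - {c}) = insert x C" using cx by blast
    ultimately have "(x, insert {x, c} P) \<in> exit_matchings E C" using cx by (simp add: exit_matchings_def)
    moreover have "{d \<in> snd (x, insert {x, c} P). d \<subseteq> C} = P" using PC cx(2) by auto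
    moreover have "insert z C - \<Union>P = e" using UP ezc z cx(1) by auto
    moreover have "M = insert e P" using e(1) by (auto simp: P_def)
    ultimately have "Q M (x, insert {x, c} P)" unfolding Q_def inner by simp
    then show ?thesis by blast
  qed
  then obtain r where r: "\<And>M. M \<in> ?M \<Longrightarrow> Q M (r M)" by metis
  have "inj_on r ?M"
  proof (rule inj_onI)
    fix M N assume MN: "M \<in> ?M" "N \<in> ?M" "r M = r N"
    have Q: "Q M (r N)" "Q N (r N)" using r[OF MN(1)] r[OF MN(2)] MN(3) by simp_all
    note q = conjunct2[OF Q(1)[unfolded Q_def]] conjunct2[OF Q(2)[unfolded Q_def]]
    have inner: "{d \<in> M. d \<subseteq> C} = {d \<in> N. d \<subseteq> C}"
      by (rule trans[OF sym[OF conjunct1[OF q(1)]] conjunct1[OF q(2)]])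
    show "M = N"
      by (rule trans[OF conjunct2[OF q(1)] trans[OF _ sym[OF conjunct2[OF q(2)]]]]) (simp only: inner)
  qed
  moreover have "r ` ?M \<subseteq> exit_matchings E C" using r unfolding Q_def by (intro image_subsetI) (rule conjunct1)
  ultimately show ?thesis by (rule card_inj_on_le) (rule finite_exit_matchings[OF G])
qed

end

text \<open>Three cut edges give one completion each; otherwise the matchings of the contraction
  supply them. The induction hypothesis is an assumption, so that the lemma serves inside the
  induction for three matchings and, with that result inserted, in the final bound.\<close>

lemma three_exit_matchings:
  fixes W :: "'a set"
  assumes G: "simple_graph W E" and bi: "biconnected W E" and CW: "C \<subseteq> W" and C: "factor_critical E C"
    and out: "2 \<le> card (W - C)" and deg: "\<And>c. c \<in> C \<Longrightarrow> 3 \<le> degree E c"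
    and IH: "\<And>(W' :: 'a set) E' z. card W' < card W \<Longrightarrow> simple_graph W' E' \<Longrightarrow> biconnected W' E' \<Longrightarrow>
      \<exists>M. perfect_matching W' E' M \<Longrightarrow> 4 \<le> card W' \<Longrightarrow> (\<And>w. w \<in> W' - {z} \<Longrightarrow> 3 \<le> degree E' w) \<Longrightarrow>
      3 \<le> card {M. perfect_matching W' E' M}"
  shows "3 \<le> card (exit_matchings E C)"
proof (cases "3 \<le> card (edge_cut E C)")
  case True
  then show ?thesis using card_edge_cut_le_exit_matchings[OF G C] by simp
next
  case few: False
  have finW: "finite W" and E: "\<forall>e\<in>E. card e = 2" and EW: "\<And>e. e \<in> E \<Longrightarrow> e \<subseteq> W"
    using G by (auto simp: simple_graph_def)
  have finC: "finite C" using CW finW by (rule finite_subset)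
  have "E \<subseteq> Pow W" using EW by blast
  then have "finite E" using finW by (auto intro: finite_subset)
  then have fin_cut: "finite (edge_cut E C)" by (simp add: edge_cut_def)
  have oddC: "odd (card C)" by (rule factor_critical_odd[OF C finC E])
  \<comment> \<open>All edges at a single vertex lie in the cut, which has fewer than three. An odd
    part of another size has at least three vertices, so the contraction has at least four.\<close>
  have "card C \<noteq> 1"
  proof
    assume "card C = 1"
    then obtain c where c: "C = {c}" by (rule card_1_singletonE)
    have "{e \<in> E. c \<in> e} \<subseteq> edge_cut E C"
    proof
      fix e assume e: "e \<in> {e \<in> E. c \<in> e}"
      have "\<not> e \<subseteq> {c}"
      proof
        assume "e \<subseteq> {c}"
        then have "card e \<le> card {c}" by (intro card_mono) simp_all
        then show False using E e by simp
      qed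
      then show "e \<in> edge_cut E C" using e c by (auto simp: edge_cut_def)
    qed
    then have "degree E c \<le> card (edge_cut E C)" unfolding degree_def using fin_cut by (intro card_mono)
    then show False using deg[of c] c few by simp
  qed
  then have C3: "3 \<le> card C" using oddC by presburger
  have dC: "W - (W - C) = C" using CW by blast
  have WC: "W - C \<noteq> {}" using out by (metis card.empty not_numeral_le_zero)
  have "2 \<le> card {x \<in> W - (W - C). \<exists>c\<in>W - C. {x, c} \<in> E}"
    by (rule two_outer_neighbours[OF G bi _ WC]) (use C3 dC in auto)
  then have two: "2 \<le> card {x \<in> C. \<exists>c\<in>W - C. {x, c} \<in> E}" unfolding dC .
  \<comment> \<open>The cut has two different ends in \<open>C\<close> by 2-connectedness. As it has
    at most two edges, these ends are distinct, and contraction loses no edge at a vertex of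
    \<open>C\<close>.\<close>
  have sub: "(\<lambda>x. {x}) ` {x \<in> C. \<exists>c\<in>W - C. {x, c} \<in> E} \<subseteq> (\<lambda>e. e \<inter> C) ` edge_cut E C"
  proof (rule image_subsetI)
    fix x assume "x \<in> {x \<in> C. \<exists>c\<in>W - C. {x, c} \<in> E}"
    then obtain y where y: "x \<in> C" "y \<in> W - C" "{x, y} \<in> E" by blast
    then have "{x, y} \<in> edge_cut E C" "{x} = {x, y} \<inter> C" by (auto simp: edge_cut_def)
    then show "{x} \<in> (\<lambda>e. e \<inter> C) ` edge_cut E C" by blast
  qed
  have "2 \<le> card ((\<lambda>x. {x}) ` {x \<in> C. \<exists>c\<in>W - C. {x, c} \<in> E})"
    using two by (subst card_image) simp_all
  also have "\<dots> \<le> card ((\<lambda>e. e \<inter> C) ` edge_cut E C)"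
    using fin_cut sub by (intro card_mono) simp_all
  finally have "card (edge_cut E C) \<le> card ((\<lambda>e. e \<inter> C) ` edge_cut E C)" using few by simp
  then have inj: "inj_on (\<lambda>e. e \<inter> C) (edge_cut E C)"
    using fin_cut by (intro eq_card_imp_inj_on) (simp_all add: card_image_le le_antisym)
  obtain z where z: "z \<in> W - C" using WC by blast
  have cW': "card (insert z C) = Suc (card C)" using z finC by simp
  have "3 \<le> card {M. perfect_matching (insert z C) (contract E C z) M}"
  proof (rule IH[where z = z])
    have "card (W - C) = card W - card C" using finC CW by (rule card_Diff_subset)
    then show "card (insert z C) < card W" using cW' out by linarith
    show "4 \<le> card (insert z C)" using cW' C3 by simp
    show "3 \<le> degree (contract E C z) w" if "w \<in> insert z C - {z}" for w
      using contract_degree[OF G bi CW C z inj, of w] deg[of w] that by fastforce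
  qed (rule contract_graph[OF G bi CW C z] contract_biconnected[OF G bi CW C z]
        contract_perfect_matching[OF G bi CW C z])+
  also have "\<dots> \<le> card (exit_matchings E C)" by (rule contract_matchings_le_exit_matchings[OF G bi CW C z])
  finally show ?thesis .
qed

text \<open>\<open>z\<close> stands for a contracted vertex, whose degree is not controlled. The
  barrier is taken through another vertex \<open>v\<close>, which contributes three extendable edges
  if the barrier is just \<open>{v}\<close>.\<close>

lemma three_perfect_matchings:
  assumes "simple_graph W E" "biconnected W E" "\<exists>M. perfect_matching W E M" "4 \<le> card W"
    and "\<And>w. w \<in> W - {z} \<Longrightarrow> 3 \<le> degree E w"
  shows "3 \<le> card {M. perfect_matching W E M}"
  using assms
proof (induction "card W" arbitrary: W E z rule: less_induct)
  case (less W E z)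
  note G = less.prems(1) and bi = less.prems(2) and deg = less.prems(5)
  have finW: "finite W" and E: "\<And>e. e \<in> E \<Longrightarrow> e \<subseteq> W \<and> card e = 2"
    using G by (auto simp: simple_graph_def)
  have "\<not> W \<subseteq> {z}"
  proof
    assume "W \<subseteq> {z}"
    then have "card W \<le> card {z}" by (intro card_mono) simp_all
    then show False using less.prems(4) by simp
  qed
  then obtain v where v: "v \<in> W" "v \<noteq> z" by blast
  obtain M where "perfect_matching W E M" using less.prems(3) by blast
  then obtain X \<C> where bar: "barrier E W X \<C>" "v \<in> X" using barrier_exists[OF G _ v(1)] by blast
  note facts = barrier_facts[OF G bar(1)]
  show ?case
  proof (cases "2 \<le> card X")
    case True
    \<comment> \<open>\<open>C0\<close> is the part containing \<open>z\<close>, if there is one,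
      and the only row for which three completions are not guaranteed.\<close>
    obtain C0 where C0: "\<And>C. C \<in> \<C> \<Longrightarrow> z \<in> C \<Longrightarrow> C = C0"
      using facts(2) unfolding disjoint_def by (metis disjoint_iff)
    have "3 \<le> card (sdrs \<C> (exit_matchings E) fst)"
    proof (rule three_sdrs[where k = C0])
      show "\<C> \<noteq> {}" using facts(4) True by auto
      fix C assume C: "C \<in> \<C>" "C \<noteq> C0"
      have "X \<subseteq> W - C" using facts(1) facts(8)[OF C(1)] by blast
      then have "card X \<le> card (W - C)" using finW by (intro card_mono) auto
      then have out: "2 \<le> card (W - C)" using True by simp
      show "3 \<le> card (exit_matchings E C)"
      proof (rule three_exit_matchings[OF G bi _ facts(7)[OF C(1)] out _ less.hyps])
        show "C \<subseteq> W" using facts(8)[OF C(1)] by blast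
        show "3 \<le> degree E c" if "c \<in> C" for c
          using that C0[OF C(1)] C(2) facts(8)[OF C(1)] by (intro deg) auto
      qed
    qed (use facts(5) finite_exit_matchings[OF G] barrier_sdr[OF G bar(1)] barrier_tight[OF G bar(1)]
          barrier_two_neighbours[OF G bar(1) bi True] in auto)
    then show ?thesis using sdrs_le_perfect_matchings[OF G bar(1)] by simp
  next
    case False
    have "degree E v \<le> card {M. perfect_matching W E M}"
    proof (rule degree_le_perfect_matchings[OF finW])
      fix e assume "e \<in> E" "v \<in> e"
      then show "\<exists>M. perfect_matching W E M \<and> e \<in> M"
        using singleton_barrier_critical[OF G bar False] v(1) E by (intro edge_in_perfect_matching) auto
    qed
    then show ?thesis using deg[of v] v by simp
  qed
qed

theorem four_perfect_matchings:
  assumes G: "simple_graph W E" and bi: "biconnected W E" and pm: "\<exists>M. perfect_matching W E M"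
    and W5: "5 \<le> card W" and deg: "\<And>w. w \<in> W \<Longrightarrow> 3 \<le> degree E w"
  shows "4 \<le> card {M. perfect_matching W E M}"
proof (cases "\<exists>X \<C>. barrier E W X \<C> \<and> 2 \<le> card X")
  case True
  then obtain X \<C> where bar: "barrier E W X \<C>" and X: "2 \<le> card X" by blast
  note facts = barrier_facts[OF G bar]
  have finW: "finite W" using G by (simp add: simple_graph_def)
  have "4 \<le> card (sdrs \<C> (exit_matchings E) fst)"
  proof (rule four_sdrs)
    show "\<C> \<noteq> {}" using facts(4) X by auto
    fix C assume C: "C \<in> \<C>"
    have "X \<subseteq> W - C" using facts(1) facts(8)[OF C] by blast
    then have "card X \<le> card (W - C)" using finW by (intro card_mono) auto
    then have out: "2 \<le> card (W - C)" using X by simp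
    show "3 \<le> card (exit_matchings E C)"
    proof (rule three_exit_matchings[OF G bi _ facts(7)[OF C] out _ three_perfect_matchings])
      show "C \<subseteq> W" using facts(8)[OF C] by blast
      show "3 \<le> degree E c" if "c \<in> C" for c using that facts(8)[OF C] by (intro deg) auto
    qed
  qed (use facts(5) finite_exit_matchings[OF G] barrier_sdr[OF G bar] barrier_tight[OF G bar]
        barrier_two_neighbours[OF G bar bi X] in auto)
  then show ?thesis using sdrs_le_perfect_matchings[OF G bar] by simp
next
  case bicritical: False
  have finW: "finite W" and E: "\<And>e. e \<in> E \<Longrightarrow> e \<subseteq> W \<and> card e = 2"
    using G by (auto simp: simple_graph_def)
  let ?P = "{M. perfect_matching W E M}"
  obtain M0 where M0: "perfect_matching W E M0" using pm by blast
  have ext: "\<exists>M. perfect_matching W E M \<and> e \<in> M" if v: "v \<in> W" and e: "e \<in> E" "v \<in> e" for v e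
  proof -
    obtain X \<C> where bar: "barrier E W X \<C>" "v \<in> X" using barrier_exists[OF G M0 v] by blast
    have "\<not> 2 \<le> card X" using bicritical bar(1) by blast
    then show ?thesis
      using singleton_barrier_critical[OF G bar] v e E by (intro edge_in_perfect_matching) auto
  qed
  show ?thesis
  proof (rule ccontr)
    assume few: "\<not> 4 \<le> card ?P"
    have "W \<noteq> {}" using W5 by auto
    then obtain v where v: "v \<in> W" by blast
    have finP: "finite ?P" by (rule finite_perfect_matchings[OF finW])
    have "3 \<le> card ?P"
      using deg[OF v] degree_le_perfect_matchings[OF finW ext[OF v]] by (rule le_trans)
    then have c3: "card ?P = 3" using few by simp
    then obtain M1 M2 M3 where P: "?P = {M1, M2, M3}" by (auto simp: card_3_iff)
    \<comment> \<open>Every edge at \<open>u\<close> lies in one of the three matchings. If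
      \<open>M\<close> and \<open>N\<close> share the edge at \<open>u\<close>, the two matchings
      other than \<open>N\<close> already account for all edges there, and the degree of
      \<open>u\<close> would be at most two.\<close>
    have disj: "M \<inter> N = {}" if MN: "M \<in> ?P" "N \<in> ?P" "M \<noteq> N" for M N
    proof (rule ccontr)
      assume "M \<inter> N \<noteq> {}"
      then obtain e where e: "e \<in> M" "e \<in> N" by blast
      have pM: "perfect_matching W E M" and pN: "perfect_matching W E N" using MN by auto
      have "e \<in> E" using perfect_matching_subset[OF pM e(1)] by blast
      then have "e \<noteq> {}" "e \<subseteq> W" using E[of e] by auto
      then obtain u where u: "u \<in> e" "u \<in> W" by blast
      define h where "h L = (THE d. d \<in> L \<and> u \<in> d)" for L :: "'a set set"
      have h: "h L = d" if "perfect_matching W E L" "d \<in> L" "u \<in> d" for L d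
        unfolding h_def using that perfect_matching_edge_unique[OF that(1)] by (intro the_equality) auto
      have "{d \<in> E. u \<in> d} \<subseteq> h ` (?P - {N})"
      proof
        fix d assume "d \<in> {d \<in> E. u \<in> d}"
        then obtain L where L: "perfect_matching W E L" "d \<in> L" "u \<in> d" using ext[OF u(2), of d] by blast
        show "d \<in> h ` (?P - {N})"
        proof (cases "L = N")
          case True
          then have "d = e" using perfect_matching_edge_unique[OF pN _ e(2) _ u(1)] L by blast
          then have "h M = d" using h[OF pM e(1) u(1)] by simp
          then show ?thesis using MN(1,3) by blast
        next
          case False
          then show ?thesis using h[OF L] L(1) by blast
        qed
      qed
      then have "card {d \<in> E. u \<in> d} \<le> card (h ` (?P - {N}))"
        using finP by (intro card_mono) simp_all
      also have "\<dots> \<le> card (?P - {N})" using finP by (intro card_image_le) simp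
      also have "\<dots> = 2" using c3 MN(2) finP by simp
      finally show False using deg[OF u(2)] by (simp add: degree_def)
    qed
    have M: "M1 \<in> ?P" "M2 \<in> ?P" "M3 \<in> ?P" unfolding P by simp_all
    have "M1 \<noteq> M2 \<and> M1 \<noteq> M3 \<and> M2 \<noteq> M3"
      using c3 unfolding P by (auto simp: card_insert_if split: if_splits)
    then have "M1 \<inter> M2 = {}" "M1 \<inter> M3 = {}" "M2 \<inter> M3 = {}" using disj M by simp_all
    then obtain L where "perfect_matching W E L" "L \<notin> {M1, M2, M3}"
      using fourth_perfect_matching[of E W M1 M2 M3] E finW W5 M by auto
    then show False using P by blast
  qed
qed

section \<open>The extremal graphs\<close>

lemma continuous_on_parabola:
  "continuous_on S (\<lambda>t. Complex (a + t * d) (s * ((t * d) * (d - t * d))))"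
  unfolding Complex_eq by (intro continuous_intros)

text \<open>Vertices are put on the real axis. Chords on the same side are parabolas with the same leading
  coefficient, so nested ones meet at most in a common end.\<close>

lemma two_page_planar:
  fixes R :: "nat \<Rightarrow> nat \<Rightarrow> bool" and page :: "nat \<Rightarrow> nat \<Rightarrow> bool"
  assumes less: "\<And>i j. R i j \<Longrightarrow> i < j"
    and page: "\<And>i j k l. R i j \<Longrightarrow> R k l \<Longrightarrow> page i j = page k l \<Longrightarrow> i < k \<Longrightarrow> k < j \<Longrightarrow> l \<le> j"
  shows "planar V {{i, j} | i j. R i j}"
proof -
  let ?E = "{{i, j} | i j. R i j}"
  define sg :: "nat \<Rightarrow> nat \<Rightarrow> real" where "sg i j = (if page i j then 1 else -1)" for i j
  define curve where "curve i j t = Complex (real i + t * (real j - real i))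
    (sg i j * ((t * (real j - real i)) * ((real j - real i) - t * (real j - real i))))" for i j and t :: real
  define \<gamma> where "\<gamma> e = curve (Min e) (Max e)" for e
  define p where "p v = complex_of_real (real v)" for v :: nat
  have \<gamma>: "\<gamma> {i, j} = curve i j" if "i < j" for i j using that by (simp add: \<gamma>_def)
  have onE: "\<exists>i j. e = {i, j} \<and> R i j \<and> i < j" if "e \<in> ?E" for e using that less by blast
  have point: "\<exists>x::real. z = Complex x (sg i j * ((x - i) * (j - x))) \<and> real i \<le> x \<and> x \<le> real j"
    if z: "z \<in> path_image (curve i j)" and ij: "i < j" for z i j
  proof -
    obtain t where t: "0 \<le> t" "t \<le> 1" "z = curve i j t" using z by (auto simp: path_image_def)
    let ?x = "real i + t * (real j - real i)"
    have "t * (real j - real i) \<le> 1 * (real j - real i)" using t ij by (intro mult_right_mono) auto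
    moreover have "0 \<le> t * (real j - real i)" using t ij by simp
    moreover have "z = Complex ?x (sg i j * ((?x - i) * (j - ?x)))"
      unfolding t(3) curve_def by (simp add: algebra_simps)
    ultimately show ?thesis by (intro exI[of _ ?x]) auto
  qed
  have sg0: "sg i j \<noteq> 0" for i j by (simp add: sg_def)
  have inj: "inj_on p V" by (simp add: p_def inj_on_def)
  have arcs: "arc (\<gamma> e) \<and> {pathstart (\<gamma> e), pathfinish (\<gamma> e)} = p ` e" if e: "e \<in> ?E" for e
  proof -
    obtain i j where ij: "e = {i, j}" "i < j" using onE[OF e] by blast
    have "path (curve i j)" unfolding path_def curve_def by (rule continuous_on_parabola)
    moreover have "inj_on (curve i j) {0..1}" using ij(2) by (auto simp: inj_on_def curve_def)
    moreover have "pathstart (curve i j) = p i" "pathfinish (curve i j) = p j"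
      by (simp_all add: pathstart_def pathfinish_def curve_def p_def complex_of_real_def)
    ultimately show ?thesis using ij \<gamma>[OF ij(2)] by (simp add: arc_def)
  qed
  have vert: "path_image (\<gamma> e) \<inter> p ` V \<subseteq> p ` e" if e: "e \<in> ?E" for e
  proof
    fix z assume z: "z \<in> path_image (\<gamma> e) \<inter> p ` V"
    obtain i j where ij: "e = {i, j}" "i < j" using onE[OF e] by blast
    obtain x :: real where x: "z = Complex x (sg i j * ((x - i) * (j - x)))"
      using point[OF _ ij(2), of z] z ij \<gamma>[OF ij(2)] by auto
    obtain v where v: "z = p v" using z by blast
    then have "Im z = 0" "Re z = real v" by (simp_all add: p_def)
    then have "x = real v" "x = real i \<or> x = real j" using x sg0[of i j] by auto
    then have "v \<in> e" using ij by auto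
    then show "z \<in> p ` e" using v by blast
  qed
  have cross: "path_image (\<gamma> e) \<inter> path_image (\<gamma> f) \<subseteq> p ` (e \<inter> f)"
    if e: "e \<in> ?E" and f: "f \<in> ?E" and ef: "e \<noteq> f" for e f
  proof
    fix z assume z: "z \<in> path_image (\<gamma> e) \<inter> path_image (\<gamma> f)"
    obtain i j where ij: "e = {i, j}" "R i j" "i < j" using onE[OF e] by blast
    obtain k l where kl: "f = {k, l}" "R k l" "k < l" using onE[OF f] by blast
    obtain x :: real where x: "z = Complex x (sg i j * ((x - i) * (j - x)))" "real i \<le> x" "x \<le> real j"
      using point[OF _ ij(3), of z] z ij \<gamma>[OF ij(3)] by auto
    obtain y :: real where y: "z = Complex y (sg k l * ((y - k) * (l - y)))" "real k \<le> y" "y \<le> real l"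
      using point[OF _ kl(3), of z] z kl \<gamma>[OF kl(3)] by auto
    have yx: "y = x" using x(1) y(1) by simp
    have Im: "sg i j * ((x - i) * (j - x)) = sg k l * ((x - k) * (l - x))"
      using x(1) y(1) yx by simp
    have pos: "0 \<le> (x - i) * (j - x)" "0 \<le> (x - k) * (l - x)"
      using x y yx by simp_all
    \<comment> \<open>Over the interior of an inner chord the outer parabola is strictly higher, by
      comparing the two factors of the height.\<close>
    have strict: "(x - c) * (d - x) < (x - a) * (b - x)"
      if "a \<le> c" "d \<le> b" "(a, b) \<noteq> (c, d)" "real c < x" "x < real d" for a b c d :: nat
    proof -
      have le: "x - c \<le> x - a" "d - x \<le> b - x" "0 < x - c" "0 < d - x" using that by auto
      from that(1-3) have "a < c \<or> d < b" by auto
      then show ?thesis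
      proof
        assume "a < c"
        then have "x - c < x - a" by simp
        then show ?thesis using le by (intro mult_less_le_imp_less) auto
      next
        assume "d < b"
        then have "d - x < b - x" by simp
        then show ?thesis using le by (intro mult_le_less_imp_less) auto
      qed
    qed
    have zero: "(x - i) * (j - x) = 0"
    proof (rule ccontr)
      assume n0: "(x - i) * (j - x) \<noteq> 0"
      \<comment> \<open>On different sides of the line the heights have opposite signs, so a common
        point would lie on the line itself.\<close>
      have same: "page i j = page k l"
      proof (rule ccontr)
        assume "page i j \<noteq> page k l"
        then have "(x - i) * (j - x) = - ((x - k) * (l - x))"
          using Im by (auto simp: sg_def split: if_splits)
        then show False using pos n0 by linarith
      qed
      then have prod: "(x - i) * (j - x) = (x - k) * (l - x)" using Im by (simp add: sg_def split: if_splits)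
      have "x \<noteq> i" "x \<noteq> j" "x \<noteq> k" "x \<noteq> l" using n0 prod by auto
      then have bd: "real i < x" "x < real j" "real k < x" "x < real l" using x y yx by auto
      then have "real k < real j" "real i < real l" by linarith+
      then have kj: "k < j" "i < l" by simp_all
      have ne: "(i, j) \<noteq> (k, l)" using ef ij kl by auto
      consider "i < k" | "k < i" | "i = k" "l \<le> j" | "i = k" "j \<le> l" by linarith
      then show False
      proof cases
        case 1
        then have "l \<le> j" using page[OF ij(2) kl(2) same] kj by blast
        then show False using strict[of i k l j] 1 ne bd prod by auto
      next
        case 2
        then have "j \<le> l" using page[OF kl(2) ij(2) same[symmetric]] kj by blast
        then show False using strict[of k i j l] 2 ne bd prod by auto
      next
        case 3
        then show False using strict[of i k l j] ne bd prod by auto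
      next
        case 4
        then show False using strict[of k i j l] ne bd prod by auto
      qed
    qed
    have "sg k l * ((x - k) * (l - x)) = 0" using Im unfolding zero by simp
    then have "(x - k) * (l - x) = 0" using sg0[of k l] by (simp only: mult_eq_0_iff simp_thms)
    with zero have ends: "x = i \<or> x = j" "x = k \<or> x = l" by auto
    then obtain v where v: "x = real v" "v \<in> e \<inter> f" using ij(1) kl(1) by auto
    have "z = p v" using x(1) ends(1) v(1) by (auto simp: p_def complex_of_real_def)
    then show "z \<in> p ` (e \<inter> f)" using v(2) by blast
  qed
  have "plane_drawing V ?E p \<gamma>"
    unfolding plane_drawing_def
    by (intro conjI ballI impI inj arcs[THEN conjunct1] arcs[THEN conjunct2] vert cross)
  then show ?thesis unfolding planar_def by blast
qed

text \<open>The edges of the Hamiltonian path include the rungs and one rail edge between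
  consecutive rungs. The second disjunct gives the other rail edge, the last two give the further
  edges of each apex: one to the end rung, one to the rung next to it.\<close>

definition chord :: "nat \<Rightarrow> nat \<Rightarrow> nat \<Rightarrow> bool" where
  "chord m i j \<longleftrightarrow> j = Suc i \<and> i < 2*m+5 \<or> odd i \<and> j = i + 3 \<and> i \<le> 2*m+1 \<or>
     i = 0 \<and> (j = 2 \<or> j = 3) \<or> j = 2*m+5 \<and> (i = 2*m+1 \<or> i = 2*m+3)"

text \<open>The vertices \<open>0\<close> and \<open>2*m+5\<close> are the apexes of the two triangles, \<open>{2*i+1, 2*i+2}\<close> are the
  rungs, and the vertices are numbered along a Hamiltonian path.\<close>

definition ladder :: "nat \<Rightarrow> nat set set" where
  "ladder m = {{i, j} | i j. chord m i j}"

lemma chord_less: "chord m i j \<Longrightarrow> i < j \<and> j < 2*m+6"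
  unfolding chord_def by auto

lemma ladderI: "chord m i j \<Longrightarrow> {i, j} \<in> ladder m"
  unfolding ladder_def by blast

lemma ladder_iff: "{u, v} \<in> ladder m \<longleftrightarrow> chord m u v \<or> chord m v u"
  unfolding ladder_def by (auto simp: doubleton_eq_iff)

lemma ladder_graph: "simple_graph {..<2*m+6} (ladder m)"
  unfolding simple_graph_def ladder_def using chord_less by fastforce

text \<open>Drives the forcing along the ladder: once all smaller vertices have other partners,
  \<open>2*i\<close> must take its successor.\<close>

lemma chord_from_even:
  assumes "chord m (2*i) w" "0 < i" shows "w = 2*i+1"
proof -
  have "2*i \<noteq> 2*m+1" "2*i \<noteq> 2*m+3" by presburger+
  then show ?thesis using assms by (simp add: chord_def)
qed

text \<open>Shaped for forcing when \<open>0\<close> is matched to \<open>2\<close>: the smaller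
  even vertices are then taken, which leaves \<open>2*i+4\<close> or, near the end, the far apex.
  The last alternative is the far apex itself.\<close>

lemma chord_odd_neighbour:
  assumes "chord m (2*i+1) w \<or> chord m w (2*i+1)"
  shows "even w \<and> w < 2*i+4 \<or> i \<le> m \<and> w = 2*i+4 \<or> w = 2*m+5 \<and> (i = m \<or> i = m+1) \<or> i = m+2"
  using assms
proof
  assume "chord m w (2*i+1)"
  then have "2*i+1 = Suc w \<or> odd w \<and> 2*i+1 = w + 3 \<or> w = 0 \<or> 2*i+1 = 2*m+5" by (auto simp: chord_def)
  then show ?thesis by presburger
qed (auto simp: chord_def)

lemma finite_ladder: "finite (ladder m)"
  by (rule finite_subset[of _ "Pow {..<2*m+6}"]) (use ladder_graph in \<open>auto simp: simple_graph_def\<close>)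

text \<open>For odd \<open>i\<close> the chords \<open>{i, i+3}\<close> and
  \<open>{i+2, i+5}\<close> interleave, so odd left ends alternate between the sides. Choosing the
  residue 1 modulo 4 keeps \<open>{1, 4}\<close> away from the long chords at \<open>0\<close>. Path
  edges enclose no vertex.\<close>

lemma ladder_planar: "planar V (ladder m)"
  unfolding ladder_def
proof (rule two_page_planar[where page = "\<lambda>i j. j = Suc i \<or> i mod 4 = 1"])
  fix i j k l
  assume c: "chord m i j" "chord m k l" and page: "(j = Suc i \<or> i mod 4 = 1) = (l = Suc k \<or> k mod 4 = 1)"
    and ik: "i < k" "k < j"
  show "l \<le> j"
  proof (cases "l = Suc k")
    case False
    have long: "odd a \<and> (b = a + 3 \<or> b = 2*m+5) \<or> a = 0 \<and> b \<le> 3" if "chord m a b" "b \<noteq> Suc a" for a b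
      using that by (auto simp: chord_def)
    have "j \<noteq> Suc i" using ik by simp
    then have mod: "i mod 4 = 1 \<longleftrightarrow> k mod 4 = 1" using page False by simp
    have k: "odd k" using long[OF c(2) False] ik by auto
    consider "j = 2*m+5" | "odd i" "j = i + 3" | "i = 0" "j \<le> 3" using long[OF c(1) \<open>j \<noteq> Suc i\<close>] by blast
    then show ?thesis
    proof cases
      case 1
      then show ?thesis using chord_less[OF c(2)] by simp
    next
      case 2
      then have "k = i + 2" using k ik by presburger
      then have False using mod 2(1) by presburger
      then show ?thesis ..
    next
      case 3
      then have "k = 1" using k ik by presburger
      then show ?thesis using mod 3 by simp
    qed
  qed (use ik in simp)
qed (simp add: chord_less)

text \<open>Path edges, skipped rail edges and the four further apex edges number
  \<open>(2*m+5) + (m+1) + 4\<close>, which is \<open>3*n/2 + 1\<close> for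
  \<open>n = 2*m+6\<close>.\<close>

lemma card_ladder: "card (ladder m) = 3*m+10"
proof -
  let ?P = "{(i, j). chord m i j}"
  have "ladder m = (\<lambda>(i, j). {i, j}) ` ?P" unfolding ladder_def by auto
  moreover have "inj_on (\<lambda>(i, j). {i, j}) ?P"
    by (rule inj_onI) (auto simp: doubleton_eq_iff dest!: chord_less)
  ultimately have "card (ladder m) = card ?P" by (simp add: card_image)
  let ?A = "(\<lambda>i. (i, Suc i)) ` {..<2*m+5}" and ?B = "(\<lambda>i. (2*i+1, 2*i+4)) ` {..m}"
    and ?C = "{(0, 2), (0, 3), (2*m+1, 2*m+5), (2*m+3, 2*m+5)}"
  have P: "?P = ?A \<union> ?B \<union> ?C"
  proof -
    have "(i, j) \<in> ?B \<longleftrightarrow> odd i \<and> j = i + 3 \<and> i \<le> 2*m+1" for i j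
      by (auto elim!: oddE)
    then show ?thesis by (auto simp: chord_def)
  qed
  have disj: "?A \<inter> ?B = {}" "(?A \<union> ?B) \<inter> ?C = {}" by auto
  have fin: "finite ?A" "finite ?B" "finite ?C" by auto
  have cards: "card ?A = 2*m+5" "card ?B = m+1" "card ?C = 4"
    by (subst card_image; simp add: inj_on_def)+ simp
  have "card ?P = card ?A + card ?B + card ?C"
    unfolding P card_Un_disjoint[OF finite_UnI[OF fin(1,2)] fin(3) disj(2)] card_Un_disjoint[OF fin(1,2) disj(1)] ..
  then have "card ?P = 2*m+5 + (m+1) + 4" unfolding cards .
  then show ?thesis using \<open>card (ladder m) = card ?P\<close> by simp
qed

lemma three_le_degree:
  assumes "finite E" "{v, a} \<in> E" "{v, b} \<in> E" "{v, c} \<in> E" "a \<noteq> b" "a \<noteq> c" "b \<noteq> c"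
  shows "3 \<le> degree E v"
proof -
  have "card {{v, a}, {v, b}, {v, c}} = 3" using assms(5-7) by (auto simp: card_insert_if doubleton_eq_iff)
  moreover have "card {{v, a}, {v, b}, {v, c}} \<le> card {e \<in> E. v \<in> e}"
    using assms by (intro card_mono) auto
  ultimately show ?thesis by (simp add: degree_def)
qed

lemma ladder_degree:
  assumes v: "v < 2*m+6" shows "3 \<le> degree (ladder m) v"
proof -
  have "v = 0 \<or> v = 2 \<or> v = 2*m+3 \<or> v = 2*m+5 \<or> odd v \<and> v \<le> 2*m+1 \<or> even v \<and> 4 \<le> v \<and> v \<le> 2*m+4"
    using v by presburger
  then consider "v = 0" | "v = 2" | "v = 2*m+3" | "v = 2*m+5" | "odd v" "v \<le> 2*m+1"
    | "even v" "4 \<le> v" "v \<le> 2*m+4" by blast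
  then show ?thesis
  proof cases
    case 1
    then show ?thesis
      by (intro three_le_degree[OF finite_ladder, of v 1 m 2 3]) (auto simp: ladder_iff chord_def)
  next
    case 2
    then show ?thesis
      by (intro three_le_degree[OF finite_ladder, of v 1 m 0 3]) (auto simp: ladder_iff chord_def)
  next
    case 3
    then show ?thesis
      by (intro three_le_degree[OF finite_ladder, of v "2*m+2" m "2*m+4" "2*m+5"]) (auto simp: ladder_iff chord_def)
  next
    case 4
    then show ?thesis
      by (intro three_le_degree[OF finite_ladder, of v "2*m+1" m "2*m+3" "2*m+4"]) (auto simp: ladder_iff chord_def)
  next
    case 5
    then have "0 < v" by (auto intro: odd_pos)
    then show ?thesis using 5
      by (intro three_le_degree[OF finite_ladder, of v "v - 1" m "v + 1" "v + 3"]) (auto simp: ladder_iff chord_def)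
  next
    case 6
    then show ?thesis
      by (intro three_le_degree[OF finite_ladder, of v "v - 1" m "v + 1" "v - 3"]) (auto simp: ladder_iff chord_def)
  qed
qed

lemma ladder_min_degree: "min_degree {..<2*m+6} (ladder m) = 3"
proof -
  have "{e \<in> ladder m. 2 \<in> e} \<subseteq> {{0, 2}, {1, 2}, {2, 3}}"
  proof
    fix e assume "e \<in> {e \<in> ladder m. 2 \<in> e}"
    then obtain i j where "e = {i, j}" "chord m i j" "i = 2 \<or> j = 2" unfolding ladder_def by auto
    then show "e \<in> {{0, 2}, {1, 2}, {2, 3}}" unfolding chord_def by auto
  qed
  then have "degree (ladder m) 2 \<le> card {{0, 2}, {1, 2}, {2, 3::nat}}"
    unfolding degree_def by (intro card_mono) simp_all
  also have "\<dots> \<le> 3" by (simp add: card_insert_if)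
  finally have "degree (ladder m) 2 = 3" using ladder_degree[of 2 m] by simp
  then show ?thesis
    unfolding min_degree_def using ladder_degree by (intro Min_eqI) (force intro!: image_eqI[of _ _ 2])+
qed

text \<open>Deleting \<open>s\<close> cuts the Hamiltonian path into at most two runs. Some chord
  jumps over \<open>s\<close>: a skipped rail edge in general, an apex chord for
  \<open>s = 1\<close> and \<open>s = 2*m+4\<close>.\<close>

lemma ladder_2_connected: "k_connected 2 {..<2*m+6} (ladder m)"
  unfolding k_connected_def
proof (intro conjI allI impI)
  fix S :: "nat set" assume S: "S \<subseteq> {..<2*m+6}" "card S < 2"
  let ?R = "{(x, y). {x, y} \<in> {e \<in> ladder m. e \<inter> S = {}}}"
  have finS: "finite S" using S(1) finite_lessThan by (rule finite_subset)
  have symR: "sym (?R\<^sup>*)" by (rule sym_rtrancl) (auto simp: sym_def insert_commute)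
  have run: "(i, i + d) \<in> ?R\<^sup>*" if "{i..i + d} \<inter> S = {}" "i + d < 2*m+6" for i d
    using that
  proof (induction d)
    case (Suc d)
    have "{i..i + d} \<inter> S = {}" using Suc.prems(1) by (auto simp: disjoint_iff)
    then have "(i, i + d) \<in> ?R\<^sup>*" using Suc.IH Suc.prems(2) by simp
    moreover have "i + d \<notin> S" "i + Suc d \<notin> S" using Suc.prems(1) by (auto simp: disjoint_iff)
    moreover have "{i + d, i + Suc d} \<in> ladder m"
      using Suc.prems(2) by (auto simp: ladder_iff chord_def)
    ultimately have "(i + d, i + Suc d) \<in> ?R" by simp
    then show ?case using \<open>(i, i + d) \<in> ?R\<^sup>*\<close> by (rule rtrancl_into_rtrancl[rotated])
  qed simp
  have run': "(i, j) \<in> ?R\<^sup>*" if "i \<le> j" "j < 2*m+6" "{i..j} \<inter> S = {}" for i j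
    using run[of i "j - i"] that by simp
  have up: "(u, v) \<in> ?R\<^sup>*" if uv: "u \<le> v" "u \<in> {..<2*m+6} - S" "v \<in> {..<2*m+6} - S" for u v
  proof (cases "{u..v} \<inter> S = {}")
    case True
    then show ?thesis using uv by (intro run') auto
  next
    case False
    then obtain s where s: "s \<in> S" "u \<le> s" "s \<le> v" by auto
    then have Ss: "S = {s}"
      using S(2) finS by (metis card_le_Suc0_iff_eq less_2_cases_iff less_or_eq_imp_le less_Suc_eq_le
          numeral_2_eq_2 insertI1 singletonD subset_antisym subsetI singleton_iff)
    have us: "u < s" "s < v" using s uv by (auto simp: le_less)
    have "\<exists>a b. a < s \<and> s < b \<and> b < 2*m+6 \<and> chord m a b"
    proof -
      have vn: "v < 2*m+6" using uv by simp
      have "s = 1 \<or> s = 2*m+4 \<or> even s \<and> 2 \<le> s \<and> s \<le> 2*m+2 \<or> odd s \<and> 3 \<le> s \<and> s \<le> 2*m+3"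
        using us vn by presburger
      then consider "s = 1" | "s = 2*m+4" | "even s" "2 \<le> s" "s \<le> 2*m+2" | "odd s" "3 \<le> s" "s \<le> 2*m+3"
        by blast
      then show ?thesis
      proof cases
        case 1 then show ?thesis by (intro exI[of _ 0] exI[of _ 2]) (auto simp: chord_def)
      next
        case 2 then show ?thesis by (intro exI[of _ "2*m+3"] exI[of _ "2*m+5"]) (auto simp: chord_def)
      next
        case 3 then show ?thesis by (intro exI[of _ "s - 1"] exI[of _ "s + 2"]) (auto simp: chord_def)
      next
        case 4 then show ?thesis by (intro exI[of _ "s - 2"] exI[of _ "s + 1"]) (auto simp: chord_def)
      qed
    qed
    then obtain a b where ab: "a < s" "s < b" "b < 2*m+6" "chord m a b" by blast
    have side: "(i, j) \<in> ?R\<^sup>*" if "i < s \<and> j < s \<or> s < i \<and> s < j" "i < 2*m+6" "j < 2*m+6" for i j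
    proof (cases "i \<le> j")
      case True
      then show ?thesis using that Ss by (intro run') auto
    next
      case False
      then have "(j, i) \<in> ?R\<^sup>*" using that Ss by (intro run') auto
      then show ?thesis using symR by (auto dest: symD)
    qed
    have "(u, a) \<in> ?R\<^sup>*" "(b, v) \<in> ?R\<^sup>*" using side[of u a] side[of b v] us ab uv by auto
    moreover have "(a, b) \<in> ?R" using ladderI[OF ab(4)] ab(1,2) Ss by auto
    ultimately show ?thesis by (meson rtrancl_into_rtrancl rtrancl_trans)
  qed
  show "graph_connected ({..<2*m+6} - S) {e \<in> ladder m. e \<inter> S = {}}"
    unfolding graph_connected_def
  proof (intro conjI ballI)
    show "{..<2*m+6} - S \<noteq> {}"
    proof
      assume "{..<2*m+6} - S = {}"
      then have "card {..<2*m+6} \<le> card S" using finS by (intro card_mono) auto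
      then show False using S(2) by simp
    qed
    fix u v assume uv: "u \<in> {..<2*m+6} - S" "v \<in> {..<2*m+6} - S"
    show "(u, v) \<in> ?R\<^sup>*"
    proof (cases "u \<le> v")
      case True
      then show ?thesis by (rule up[OF _ uv])
    next
      case False
      then have "v \<le> u" by simp
      then show ?thesis by (rule symD[OF symR up[OF _ uv(2,1)]])
    qed
  qed
qed simp

section \<open>The perfect matchings of the ladder\<close>

definition pairing :: "nat \<Rightarrow> nat set set" where
  "pairing m = (\<lambda>i. {2*i, 2*i+1}) ` {..<m+3}"

lemma pairing_perfect_matching: "perfect_matching {..<2*m+6} (ladder m) (pairing m)"
  unfolding perfect_matching_def matching_def
proof (intro conjI)
  show "pairing m \<subseteq> ladder m" by (auto simp: pairing_def ladder_iff chord_def)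
  show "disjoint (pairing m)" by (auto simp: pairing_def pairwise_def disjnt_def) presburger+
  show "\<Union>(pairing m) = {..<2*m+6}"
  proof (intro equalityI subsetI)
    fix v assume "v \<in> {..<2*m+6}"
    then have "v div 2 \<in> {..<m+3}" "v \<in> {2 * (v div 2), 2 * (v div 2) + 1}" by auto
    then show "v \<in> \<Union>(pairing m)" unfolding pairing_def by blast
  qed (auto simp: pairing_def)
qed

text \<open>A perfect matching is determined by the partners of the two apexes, as the rest of it is forced along
  the ladder.\<close>

lemma ladder_perfect_matchings:
  "{M. perfect_matching {..<2*m+6} (ladder m) M} \<subseteq>
    {pairing m,
     insert {0, 3} (insert {1, 2} ((\<lambda>i. {2*i, 2*i+1}) ` {2..<m+3})),
     insert {0, 2} (insert {2*m+3, 2*m+5} ((\<lambda>i. {2*i+1, 2*i+4}) ` {..<Suc m})),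
     insert {0, 2} (insert {2*m+1, 2*m+5} (insert {2*m+3, 2*m+4} ((\<lambda>i. {2*i+1, 2*i+4}) ` {..<m})))}"
  (is "_ \<subseteq> {?A, ?B, ?C, ?D}")
proof
  fix M assume "M \<in> {M. perfect_matching {..<2*m+6} (ladder m) M}"
  then have M: "M \<subseteq> ladder m" "disjoint M" "\<Union>M = {..<2*m+6}"
    by (simp_all add: perfect_matching_def matching_def)
  have same: "d = e" if "d \<in> M" "e \<in> M" "v \<in> d" "v \<in> e" for d e v
    using M(2) that unfolding disjoint_def by blast
  have clash1: "x = z" if "{x, y} \<in> M" "{y, z} \<in> M" for x y z
  proof -
    have "{x, y} = {y, z}" using same[OF that, of y] by simp
    then show ?thesis by (auto simp: doubleton_eq_iff)
  qed
  have clash2: "x = z" if "{x, y} \<in> M" "{z, y} \<in> M" for x y z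
    using clash1[of x y z] that by (simp add: insert_commute)
  have taken: "w \<noteq> 2*j \<and> w \<noteq> 2*j+1" if wi: "{2*i, w} \<in> M" and j: "{2*j, 2*j+1} \<in> M" and ji: "j < i" for i j w
  proof (intro conjI notI)
    assume "w = 2*j"
    then have "2*i = 2*j+1" using clash1[of "2*i" "2*j" "2*j+1"] j wi by simp
    then show False by presburger
  next
    assume "w = 2*j+1"
    then have "2*i = 2*j" using clash2[of "2*i" "2*j+1" "2*j"] j wi by simp
    then show False using ji by simp
  qed
  have ex: "\<exists>u. {v, u} \<in> M \<and> (chord m v u \<or> chord m u v)" if v: "v < 2*m+6" for v
  proof -
    have "v \<in> \<Union>M" using M(3) v by simp
    then obtain e where e: "e \<in> M" "v \<in> e" by blast
    then have "e \<in> ladder m" using M(1) by blast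
    then obtain i j where ij: "e = {i, j}" unfolding ladder_def by blast
    then obtain u where "e = {v, u}" using e(2) by auto
    then show ?thesis using e \<open>e \<in> ladder m\<close> ladder_iff by blast
  qed
  \<comment> \<open>A subset of \<open>M\<close> that covers all vertices is \<open>M\<close>
    itself, so each case only has to collect enough forced edges.\<close>
  have eqI: "M = N" if N: "N \<subseteq> M" "{..<2*m+6} \<subseteq> \<Union>N" for N
  proof (intro equalityI N(1) subsetI)
    fix e assume e: "e \<in> M"
    then obtain i j where "e = {i, j}" using M(1) unfolding ladder_def by blast
    then have i: "i \<in> e" by simp
    then have "i \<in> \<Union>N" using M(3) N(2) e by blast
    then obtain d where "d \<in> N" "i \<in> d" by blast
    then show "e \<in> N" using same[of e d i] e i N(1) by blast
  qed
  obtain u where u: "{0, u} \<in> M" "chord m 0 u \<or> chord m u 0" using ex[of 0] by auto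
  then consider "u = 1" | "u = 2" | "u = 3" unfolding chord_def by auto
  then show "M \<in> {?A, ?B, ?C, ?D}"
  proof cases
    case 1
    \<comment> \<open>Upwards through the even vertices: everything below \<open>2*i\<close> is
      already paired off, so only the successor remains.\<close>
    have "{2*i, 2*i+1} \<in> M" if "i < m+3" for i
      using that
    proof (induction i rule: less_induct)
      case (less i)
      show ?case
      proof (cases "i = 0")
        case True
        then show ?thesis using u 1 by simp
      next
        case False
        obtain w where w: "{2*i, w} \<in> M" "chord m (2*i) w \<or> chord m w (2*i)" using ex[of "2*i"] less.prems by auto
        have "w \<noteq> 2*j \<and> w \<noteq> 2*j+1" if "j < i" for j
          using less that by (intro taken[OF w(1)]) simp_all
        from this[of "w div 2"] have "\<not> w < 2*i" by presburger
        then have "chord m (2*i) w" using w(2) chord_less[of m w "2*i"] by blast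
        then have "w = 2*i+1" by (rule chord_from_even) (use False in simp)
        then show ?thesis using w(1) by simp
      qed
    qed
    then have "?A \<subseteq> M" by (auto simp: pairing_def)
    moreover have "{..<2*m+6} \<subseteq> \<Union>?A"
      using pairing_perfect_matching[of m] by (simp add: perfect_matching_def)
    ultimately have "M = ?A" by (rule eqI)
    then show ?thesis by blast
  next
    case 3
    \<comment> \<open>The neighbours of \<open>2\<close> are \<open>0\<close>, \<open>1\<close> and
      \<open>3\<close>. As \<open>0\<close> and \<open>3\<close> are matched to each other,
      \<open>2\<close> takes \<open>1\<close>, and from \<open>4\<close> on the even vertices are
      forced as before.\<close>
    obtain w where w: "{2, w} \<in> M" "chord m 2 w \<or> chord m w 2" using ex[of 2] by auto
    have "w \<noteq> 0" by (rule notI) (use clash1[of 2 0 3] u(1) 3 w(1) in simp)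
    moreover have "w \<noteq> 3" by (rule notI) (use clash2[of 2 3 0] u(1) 3 w(1) in simp)
    ultimately have "w = 1" using w(2) by (auto simp: chord_def)
    then have e12: "{1, 2} \<in> M" using w(1) by (simp add: insert_commute)
    have e03: "{0, 3} \<in> M" using u 3 by simp
    have "{2*i, 2*i+1} \<in> M" if "2 \<le> i" "i < m+3" for i
      using that
    proof (induction i rule: less_induct)
      case (less i)
      obtain w where w: "{2*i, w} \<in> M" "chord m (2*i) w \<or> chord m w (2*i)" using ex[of "2*i"] less.prems by auto
      have "w \<noteq> 0" "w \<noteq> 1" "w \<noteq> 2" "w \<noteq> 3"
        by (rule notI, use clash1[of "2*i" 0 3] clash1[of "2*i" 1 2] clash2[of "2*i" 2 1] clash2[of "2*i" 3 0]
          e12 e03 w(1) less.prems in simp)+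
      moreover have "w \<noteq> 2*j \<and> w \<noteq> 2*j+1" if "2 \<le> j" "j < i" for j
        using less that by (intro taken[OF w(1)]) simp_all
      from this[of "w div 2"] have "\<not> (4 \<le> w \<and> w < 2*i)" by presburger
      ultimately have "\<not> w < 2*i" by presburger
      then have "chord m (2*i) w" using w(2) chord_less[of m w "2*i"] by blast
      then have "w = 2*i+1" by (rule chord_from_even) (use less.prems in simp)
      then show ?case using w(1) by simp
    qed
    then have "?B \<subseteq> M" using e12 e03 by auto
    moreover have "{..<2*m+6} \<subseteq> \<Union>?B"
    proof
      fix v assume v: "v \<in> {..<2*m+6}"
      show "v \<in> \<Union>?B"
      proof (cases "v < 4")
        case True
        then have "v \<in> {0, 3} \<union> {1, 2}" by auto
        then show ?thesis by auto
      next
        case False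
        then have "v div 2 \<in> {2..<m+3}" "v \<in> {2 * (v div 2), 2 * (v div 2) + 1}" using v by auto
        then show ?thesis by blast
      qed
    qed
    ultimately have "M = ?B" by (rule eqI)
    then show ?thesis by blast
  next
    case 2
    have e02: "{0, 2} \<in> M" using u 2 by simp
    \<comment> \<open>Here the forcing runs through the odd vertices. The even vertices below
      \<open>v + 3\<close> are \<open>0\<close>, \<open>2\<close> and the upper ends
      \<open>2*i+4\<close> of edges already found.\<close>
    have used: "w \<noteq> 2*j"
      if "{v, w} \<in> M" "odd v" "2*j < v + 3" "\<And>i. 2*i+1 < v \<Longrightarrow> {2*i+1, 2*i+4} \<in> M" for v w j
    proof
      assume wj: "w = 2*j"
      show False
      proof (cases "j \<le> 1")
        case True
        then have "w = 0 \<or> w = 2" using wj by auto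
        then show False using clash1[of v 0 2] clash2[of v 2 0] e02 that(1,2) by auto
      next
        case False
        then obtain i where i: "j = i + 2" by (metis add.commute le_add_diff_inverse not_less_eq_eq Suc_1)
        then have "{2*i+1, 2*i+4} \<in> M" using that(2,3) by (intro that(4)) presburger
        moreover have "w = 2*i+4" using wj i by simp
          ultimately have "v = 2*i+1" using clash2[of v "2*i+4" "2*i+1"] that(1) by simp
        then show False using that(3) i by simp
      qed
    qed
    have step: "{2*i+1, 2*i+4} \<in> M" if "i < m" for i
      using that
    proof (induction i rule: less_induct)
      case (less i)
      obtain w where w: "{2*i+1, w} \<in> M" "chord m (2*i+1) w \<or> chord m w (2*i+1)"
        using ex[of "2*i+1"] less.prems by auto
      have "w \<noteq> 2*j" if "2*j < 2*i+4" for j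
        by (rule used[OF w(1)]) (use that less in auto)
      from this[of "w div 2"] have "\<not> (even w \<and> w < 2*i+4)" by presburger
      then have "w = 2*i+4" using chord_odd_neighbour[OF w(2)] less.prems by auto
      then show ?case using w(1) by simp
    qed
    \<comment> \<open>A choice is left only at the far end: one of \<open>2*m+1\<close> and
      \<open>2*m+3\<close> takes \<open>2*m+4\<close>, the other the apex
      \<open>2*m+5\<close>.\<close>
    obtain w where w: "{2*m+1, w} \<in> M" "chord m (2*m+1) w \<or> chord m w (2*m+1)" using ex[of "2*m+1"] by auto
    have "w \<noteq> 2*j" if "2*j < 2*m+4" for j
      by (rule used[OF w(1)]) (use that step in auto)
    from this[of "w div 2"] have "\<not> (even w \<and> w < 2*m+4)" by presburger
    then have w2: "w = 2*m+4 \<or> w = 2*m+5" using chord_odd_neighbour[OF w(2)] by auto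
    obtain x where x: "{2*m+3, x} \<in> M" "chord m (2*m+3) x \<or> chord m x (2*m+3)" using ex[of "2*m+3"] by auto
    have wx: "x \<noteq> w" using clash2[of "2*m+3" w "2*m+1"] w(1) x(1) by auto
    have x2: "x \<noteq> 2*m+2" "x \<noteq> 0"
    proof -
      show "x \<noteq> 0" by (rule notI) (use clash1[of "2*m+3" 0 2] e02 x(1) in simp)
      show "x \<noteq> 2*m+2"
      proof
        assume xm: "x = 2*m+2"
        show False
        proof (cases m)
          case 0
          then have "x = 2" "2*m+3 = 3" using xm by simp_all
          then show False using clash2[of 3 2 0] e02 x(1) by simp
        next
          case (Suc k)
          then have "{2*k+1, 2*k+4} \<in> M" using step by simp
          moreover have "x = 2*k+4" using xm Suc by simp
          ultimately have "2*m+3 = 2*k+1" using clash2[of "2*m+3" "2*k+4" "2*k+1"] x(1) by simp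
          then show False using Suc by simp
        qed
      qed
    qed
    have x3: "x = 2*m+4 \<or> x = 2*m+5" using x(2) x2 by (auto simp: chord_def)
    have cover: "v \<in> {0, 2} \<or> v \<in> {2*m+1, 2*m+3, 2*m+4, 2*m+5} \<or> (\<exists>i<m. v \<in> {2*i+1, 2*i+4})"
      if v: "v < 2*m+6" for v
    proof -
      have "v = 0 \<or> v = 2 \<or> v = 2*m+1 \<or> v = 2*m+3 \<or> v = 2*m+4 \<or> v = 2*m+5 \<or> odd v \<and> v < 2*m
          \<or> even v \<and> 4 \<le> v \<and> v < 2*m+4"
        using v by presburger
      then consider "v \<in> {0, 2}" | "v \<in> {2*m+1, 2*m+3, 2*m+4, 2*m+5}" | "odd v" "v < 2*m"
        | "even v" "4 \<le> v" "v < 2*m+4" by blast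
      then show ?thesis
      proof cases
        case 3
        then have "v div 2 < m" "v = 2 * (v div 2) + 1" by presburger+
        then show ?thesis by blast
      next
        case 4
        then have "v div 2 - 2 < m" "v = 2 * (v div 2 - 2) + 4" by presburger+
        then show ?thesis by blast
      qed blast+
    qed
    from w2 show ?thesis
    proof
      assume w4: "w = 2*m+4"
      then have "{2*m+3, 2*m+5} \<in> M" "{2*m+1, 2*m+4} \<in> M" using x3 wx x(1) w(1) by auto
      then have "?C \<subseteq> M" using e02 step by (auto simp: less_Suc_eq)
      moreover have "{..<2*m+6} \<subseteq> \<Union>?C" using cover by (fastforce simp: less_Suc_eq)
      ultimately have "M = ?C" by (rule eqI)
      then show ?thesis by blast
    next
      assume w5: "w = 2*m+5"
      then have "{2*m+3, 2*m+4} \<in> M" "{2*m+1, 2*m+5} \<in> M" using x3 wx x(1) w(1) by auto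
      then have "?D \<subseteq> M" using e02 step by auto
      moreover have "{..<2*m+6} \<subseteq> \<Union>?D" using cover by fastforce
      ultimately have "M = ?D" by (rule eqI)
      then show ?thesis by blast
    qed
  qed
qed

lemma card_ladder_perfect_matchings_le:
  "card {M. perfect_matching {..<2*m+6} (ladder m) M} \<le> 4"
proof -
  have *: "card {A, B, C, D} \<le> 4" for A B C D :: "nat set set" by (simp add: card_insert_if)
  show ?thesis by (rule order_trans[OF card_mono[OF _ ladder_perfect_matchings] *]) simp
qed

theorem theorem1:
  fixes n :: nat
  assumes "even n" and "n \<ge> 6"
  shows "(\<exists>(V :: nat set) E.
            simple_graph V E \<and> card V = n \<and> planar V E \<and> k_connected 2 V E \<and>
            card {M. perfect_matching V E M} = 4 \<and>
            min_degree V E = 3 \<and>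
            real (card E) = 3 * real n / 2 + 1) \<and>
         (\<forall>(V :: 'a set) E.
            simple_graph V E \<and> card V = n \<and> planar V E \<and> k_connected 2 V E \<and>
            min_degree V E = 3 \<and> (\<exists>M. perfect_matching V E M) \<longrightarrow>
            4 \<le> card {M. perfect_matching V E M})"
proof (intro conjI allI impI)
  define m where "m = n div 2 - 3"
  have n: "n = 2*m+6" using assms unfolding m_def by presburger
  let ?V = "{..<2*m+6}"
  \<comment> \<open>The general lower bound, applied to the ladder, already gives four. With the
    list of four candidates equality follows, so these need no separate proof of being distinct or
    of being perfect matchings.\<close>
  have "4 \<le> card {M. perfect_matching ?V (ladder m) M}"
    using ladder_degree pairing_perfect_matching
    by (intro four_perfect_matchings[OF ladder_graph]
        k_connected_2_biconnected[OF ladder_graph ladder_2_connected]) auto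
  then have "card {M. perfect_matching ?V (ladder m) M} = 4"
    using card_ladder_perfect_matchings_le[of m] by simp
  then show "\<exists>(V :: nat set) E.
            simple_graph V E \<and> card V = n \<and> planar V E \<and> k_connected 2 V E \<and>
            card {M. perfect_matching V E M} = 4 \<and>
            min_degree V E = 3 \<and>
            real (card E) = 3 * real n / 2 + 1"
    using ladder_graph ladder_planar ladder_2_connected ladder_min_degree card_ladder[of m] n
    by (intro exI[of _ ?V] exI[of _ "ladder m"]) simp
next
  fix V :: "'a set" and E
  assume G: "simple_graph V E \<and> card V = n \<and> planar V E \<and> k_connected 2 V E \<and>
    min_degree V E = 3 \<and> (\<exists>M. perfect_matching V E M)"
  have "3 \<le> degree E v" if "v \<in> V" for v
  proof -
    have "finite V" using G by (simp add: simple_graph_def)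
    then have "min_degree V E \<le> degree E v" unfolding min_degree_def using that by (intro Min_le) auto
    then show ?thesis using G by simp
  qed
  then show "4 \<le> card {M. perfect_matching V E M}"
    using G assms(2) k_connected_2_biconnected by (intro four_perfect_matchings) auto
qed

end
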